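(* Let $(\Omega,\mathcal{B},\mu)$ be a $\sigma$-finite measure space with $\mu(\Omega)=\infty$, let $T:\Omega\to\Omega$ be a conservative, invertible, ergodic, measure-preserving transformation, let $f:\Omega\to\mathbb{R}$ be bounded and measurable, and for $\omega\in\Omega$ let $H_\omega$ be the bounded self-adjoint operator on $\ell^2(\mathbb{Z})$ given by $(H_\omega u)_n=u_{n-1}+u_{n+1}+f(T^n\omega)u_n$. Then there exist compact sets $\Sigma_{\mathrm{ac}},\Sigma_{\mathrm{sc}},\Sigma_{\mathrm{pp}}\subseteq\mathbb{R}$ such that for $\mu$-almost every $\omega\in\Omega$ one has $\sigma_\bullet(H_\omega)=\Sigma_\bullet$ for each $\bullet\in\{\mathrm{ac},\mathrm{sc},\mathrm{pp}\}$.
   Context: A measurable transformation $T$ is: invertible if it is bijective and $T^{-1}$ is measurable; measure-preserving if $\mu(T^{-1}E)=\mu(E)$ for all $E\in\mathcal{B}$; ergodic if $T^{-1}E=E$ (with $E\in\mathcal{B}$) implies $\mu(E)=0$ or $\mu(\Omega\setminus E)=0$; conservative if there is no $W\in\mathcal{B}$ with $\mu(W)>0$ such that the sets $T^{-n}W$, $n\ge 0$, are pairwise disjoint. For a bounded self-adjoint operator $H$, $\sigma_{\mathrm{ac}}(H)$, $\sigma_{\mathrm{sc}}(H)$, $\sigma_{\mathrm{pp}}(H)$ denote the spectra of the restrictions of $H$ to its absolutely continuous, singular continuous and pure point subspaces, respectively (these are the subspaces of vectors whose spectral measure with respect to $H$ is absolutely continuous with respect to Lebesgue measure, singular continuous,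 respectively pure point); the spectrum of an operator on the zero space is empty. *)

theory Defs
  imports "HOL-Analysis.Analysis"
begin

section \<open>Transformations of a measure space\<close>

definition invertible_map :: "'a measure \<Rightarrow> ('a \<Rightarrow> 'a) \<Rightarrow> bool" where
  "invertible_map M T \<longleftrightarrow>
     T \<in> measurable M M \<and> bij_betw T (space M) (space M) \<and>
     inv_into (space M) T \<in> measurable M M"

definition measure_preserving :: "'a measure \<Rightarrow> ('a \<Rightarrow> 'a) \<Rightarrow> bool" where
  "measure_preserving M T \<longleftrightarrow>
     T \<in> measurable M M \<and>
     (\<forall>E\<in>sets M. emeasure M (T -` E \<inter> space M) = emeasure M E)"

definition ergodic :: "'a measure \<Rightarrow> ('a \<Rightarrow> 'a) \<Rightarrow> bool" where
  "ergodic M T \<longleftrightarrow>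
     (\<forall>E\<in>sets M. T -` E \<inter> space M = E \<longrightarrow>
        emeasure M E = 0 \<or> emeasure M (space M - E) = 0)"

definition conservative :: "'a measure \<Rightarrow> ('a \<Rightarrow> 'a) \<Rightarrow> bool" where
  "conservative M T \<longleftrightarrow>
     \<not> (\<exists>W\<in>sets M. emeasure M W > 0 \<and>
            disjoint_family (\<lambda>n::nat. (T ^^ n) -` W \<inter> space M))"

definition int_iterate :: "'a measure \<Rightarrow> ('a \<Rightarrow> 'a) \<Rightarrow> int \<Rightarrow> 'a \<Rightarrow> 'a" where
  "int_iterate M T n =
     (if n \<ge> 0 then T ^^ nat n else inv_into (space M) T ^^ nat (- n))"


section \<open>The Hilbert space of square-summable two-sided sequences\<close>

text \<open>
  Operators are functions on all two-sided complex sequences; only their values on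
  \<open>ell2\<close> matter. The inner product is linear in its second argument.
\<close>

definition ell2 :: "(int \<Rightarrow> complex) set" where
  "ell2 = {u. (\<lambda>n. (cmod (u n))\<^sup>2) summable_on UNIV}"

definition ell2_inner :: "(int \<Rightarrow> complex) \<Rightarrow> (int \<Rightarrow> complex) \<Rightarrow> complex" where
  "ell2_inner u v = (\<Sum>\<^sub>\<infinity>n. cnj (u n) * v n)"

definition ell2_norm :: "(int \<Rightarrow> complex) \<Rightarrow> real" where
  "ell2_norm u = sqrt (\<Sum>\<^sub>\<infinity>n. (cmod (u n))\<^sup>2)"

type_synonym operator = "(int \<Rightarrow> complex) \<Rightarrow> (int \<Rightarrow> complex)"

definition hamiltonian ::
    "'a measure \<Rightarrow> ('a \<Rightarrow> 'a) \<Rightarrow> ('a \<Rightarrow> real) \<Rightarrow> 'a \<Rightarrow> operator" where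
  "hamiltonian M T f \<omega> u =
     (\<lambda>n. u (n - 1) + u (n + 1) + complex_of_real (f (int_iterate M T n \<omega>)) * u n)"

text \<open>
  The spectrum of the restriction of \<open>A\<close> to an \<open>A\<close>-invariant closed subspace \<open>X\<close>:
  the complement of those \<open>z\<close> for which \<open>A - z\<close> maps \<open>X\<close> bijectively onto \<open>X\<close> with
  bounded inverse. For the zero subspace it is empty.
\<close>

definition spectrum_on :: "(int \<Rightarrow> complex) set \<Rightarrow> operator \<Rightarrow> complex set" where
  "spectrum_on X A =
     {z. \<not> (bij_betw (\<lambda>u n. A u n - z * u n) X X \<and>
            (\<exists>C. \<forall>u\<in>X. ell2_norm u \<le> C * ell2_norm (\<lambda>n. A u n - z * u n)))}"


section \<open>Spectral measures\<close>

definition orthogonal_projection :: "operator \<Rightarrow> bool" where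
  "orthogonal_projection P \<longleftrightarrow>
     P ` ell2 \<subseteq> ell2 \<and>
     (\<forall>a b. \<forall>u\<in>ell2. \<forall>v\<in>ell2.
        P (\<lambda>n. a * u n + b * v n) = (\<lambda>n. a * P u n + b * P v n)) \<and>
     (\<forall>u\<in>ell2. P (P u) = P u) \<and>
     (\<forall>u\<in>ell2. \<forall>v\<in>ell2. ell2_inner u (P v) = ell2_inner (P u) v)"

text \<open>Countable additivity is with respect to strong convergence.\<close>

definition projection_valued_measure :: "(real set \<Rightarrow> operator) \<Rightarrow> bool" where
  "projection_valued_measure E \<longleftrightarrow>
     (\<forall>B\<in>sets borel. orthogonal_projection (E B)) \<and>
     (\<forall>u\<in>ell2. E UNIV u = u) \<and>
     (\<forall>B :: nat \<Rightarrow> real set. range B \<subseteq> sets borel \<longrightarrow> disjoint_family B \<longrightarrow>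
        (\<forall>u\<in>ell2. (\<lambda>N. ell2_norm (\<lambda>n. (\<Sum>i<N. E (B i) u n) - E (\<Union>i. B i) u n))
                    \<longlonglongrightarrow> 0))"

text \<open>The Borel measure \<open>B \<mapsto> \<langle>u, E(B) u\<rangle>\<close>.\<close>

definition vector_measure ::
    "(real set \<Rightarrow> operator) \<Rightarrow> (int \<Rightarrow> complex) \<Rightarrow> real measure" where
  "vector_measure E u =
     measure_of UNIV (sets borel) (\<lambda>B. ennreal (Re (ell2_inner u (E B u))))"

text \<open>
  \<open>A = \<integral> x dE(x)\<close> for a bounded self-adjoint operator \<open>A\<close>: \<open>E\<close> is a projection-valued
  measure with bounded support, and the integral is taken in the sense of quadratic
  forms.
\<close>

definition spectral_resolution :: "operator \<Rightarrow> (real set \<Rightarrow> operator) \<Rightarrow> bool" where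
  "spectral_resolution A E \<longleftrightarrow>
     projection_valued_measure E \<and>
     (\<exists>R. \<forall>u\<in>ell2. E (- {-R..R}) u = (\<lambda>n. 0)) \<and>
     (\<forall>u\<in>ell2. ell2_inner u (A u) =
        complex_of_real (integral\<^sup>L (vector_measure E u) (\<lambda>x. x)))"

text \<open>
  By the spectral theorem, this is well defined if \<open>A\<close> is bounded and self-adjoint and
  \<open>u \<in> ell2\<close>; the values of the spectral resolution on Borel sets and on \<open>ell2\<close> are
  unique, and the measure depends only on these.
\<close>

definition spectral_measure :: "operator \<Rightarrow> (int \<Rightarrow> complex) \<Rightarrow> real measure" where
  "spectral_measure A u =
     (THE \<nu>. \<exists>E. spectral_resolution A E \<and> \<nu> = vector_measure E u)"


section \<open>The parts of the spectrum\<close>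

definition singular_continuous :: "real measure \<Rightarrow> bool" where
  "singular_continuous \<nu> \<longleftrightarrow>
     (\<exists>S\<in>sets borel. emeasure lborel S = 0 \<and> emeasure \<nu> (- S) = 0) \<and>
     (\<forall>x. emeasure \<nu> {x} = 0)"

definition pure_point :: "real measure \<Rightarrow> bool" where
  "pure_point \<nu> \<longleftrightarrow> (\<exists>S. countable S \<and> emeasure \<nu> (- S) = 0)"

definition ac_subspace :: "operator \<Rightarrow> (int \<Rightarrow> complex) set" where
  "ac_subspace A = {u \<in> ell2. absolutely_continuous lborel (spectral_measure A u)}"

definition sc_subspace :: "operator \<Rightarrow> (int \<Rightarrow> complex) set" where
  "sc_subspace A = {u \<in> ell2. singular_continuous (spectral_measure A u)}"

definition pp_subspace :: "operator \<Rightarrow> (int \<Rightarrow> complex) set" where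
  "pp_subspace A = {u \<in> ell2. pure_point (spectral_measure A u)}"

definition ac_spectrum :: "operator \<Rightarrow> complex set" where
  "ac_spectrum A = spectrum_on (ac_subspace A) A"

definition sc_spectrum :: "operator \<Rightarrow> complex set" where
  "sc_spectrum A = spectrum_on (sc_subspace A) A"

definition pp_spectrum :: "operator \<Rightarrow> complex set" where
  "pp_spectrum A = spectrum_on (pp_subspace A) A"

end

(*
  The spectral theorem is obtained from the Hausdorff moment problem: for a symmetric operator A
  with norm at most R, the operators (R + A)^j (R - A)^k are positive, so the numbers <u, p(A) u>
  are the moments of a measure on [-R, R], a weak limit of discrete measures with Bernstein
  weights. Bounded Borel functions of A are strong limits of polynomials in A that converge almost
  everywhere with respect to a measure nu of maximal spectral type, and comparison with step
  operators shows that the spectral resolution is unique.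

  The points where the dyadic densities of nu are unbounded, together with the atoms of nu,
  partition the line into Borel sets B_ac, B_sc, B_pp such that each part of the spectrum is the
  support of nu restricted to the corresponding set. These sets depend measurably on omega when nu
  does, and whether a part charges a rational interval is a T-invariant condition on omega, because
  H_(T omega) is conjugate to H_omega by the shift. By ergodicity, each of these countably many
  conditions holds almost everywhere or almost nowhere.
*)
theory Submission
  imports Defs "HOL-Probability.Probability"
begin

text \<open>The obstacle is the dependence on \<omega>. A Lebesgue decomposition known only to exist
  would give no control over how its parts vary with \<omega>; the carrier sets are therefore given
  by a countable formula in the masses of dyadic intervals and points, which is measurable jointly
  in \<omega> and the energy. For the same reason the measure of maximal spectral type is an average
  over a fixed countable total family. It matters only up to equivalence: passing to
  \<open>T \<omega>\<close> permutes the family but not the weights, so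
  \<open>\<nu> (T \<omega>)\<close> need not equal \<open>\<nu> \<omega>\<close>. Invariance is thus
  proved for statements about the spectral measures of all vectors, a collection that is the same
  for both points. The complex space is treated as a real Hilbert space with a skew operator
  \<open>J\<close>, multiplication by i. Then A - (a + ib) is A - a - bJ, and its product with the
  conjugate shift is the real polynomial (A - a)^2 + b^2, so that real polynomials and real measures
  also serve non-real spectral parameters.\<close>

section \<open>The Hausdorff moment problem on a compact interval\<close>

lemma borel_measurable_poly [measurable]: "poly (p :: real poly) \<in> borel_measurable borel"
  by (intro borel_measurable_continuous_onI continuous_intros)

text \<open>Choosing k elements out of n and then j out of those k amounts to choosing the j first,
  which turns the sum into a binomial expansion of degree n - j. With s + r = 1 this is the j-th
  binomial moment of the binomial distribution. A general ring is taken because s and r will be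
  polynomials.\<close>

lemma bernstein_factorial_moment:
  fixes s r :: "'a::comm_ring_1"
  assumes "j \<le> n"
  shows "(\<Sum>k\<le>n. of_nat (k choose j) * (of_nat (n choose k) * s ^ k * r ^ (n - k))) =
         of_nat (n choose j) * s ^ j * (s + r) ^ (n - j)"
proof -
  let ?F = "\<lambda>k. of_nat (k choose j) * (of_nat (n choose k) * s ^ k * r ^ (n - k))"
  have "(\<Sum>k\<le>n. ?F k) = (\<Sum>k\<in>{j..n}. ?F k)"
    by (intro sum.mono_neutral_right) (auto simp: not_le binomial_eq_0)
  also have "\<dots> = (\<Sum>i\<le>n - j. ?F (j + i))"
    using sum.atLeastAtMost_shift_0[OF assms, of ?F] by (simp add: atMost_atLeast0)
  also have "\<dots> = (\<Sum>i\<le>n - j. of_nat (n choose j) * s ^ j *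
                     (of_nat ((n - j) choose i) * s ^ i * r ^ (n - j - i)))"
  proof (rule sum.cong[OF refl])
    fix i assume "i \<in> {..n - j}"
    then have "(n choose (j + i)) * ((j + i) choose j) = (n choose j) * ((n - j) choose i)"
      using choose_mult[of j "j + i" n] assms by simp
    then have "of_nat ((j + i) choose j) * of_nat (n choose (j + i)) =
        (of_nat (n choose j) * of_nat ((n - j) choose i) :: 'a)"
      by (metis mult.commute of_nat_mult)
    then show "?F (j + i) = of_nat (n choose j) * s ^ j *
                     (of_nat ((n - j) choose i) * s ^ i * r ^ (n - j - i))"
      by (simp add: power_add mult_ac) (metis mult.assoc)
  qed
  also have "\<dots> = of_nat (n choose j) * s ^ j * (s + r) ^ (n - j)"
    by (simp add: binomial_ring sum_distrib_left)
  finally show ?thesis .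
qed

text \<open>Each quotient is a product of j factors of modulus at most 1, so the difference of the
  products is at most the sum of the differences of corresponding factors. This lets exact binomial
  moments replace powers of k/n in the limit.\<close>

lemma binomial_ratio_bound:
  assumes "k \<le> n" "2 * j < n"
  shows "\<bar>real (k choose j) / real (n choose j) - (real k / real n) ^ j\<bar> \<le> j * (real j / (real n - real j))"
proof -
  have pos: "0 < real n - real i" if "i < j" for i using that assms by simp
  have "real (k choose j) / real (n choose j) = (\<Prod>i<j. (real k - real i) / (real n - real i))"
    by (simp add: binomial_gbinomial gbinomial_prod_rev prod_dividef lessThan_atLeast0)
  then have "\<bar>real (k choose j) / real (n choose j) - (real k / real n) ^ j\<bar>
     = norm ((\<Prod>i<j. (real k - real i) / (real n - real i)) - (\<Prod>i<j. real k / real n))"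
    by simp
  also have "\<dots> \<le> (\<Sum>i<j. norm ((real k - real i) / (real n - real i) - real k / real n))"
  proof (rule norm_prod_diff)
    fix i assume "i \<in> {..<j}"
    then have i: "i < j" by simp
    \<comment> \<open>For k < i this uses i - k \<le> i \<le> n - i, which is where
      \<open>2 * j < n\<close> enters.\<close>
    have "\<bar>real k - real i\<bar> \<le> real n - real i"
      using assms i by linarith
    then show "norm ((real k - real i) / (real n - real i)) \<le> 1"
      using pos[OF i] by simp
    show "norm (real k / real n) \<le> 1" using assms by (auto simp: divide_simps)
  qed
  also have "\<dots> \<le> (\<Sum>i<j. real j / (real n - real j))"
  proof (rule sum_mono)
    fix i assume "i \<in> {..<j}"
    then have i: "i < j" by simp
    have n: "0 < real n" using assms by simp
    have "(real k - real i) / (real n - real i) - real k / real n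
         = - (real i / (real n - real i) * ((real n - real k) / real n))"
      using pos[OF i] n by (simp add: field_simps)
    then have "norm ((real k - real i) / (real n - real i) - real k / real n)
         = real i / (real n - real i) * ((real n - real k) / real n)"
      using pos[OF i] n assms by (simp add: abs_mult)
    also have "\<dots> \<le> real i / (real n - real i) * 1"
      using pos[OF i] n assms by (intro mult_left_mono) auto
    also have "\<dots> \<le> real j / (real n - real j)"
      using i assms by (auto intro!: frac_le)
    finally show "norm ((real k - real i) / (real n - real i) - real k / real n) \<le> real j / (real n - real j)" .
  qed
  finally show ?thesis by simp
qed

section \<open>Weak limits of measures on an interval\<close>

lemma continuous_on_Icc_bounded:
  fixes f :: "real \<Rightarrow> real"
  assumes "continuous_on {a..b} f"
  shows "\<exists>B. \<forall>x\<in>{a..b}. norm (f x) \<le> B"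
  using compact_imp_bounded[OF compact_continuous_image[OF assms compact_Icc]]
  by (auto simp: bounded_iff)

text \<open>A common bounded support makes the sequence tight, so a subsequence converges weakly.
  Weak convergence tests only bounded continuous functions, which is enough: on the support any
  continuous function agrees with its composition with the clamp to [-R, R].\<close>

lemma weak_limit_compact_support:
  fixes \<mu> :: "nat \<Rightarrow> real measure"
  assumes rd: "\<And>n. real_distribution (\<mu> n)"
    and supp: "\<And>n. AE x in \<mu> n. x \<in> {-R..R}"
  obtains r M where "strict_mono (r :: nat \<Rightarrow> nat)" "real_distribution M" "AE x in M. x \<in> {-R..R}"
    "\<And>f :: real \<Rightarrow> real. continuous_on UNIV f \<Longrightarrow>
       (\<lambda>n. integral\<^sup>L (\<mu> (r n)) f) \<longlonglongrightarrow> integral\<^sup>L M f"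
proof -
  have R: "R \<ge> 0"
  proof (rule ccontr)
    interpret real_distribution "\<mu> 0" by fact
    assume "\<not> 0 \<le> R"
    then have "AE x in \<mu> 0. False" using supp[of 0] by simp
    then show False by simp
  qed
  have "tight \<mu>"
    unfolding tight_def
  proof (intro conjI allI impI)
    fix e :: real assume "0 < e"
    show "\<exists>a b. a < b \<and> (\<forall>n. 1 - e < measure (\<mu> n) {a<..b})"
    proof (intro exI conjI allI)
      show "-R-1 < R+1" using R by simp
      fix n
      interpret real_distribution "\<mu> n" by fact
      have "prob {-R-1<..R+1} = 1"
        using supp[of n] by (intro prob_eq_1[THEN iffD2]) (auto elim: eventually_mono)
      then show "1 - e < prob {-R-1<..R+1}" using \<open>0 < e\<close> by simp
    qed
  qed (rule rd)
  from tight_imp_convergent_subsubsequence[OF this strict_mono_id]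
  obtain r M where r: "strict_mono r" "real_distribution M" "weak_conv_m (\<mu> \<circ> r) M"
    by (auto simp: comp_def)
  interpret M: real_distribution M by fact
  have bc: "(\<lambda>n. integral\<^sup>L (\<mu> (r n)) f) \<longlonglongrightarrow> integral\<^sup>L M f"
    if "continuous_on UNIV f" "\<And>x. norm (f x) \<le> B" for f :: "real \<Rightarrow> real" and B
    using weak_conv_imp_integral_bdd_continuous_conv[of "\<mu> \<circ> r" M f B] rd r that
    by (auto simp: comp_def continuous_on_eq_continuous_at)
  \<comment> \<open>A bounded continuous function vanishing exactly on [-R, R]; its zero integrals
    pass to the limit and keep the limit measure on the interval.\<close>
  define h where "h x = min 1 (max 0 (\<bar>x\<bar> - R))" for x
  have h0: "h x = 0 \<longleftrightarrow> x \<in> {-R..R}" for x by (auto simp: h_def min_def max_def)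
  have hc: "continuous_on UNIV h" unfolding h_def by (intro continuous_intros)
  have hm[measurable]: "h \<in> borel_measurable borel" using hc by (rule borel_measurable_continuous_onI)
  have hb: "norm (h x) \<le> 1" for x by (auto simp: h_def)
  have "integral\<^sup>L (\<mu> (r n)) h = 0" for n
    using supp[of "r n"] by (intro integral_eq_zero_AE) (auto simp: h0 elim!: eventually_mono)
  with bc[OF hc hb] have h00: "integral\<^sup>L M h = 0" by (simp add: LIMSEQ_const_iff)
  have "integrable M h" by (rule M.integrable_const_bound[where B=1]) (use hb in auto)
  then have supM: "AE x in M. x \<in> {-R..R}"
    using integral_nonneg_eq_0_iff_AE[of M h] h00 h0 by (auto simp: h_def)
  show ?thesis
  proof (rule that[OF r(1,2) supM])
    fix f :: "real \<Rightarrow> real" assume f: "continuous_on UNIV f"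
    define g where "g x = f (max (-R) (min R x))" for x
    have cl: "max (-R) (min R x) \<in> {-R..R}" for x using R by auto
    have gc: "continuous_on UNIV g" unfolding g_def
      by (rule continuous_on_compose2[OF f]) (auto intro!: continuous_intros)
    obtain B where "\<And>y. y \<in> {-R..R} \<Longrightarrow> norm (f y) \<le> B"
      using continuous_on_Icc_bounded[OF continuous_on_subset[OF f subset_UNIV]] by blast
    then have "norm (g x) \<le> B" for x using cl[of x] unfolding g_def by blast
    from bc[OF gc this] have *: "(\<lambda>n. integral\<^sup>L (\<mu> (r n)) g) \<longlonglongrightarrow> integral\<^sup>L M g" .
    have [measurable]: "f \<in> borel_measurable borel" "g \<in> borel_measurable borel"
      using f gc by (auto intro: borel_measurable_continuous_onI)
    have gf: "x \<in> {-R..R} \<Longrightarrow> g x = f x" for x by (simp add: g_def)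
    have "integral\<^sup>L (\<mu> n) g = integral\<^sup>L (\<mu> n) f" for n
    proof -
      interpret real_distribution "\<mu> n" by fact
      have "AE x in \<mu> n. g x = f x" using supp[of n] by (rule eventually_mono) (rule gf)
      then show ?thesis by (intro integral_cong_AE) auto
    qed
    moreover have "integral\<^sup>L M g = integral\<^sup>L M f"
      by (intro integral_cong_AE eventually_mono[OF supM] gf) auto
    ultimately show "(\<lambda>n. integral\<^sup>L (\<mu> (r n)) f) \<longlonglongrightarrow> integral\<^sup>L M f" using * by simp
  qed
qed

lemma discrete_distribution:
  fixes x :: "nat \<Rightarrow> real" and w :: "nat \<Rightarrow> real"
  assumes w: "\<And>k. k \<le> n \<Longrightarrow> 0 \<le> w k" "(\<Sum>k\<le>n. w k) = 1"
    and x: "\<And>k. k \<le> n \<Longrightarrow> x k \<in> A" and A: "A \<in> sets borel"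
  obtains M where "real_distribution M" "AE y in M. y \<in> A"
    "\<And>f :: real \<Rightarrow> real. f \<in> borel_measurable borel \<Longrightarrow> integral\<^sup>L M f = (\<Sum>k\<le>n. w k * f (x k))"
proof -
  define P where "P = point_measure {..n} (\<lambda>k. ennreal (w k))"
  have P: "prob_space P"
    proof (rule prob_spaceI)
    have "emeasure P (space P) = (\<Sum>k\<le>n. ennreal (w k))"
      by (simp add: P_def emeasure_point_measure_finite space_point_measure)
    also have "\<dots> = ennreal (\<Sum>k\<le>n. w k)" using w(1) by (intro sum_ennreal) auto
    finally show "emeasure P (space P) = 1" using w(2) by simp
  qed
  interpret P: prob_space P by fact
  have [measurable]: "x \<in> borel_measurable P" by (simp add: P_def)
  interpret D: prob_space "distr P borel x" by (rule P.prob_space_distr) simp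
  show ?thesis
  proof (rule that[of "distr P borel x"])
    show "real_distribution (distr P borel x)" by standard simp
    show "AE y in distr P borel x. y \<in> A"
      using x A by (subst AE_distr_iff) (auto simp: P_def AE_point_measure space_point_measure)
    fix f :: "real \<Rightarrow> real" assume "f \<in> borel_measurable borel"
    then have "integral\<^sup>L (distr P borel x) f = (\<integral>k. f (x k) \<partial>P)"
      by (simp add: integral_distr)
    also have "\<dots> = (\<Sum>k\<le>n. w k * f (x k))"
      unfolding P_def using w(1) by (subst lebesgue_integral_point_measure_finite) auto
    finally show "integral\<^sup>L (distr P borel x) f = (\<Sum>k\<le>n. w k * f (x k))" .
  qed
qed

text \<open>In the coordinate t, the value of \<open>L\<close> on a Bernstein polynomial is a weight
  at the node k/n. The weights are nonnegative by \<open>pos\<close>, and their binomial moments are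
  exactly those of \<open>L\<close> by \<open>bernstein_factorial_moment\<close>; the j-th powers of
  the nodes differ from normalised binomial coefficients by O(1/n). A weak limit of the weighted
  nodes therefore has the moments of \<open>L\<close>.\<close>

lemma hausdorff_moment_problem:
  fixes L :: "real poly \<Rightarrow> real" and R :: real
  assumes R: "R > 0"
    and add: "\<And>p q. L (p + q) = L p + L q"
    and smult: "\<And>c p. L (smult c p) = c * L p"
    and one: "L 1 = 1"
    and pos: "\<And>j k. L ([:R, 1:] ^ j * [:R, -1:] ^ k) \<ge> 0"
  obtains M where "real_distribution M" "AE x in M. x \<in> {-R..R}" "\<And>p. (\<integral>x. poly p x \<partial>M) = L p"
proof -
  \<comment> \<open>Affine coordinates (R + x)/(2R) and (R - x)/(2R): on [-R, R] they lie in [0, 1],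
    and they add up to 1.\<close>
  define t where "t = smult (1 / (2 * R)) [:R, 1:]"
  define u where "u = smult (1 / (2 * R)) [:R, -1:]"
  have tu: "t + u = 1" using R by (simp add: t_def u_def one_pCons)
  have zero: "L 0 = 0" using smult[of 0 0] by simp
  have Lsum: "L (\<Sum>i\<in>I. g i) = (\<Sum>i\<in>I. L (g i))" if "finite I" for g and I :: "nat set"
    using that by (induction I rule: finite_induct) (auto simp: zero add)
  define w where "w n k = L (of_nat (n choose k) * t ^ k * u ^ (n - k))" for n k
  have w0: "w n k \<ge> 0" for n k
  proof -
    have "of_nat (n choose k) * t ^ k * u ^ (n - k) =
       smult (real (n choose k) * ((1/(2*R))^k * (1/(2*R))^(n-k))) ([:R, 1:] ^ k * [:R, -1:] ^ (n - k))"
      unfolding t_def u_def smult_power of_nat_poly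
      by (simp only: mult_smult_left mult_smult_right smult_smult mult.assoc mult_1_left one_pCons[symmetric] mult_pCons_left smult_1_left) (simp add: mult_ac)
    then show ?thesis using pos[of k "n-k"] R
      by (simp add: w_def smult)
  qed
  have L_nat: "L (of_nat c * p) = real c * L p" for c p
    using smult[of "real c" p] by (simp add: of_nat_poly)
  have fm: "(\<Sum>k\<le>n. w n k * real (k choose j)) = real (n choose j) * L (t ^ j)" if "j \<le> n" for n j
  proof -
    have "(\<Sum>k\<le>n. w n k * real (k choose j)) =
       L (\<Sum>k\<le>n. of_nat (k choose j) * (of_nat (n choose k) * t ^ k * u ^ (n - k)))"
      unfolding Lsum[OF finite_atMost] w_def L_nat by (simp add: mult.commute)
    also have "\<dots> = real (n choose j) * L (t ^ j)"
      unfolding bernstein_factorial_moment[OF that] tu power_one mult_1_right L_nat ..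
    finally show ?thesis .
  qed
  have ws: "(\<Sum>k\<le>n. w n k) = 1" for n using fm[of 0 n] by (simp add: one)
  \<comment> \<open>\<open>x n k\<close> is the point at which \<open>t\<close> takes the value
    k/n.\<close>
  define x where "x n k = R * (2 * (real k / real n) - 1)" for n k
  have x: "x n k \<in> {-R..R}" if "k \<le> n" for n k
  proof -
    have "0 \<le> real k / real n" "real k / real n \<le> 1" using that by (auto simp: divide_simps)
    then have "R * (2 * (real k / real n) - 1) \<le> R * 1" "R * (-1) \<le> R * (2 * (real k / real n) - 1)"
      using R mult_left_mono[of "2 * (real k / real n) - 1" 1 R] mult_left_mono[of "-1" "2 * (real k / real n) - 1" R] by auto
    then show ?thesis by (simp add: x_def)
  qed
  have "\<exists>M. real_distribution M \<and> (AE y in M. y \<in> {-R..R}) \<and>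
    (\<forall>f :: real \<Rightarrow> real. f \<in> borel_measurable borel \<longrightarrow> integral\<^sup>L M f = (\<Sum>k\<le>n. w n k * f (x n k)))"
    (is "\<exists>M. ?Q n M") for n
    by (rule discrete_distribution[of n "w n" "x n" "{-R..R}"]) (use w0 ws x in auto)
  then have "\<exists>\<mu>. \<forall>n. ?Q n (\<mu> n)" by (rule choice[OF allI])
  then obtain \<mu> where \<mu>: "\<And>n. real_distribution (\<mu> n)" "\<And>n. AE y in \<mu> n. y \<in> {-R..R}"
    "\<And>n f :: real \<Rightarrow> real. f \<in> borel_measurable borel \<Longrightarrow> integral\<^sup>L (\<mu> n) f = (\<Sum>k\<le>n. w n k * f (x n k))"
    by blast
  obtain r M where r: "strict_mono (r :: nat \<Rightarrow> nat)" and M: "real_distribution M" "AE x in M. x \<in> {-R..R}"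
    and lim: "\<And>f :: real \<Rightarrow> real. continuous_on UNIV f \<Longrightarrow>
       (\<lambda>n. integral\<^sup>L (\<mu> (r n)) f) \<longlonglongrightarrow> integral\<^sup>L M f"
    by (rule weak_limit_compact_support[OF \<mu>(1,2)]) (rule that)
  interpret M: real_distribution M by fact
  have mom: "(\<integral>y. poly (t ^ j) y \<partial>M) = L (t ^ j)" for j
  proof -
    have pt: "poly t (x n k) = real k / real n" for n k
      using R by (simp add: t_def x_def field_simps)
    have cont: "continuous_on UNIV (poly (t ^ j))" by (intro continuous_intros)
    have I: "integral\<^sup>L (\<mu> n) (poly (t ^ j)) = (\<Sum>k\<le>n. w n k * (real k / real n) ^ j)" for n
      using cont by (simp add: \<mu>(3) borel_measurable_continuous_onI poly_power pt)
    have "(\<lambda>n. integral\<^sup>L (\<mu> n) (poly (t ^ j)) - L (t ^ j)) \<longlonglongrightarrow> 0"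
    proof (rule Lim_null_comparison)
      show "\<forall>\<^sub>F n in sequentially. norm (integral\<^sup>L (\<mu> n) (poly (t ^ j)) - L (t ^ j))
              \<le> real j * (real j / (real n - real j))"
        using eventually_gt_at_top[of "2 * j"]
      proof eventually_elim
        case (elim n)
        have "L (t ^ j) = (\<Sum>k\<le>n. w n k * (real (k choose j) / real (n choose j)))"
          using fm[of j n] elim by (simp add: sum_divide_distrib[symmetric] flip: times_divide_eq_right)
             (simp add: field_simps sum_divide_distrib[symmetric])
        then have "norm (integral\<^sup>L (\<mu> n) (poly (t ^ j)) - L (t ^ j)) =
            \<bar>\<Sum>k\<le>n. w n k * ((real k / real n) ^ j - real (k choose j) / real (n choose j))\<bar>"
          by (simp add: I sum_subtractf algebra_simps)
        also have "\<dots> \<le> (\<Sum>k\<le>n. \<bar>w n k * ((real k / real n) ^ j - real (k choose j) / real (n choose j))\<bar>)"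
          by (rule sum_abs)
        also have "\<dots> \<le> (\<Sum>k\<le>n. w n k * (real j * (real j / (real n - real j))))"
        proof (rule sum_mono)
          fix k assume "k \<in> {..n}"
          then show "\<bar>w n k * ((real k / real n) ^ j - real (k choose j) / real (n choose j))\<bar> \<le>
            w n k * (real j * (real j / (real n - real j)))"
            using binomial_ratio_bound[of k n j] elim w0[of n k]
            by (simp add: abs_mult abs_minus_commute mult_left_mono del: times_divide_eq_right)
        qed
        also have "\<dots> = real j * (real j / (real n - real j))"
          unfolding sum_distrib_right[symmetric] ws by simp
        finally show ?case .
      qed
      show "(\<lambda>n. real j * (real j / (real n - real j))) \<longlonglongrightarrow> 0"
        by (intro tendsto_mult_right_zero real_tendsto_divide_at_top[OF tendsto_const]
              filterlim_tendsto_add_at_top[OF tendsto_const filterlim_real_sequentially, of "- real j", simplified])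
    qed
    then have "(\<lambda>n. integral\<^sup>L (\<mu> n) (poly (t ^ j))) \<longlonglongrightarrow> L (t ^ j)"
      by (simp add: LIM_zero_iff)
    from lim[OF cont] LIMSEQ_subseq_LIMSEQ[OF this r, unfolded comp_def] show ?thesis
      by (rule LIMSEQ_unique)
  qed
  have intp: "integrable M (\<lambda>y. poly p y)" for p
  proof -
    have "continuous_on {-R..R} (poly p)" by (intro continuous_intros)
    then obtain B where B: "\<And>y. y \<in> {-R..R} \<Longrightarrow> norm (poly p y) \<le> B"
      using continuous_on_Icc_bounded by blast
    have "poly p \<in> borel_measurable borel" by (intro borel_measurable_continuous_onI continuous_intros)
    moreover have "AE y in M. norm (poly p y) \<le> B" using M(2) by (rule eventually_mono) (rule B)
    ultimately show ?thesis by (intro M.integrable_const_bound[where B=B]) auto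
  qed
  \<comment> \<open>The free factor t^j absorbs the factor \<open>t\<close> that is split off with
    each coefficient of \<open>q\<close>, which makes the induction close.\<close>
  have step: "(\<integral>y. poly (t ^ j * pcompose q t) y \<partial>M) = L (t ^ j * pcompose q t)" for q j
  proof (induction q arbitrary: j)
    case 0
    then show ?case by (simp add: zero)
  next
    case (pCons a q)
    have *: "t ^ j * pcompose (pCons a q) t = smult a (t ^ j) + t ^ Suc j * pcompose q t"
      by (simp add: pcompose_pCons algebra_simps)
    show ?case
      unfolding * add smult pCons.IH[symmetric] mom[symmetric] poly_add poly_smult
      by (simp add: Bochner_Integration.integral_add[OF integrable_mult_right[OF intp] intp] del: poly_mult poly_power power_Suc)
  qed
  then have all: "(\<integral>y. poly (pcompose q t) y \<partial>M) = L (pcompose q t)" for q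
    using step[of 0 q] by simp
  \<comment> \<open>The inner polynomial inverts the change of coordinate \<open>t\<close>, so every
    polynomial is a polynomial in \<open>t\<close>.\<close>
  have "p = pcompose (pcompose p [:-R, 2*R:]) t" for p
  proof -
    have "pcompose [:-R, 2*R:] t = [:0, 1:]" using R by (simp add: t_def pcompose_pCons)
    then show ?thesis by (simp add: pcompose_assoc[symmetric])
  qed
  then have "(\<integral>x. poly p x \<partial>M) = L p" for p using all by metis
  with M show ?thesis by (rule that)
qed

section \<open>Polynomial approximation of indicators\<close>

lemma indicator_closed_limit:
  fixes K :: "real set"
  assumes "closed K"
  obtains f :: "nat \<Rightarrow> real \<Rightarrow> real" where "\<And>n. continuous_on UNIV (f n)" "\<And>n x. \<bar>f n x\<bar> \<le> 1"
    "\<And>x. (\<lambda>n. f n x) \<longlonglongrightarrow> indicator K x"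
\<comment> \<open>\<open>infdist\<close> to the empty set is 0, so the formula used below would
  converge to 1 instead of 0.\<close>
proof (cases "K = {}")
  case True
  then show ?thesis by (intro that[of "\<lambda>_ _. 0"]) auto
next
  case False
  define f where "f n x = max 0 (1 - real n * infdist x K)" for n x
  have "(\<lambda>n. f n x) \<longlonglongrightarrow> indicator K x" for x
  proof (cases "x \<in> K")
    case True
    then have "f n x = 1" for n by (auto simp: f_def)
    then show ?thesis using True by simp
  next
    assume x: "x \<notin> K"
    have d: "infdist x K > 0"
      using in_closed_iff_infdist_zero[OF assms False, of x] infdist_nonneg[of x K] x by (auto simp: less_le)
    obtain N where N: "real N * infdist x K > 1" using d reals_Archimedean3 by blast
    have "\<forall>\<^sub>F n in sequentially. f n x = 0"
      using eventually_ge_at_top[of N]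
    proof eventually_elim
      case (elim n)
      then have "real N * infdist x K \<le> real n * infdist x K" using d by simp
      with N show ?case by (simp add: f_def)
    qed
    then show ?thesis using x by (simp add: tendsto_eventually)
  qed
  then show ?thesis
    by (intro that[of f]) (auto simp: f_def infdist_nonneg intro!: continuous_intros)
qed

text \<open>Inner regularity supplies a compact set carrying all but e/2 of the mass of A, and
  \<open>indicator_closed_limit\<close> approximates the indicator of that set in L1 by dominated
  convergence.\<close>

lemma (in finite_borel_measure) indicator_approx_continuous:
  fixes A :: "real set"
  assumes A[measurable]: "A \<in> sets borel" and e: "0 < e"
  shows "\<exists>f. continuous_on UNIV f \<and> (\<forall>x. \<bar>f x\<bar> \<le> 1) \<and> (LINT x|M. \<bar>indicator A x - f x :: real\<bar>) < e"
proof -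
  note sets[measurable_cong] = M_is_borel
  have fin: "emeasure M (space M) \<noteq> \<infinity>" by simp
  have "\<exists>K. K \<subseteq> A \<and> compact K \<and> measure M A < measure M K + e/2"
  \<comment> \<open>\<open>ennreal\<close> sends negative numbers to 0, so the strict inequality
    below could fail for a set of small measure; there the empty set will do.\<close>
  proof (cases "measure M A < e/2")
    case True
    then show ?thesis by (intro exI[of _ "{}"]) auto
  next
    case False
    then have "ennreal (measure M A - e/2) < emeasure M A"
      using e by (simp add: emeasure_eq_measure ennreal_less_iff)
    then obtain K where "K \<subseteq> A" "compact K" "ennreal (measure M A - e/2) < emeasure M K"
      unfolding inner_regular[OF sets fin A] by (auto simp: less_SUP_iff)
    then show ?thesis
      using False by (intro exI[of _ K]) (auto simp: emeasure_eq_measure ennreal_less_iff)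
  qed
  then obtain K where K: "K \<subseteq> A" "compact K" "measure M A < measure M K + e/2" by blast
  have [measurable]: "K \<in> sets borel" using K(2) by (simp add: borel_compact)
  have KM: "K \<in> sets M" "A \<in> sets M" using sets A by auto
  obtain f :: "nat \<Rightarrow> real \<Rightarrow> real" where fc: "\<And>n. continuous_on UNIV (f n)"
      and f1: "\<And>n x. \<bar>f n x\<bar> \<le> 1" and flim: "\<And>x. (\<lambda>n. f n x) \<longlonglongrightarrow> indicator K x"
    using indicator_closed_limit[OF compact_imp_closed[OF K(2)]] by metis
  have [measurable]: "f n \<in> borel_measurable borel" for n by (rule borel_measurable_continuous_onI[OF fc])
  have "(\<lambda>n. LINT x|M. \<bar>indicator K x - f n x\<bar>) \<longlonglongrightarrow> (LINT x|M. 0)"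
  proof (rule integral_dominated_convergence[where w="\<lambda>x. 2"])
    show "AE x in M. (\<lambda>n. \<bar>indicator K x - f n x\<bar>) \<longlonglongrightarrow> 0"
    proof (rule AE_I2)
      fix x
      from tendsto_rabs[OF tendsto_diff[OF tendsto_const flim[of x]], of "indicator K x"]
      show "(\<lambda>n. \<bar>indicator K x - f n x\<bar>) \<longlonglongrightarrow> 0" by simp
    qed
    show "AE x in M. norm \<bar>indicator K x - f n x\<bar> \<le> 2" for n
    proof (rule AE_I2)
      fix x show "norm \<bar>indicator K x - f n x\<bar> \<le> 2" using f1[of n x] by (auto simp: indicator_def)
    qed
  qed auto
  then have "\<forall>\<^sub>F n in sequentially. (LINT x|M. \<bar>indicator K x - f n x\<bar>) < e/2"
    using e by (intro order_tendstoD(2)[where y=0]) auto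
  then obtain n where n: "(LINT x|M. \<bar>indicator K x - f n x\<bar>) < e/2" by (auto dest: eventually_happens)
  have fi: "integrable M (f n)" using f1 by (intro integrable_const_bound[where B=1]) auto
  have Ki: "integrable M (indicator K :: real \<Rightarrow> real)" "integrable M (indicator A :: real \<Rightarrow> real)"
    using KM by (auto simp: integrable_indicator_iff less_top[symmetric])
  have "(LINT x|M. \<bar>indicator A x - f n x\<bar>) \<le>
      (LINT x|M. (indicator A x - indicator K x) + \<bar>indicator K x - f n x\<bar>)"
  proof (rule integral_mono)
    fix x show "\<bar>indicator A x - f n x\<bar> \<le> (indicator A x - indicator K x) + \<bar>indicator K x - f n x\<bar>"
      using K(1) by (auto simp: indicator_def)
  qed (intro Bochner_Integration.integrable_add Bochner_Integration.integrable_diff integrable_abs Ki fi)+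
  also have "\<dots> = (measure M A - measure M K) + (LINT x|M. \<bar>indicator K x - f n x\<bar>)"
    using Ki fi KM by (simp add: sets_eq_imp_space_eq[OF sets])
  also have "\<dots> < e" using n K(3) by simp
  finally show ?thesis using fc f1 by blast
qed

lemma polynomial_approx_Icc:
  fixes f :: "real \<Rightarrow> real"
  assumes "continuous_on {a..b} f" "0 < e"
  shows "\<exists>p. \<forall>x\<in>{a..b}. \<bar>f x - poly p x\<bar> < e"
proof -
  obtain g where g: "real_polynomial_function g" "\<And>x. x \<in> {a..b} \<Longrightarrow> \<bar>f x - g x\<bar> < e"
    using Stone_Weierstrass_real_polynomial_function[OF compact_Icc assms] by blast
  obtain c n where "g = (\<lambda>x. \<Sum>i\<le>n. c i * x ^ i)"
    using g(1) by (auto simp: real_polynomial_function_iff_sum)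
  then have "g x = poly (\<Sum>i\<le>n. monom (c i) i) x" for x by (simp add: poly_sum poly_monom)
  with g(2) show ?thesis by metis
qed

text \<open>The k-th uniform error is at most 2^-k: at most 1, hence the constant C + 1, and
  vanishing, hence the same pointwise limits.\<close>

lemma polynomial_sequence_limit:
  fixes f :: "nat \<Rightarrow> real \<Rightarrow> real"
  assumes f: "\<And>k. continuous_on UNIV (f k)" "\<And>k x. \<bar>f k x\<bar> \<le> C"
  obtains p where "\<And>k x. x \<in> {a..b} \<Longrightarrow> \<bar>poly (p k) x\<bar> \<le> C + 1"
    "\<And>x l. x \<in> {a..b} \<Longrightarrow> (\<lambda>k. f k x) \<longlonglongrightarrow> l \<Longrightarrow> (\<lambda>k. poly (p k) x) \<longlonglongrightarrow> l"
proof -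
  have "\<exists>p. \<forall>x\<in>{a..b}. \<bar>f k x - poly p x\<bar> < (1/2)^k" for k
    by (intro polynomial_approx_Icc continuous_on_subset[OF f(1)]) auto
  then obtain p where p: "\<And>k x. x \<in> {a..b} \<Longrightarrow> \<bar>f k x - poly (p k) x\<bar> < (1/2)^k" by metis
  show ?thesis
  proof (rule that)
    fix k x assume x: "x \<in> {a..b}"
    have "(1/2::real)^k \<le> 1" by (rule power_le_one) auto
    then show "\<bar>poly (p k) x\<bar> \<le> C + 1" using p[OF x, of k] f(2)[of k x] by linarith
  next
    fix x l assume x: "x \<in> {a..b}" and l: "(\<lambda>k. f k x) \<longlonglongrightarrow> l"
    have "(\<lambda>k. f k x - poly (p k) x) \<longlonglongrightarrow> 0"
    proof (rule Lim_null_comparison)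
      show "\<forall>\<^sub>F k in sequentially. norm (f k x - poly (p k) x) \<le> (1/2)^k"
        using p[OF x] by (intro always_eventually) (auto intro: less_imp_le)
    qed (rule LIMSEQ_power_zero, simp)
    from tendsto_diff[OF l this] show "(\<lambda>k. poly (p k) x) \<longlonglongrightarrow> l" by simp
  qed
qed

text \<open>The L1 errors 2^-k are summable, so the sum of the pointwise errors has finite integral
  and is finite almost everywhere. Convergence thus holds along the whole sequence, with no
  subsequence to extract.\<close>

lemma (in finite_borel_measure) indicator_polynomial_limit:
  assumes B: "B \<in> sets borel"
  obtains p where "\<And>k x. x \<in> {a..b} \<Longrightarrow> \<bar>poly (p k) x\<bar> \<le> 2"
    "AE x in M. x \<in> {a..b} \<longrightarrow> (\<lambda>k. poly (p k) x) \<longlonglongrightarrow> indicator B x"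
proof -
  note [measurable_cong] = M_is_borel and [measurable] = B
  have "\<exists>f. continuous_on UNIV f \<and> (\<forall>x. \<bar>f x\<bar> \<le> 1) \<and> (LINT x|M. \<bar>indicator B x - f x\<bar>) < (1/2 :: real)^k"
    for k :: nat by (rule indicator_approx_continuous[OF B]) simp
  then obtain f where f: "\<And>k. continuous_on UNIV (f k)" "\<And>k x. \<bar>f k x\<bar> \<le> 1"
     "\<And>k::nat. (LINT x|M. \<bar>indicator B x - f k x\<bar>) < (1/2 :: real)^k" by metis
  have [measurable]: "f k \<in> borel_measurable borel" for k
    using f(1) by (auto intro: borel_measurable_continuous_onI)
  have fi: "integrable M (f k)" for k using f(2) by (intro integrable_const_bound[where B=1]) auto
  have gi: "integrable M (indicator B :: real \<Rightarrow> real)" by (intro integrable_const_bound[where B=1]) auto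
  have "(\<integral>\<^sup>+x. (\<Sum>k. ennreal \<bar>indicator B x - f k x\<bar>) \<partial>M) = (\<Sum>k. \<integral>\<^sup>+x. ennreal \<bar>indicator B x - f k x\<bar> \<partial>M)"
    by (intro nn_integral_suminf) auto
  also have "\<dots> = (\<Sum>k. ennreal (LINT x|M. \<bar>indicator B x - f k x\<bar>))"
    using gi fi by (intro suminf_cong nn_integral_eq_integral integrable_abs Bochner_Integration.integrable_diff) auto
  also have "\<dots> \<le> (\<Sum>k. ennreal ((1/2)^k))"
    using f(3) by (intro suminf_le) (auto intro!: ennreal_leI less_imp_le)
  also have "\<dots> < \<infinity>" by (simp add: suminf_ennreal_eq[OF _ geometric_sums])
  finally have "AE x in M. (\<Sum>k. ennreal \<bar>indicator B x - f k x\<bar>) \<noteq> \<infinity>"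
    by (intro nn_integral_noteq_infinite) auto
  then have lim: "AE x in M. (\<lambda>k. f k x) \<longlonglongrightarrow> indicator B x"
  proof (rule eventually_mono)
    fix x assume "(\<Sum>k. ennreal \<bar>indicator B x - f k x\<bar>) \<noteq> \<infinity>"
    then have "summable (\<lambda>k. \<bar>indicator B x - f k x\<bar>)" by (intro summable_suminf_not_top) (auto simp: top_ennreal_def)
    from tendsto_rabs_zero_cancel[OF summable_LIMSEQ_zero[OF this]]
    have "(\<lambda>k. indicator B x - (indicator B x - f k x)) \<longlonglongrightarrow> indicator B x - 0" by (intro tendsto_intros)
    then show "(\<lambda>k. f k x) \<longlonglongrightarrow> indicator B x" by simp
  qed
  obtain p where p: "\<And>k x. x \<in> {a..b} \<Longrightarrow> \<bar>poly (p k) x\<bar> \<le> 1 + 1"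
      "\<And>x l. x \<in> {a..b} \<Longrightarrow> (\<lambda>k. f k x) \<longlonglongrightarrow> l \<Longrightarrow> (\<lambda>k. poly (p k) x) \<longlonglongrightarrow> l"
    by (rule polynomial_sequence_limit[of f 1 a b, OF f(1,2)]) (rule that)
  have "AE x in M. x \<in> {a..b} \<longrightarrow> (\<lambda>k. poly (p k) x) \<longlonglongrightarrow> indicator B x"
    using lim by (rule eventually_mono) (intro impI p(2))
  moreover have "\<bar>poly (p k) x\<bar> \<le> 2" if "x \<in> {a..b}" for k x using p(1)[OF that] by simp
  ultimately show ?thesis by (intro that)
qed

section \<open>Polynomials in a bounded symmetric operator\<close>

definition poly_op :: "('a::real_vector \<Rightarrow> 'a) \<Rightarrow> real poly \<Rightarrow> 'a \<Rightarrow> 'a" where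
  "poly_op A p = fold_coeffs (\<lambda>a f x. a *\<^sub>R x + A (f x)) p (\<lambda>x. 0)"

locale symmetric_operator =
  fixes A :: "'a::real_inner \<Rightarrow> 'a"
  assumes linear: "linear A" and symmetric: "inner (A x) y = inner x (A y)"
begin

lemma poly_op_0 [simp]: "poly_op A 0 x = 0"
  by (simp add: poly_op_def)

lemma poly_op_pCons: "poly_op A (pCons a p) x = a *\<^sub>R x + A (poly_op A p x)"
  using linear_0[OF linear] by (cases "p = 0 \<and> a = 0") (auto simp: poly_op_def)

lemma poly_op_1 [simp]: "poly_op A 1 x = x"
  by (simp add: one_pCons poly_op_pCons linear_0[OF linear])

lemma poly_op_X [simp]: "poly_op A [:0, 1:] x = A x"
  by (simp add: poly_op_pCons linear_0[OF linear])

lemma poly_op_add: "poly_op A (p + q) x = poly_op A p x + poly_op A q x"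
proof (induction p arbitrary: q)
  case (pCons a p)
  show ?case
    by (cases q) (simp add: poly_op_pCons pCons.IH linear_add[OF linear] scaleR_add_left)
qed simp

lemma poly_op_smult: "poly_op A (smult c p) x = c *\<^sub>R poly_op A p x"
  by (induction p) (simp_all add: poly_op_pCons linear_scale[OF linear] scaleR_add_right)

lemma poly_op_diff: "poly_op A (p - q) x = poly_op A p x - poly_op A q x"
  using poly_op_add[of p "- q" x] poly_op_smult[of "-1" q x] by simp

lemma linear_poly_op: "linear (poly_op A p)"
proof (induction p)
  case 0
  then show ?case by (intro linearI) auto
next
  case (pCons a p)
  then show ?case
    by (intro linearI)
       (simp_all add: poly_op_pCons linear_add[OF linear] linear_scale[OF linear] linear_add[OF pCons(2)] linear_scale[OF pCons(2)]
         scaleR_add_right)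
qed

lemma poly_op_mult: "poly_op A (p * q) x = poly_op A p (poly_op A q x)"
  by (induction p) (simp_all add: poly_op_pCons poly_op_add poly_op_smult)

lemma poly_op_symmetric: "inner (poly_op A p x) y = inner x (poly_op A p y)"
proof (induction p arbitrary: x y)
  case (pCons a p)
  have "poly_op A p (A y) = A (poly_op A p y)"
    using poly_op_mult[of p "[:0,1:]" y] poly_op_mult[of "[:0,1:]" p y] by (simp add: mult.commute)
  then show ?case by (simp add: poly_op_pCons inner_add_left inner_add_right symmetric pCons.IH)
qed simp

lemma poly_op_commute:
  assumes "linear J" "\<And>x. J (A x) = A (J x)"
  shows "J (poly_op A p x) = poly_op A p (J x)"
  by (induction p)
     (simp_all add: poly_op_pCons linear_0[OF assms(1)] linear_add[OF assms(1)] linear_scale[OF assms(1)] assms(2))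

lemma norm_poly_op_power2: "(norm (poly_op A p u))\<^sup>2 = inner u (poly_op A (p * p) u)"
  by (simp add: power2_norm_eq_inner poly_op_mult poly_op_symmetric)

text \<open>Polarisation turns the bilinear form into quadratic forms at u + v and u - v, and the
  parallelogram law sums the squared norms of these vectors. Estimates under an integral against a
  spectral measure thereby become operator norm estimates.\<close>

lemma numerical_radius:
  assumes c: "\<And>u. \<bar>inner u (A u)\<bar> \<le> c * (norm u)\<^sup>2"
  shows "norm (A u) \<le> c * norm u"
proof (cases "A u = 0 \<or> u = 0")
  case True
  have "0 \<le> c * norm u" if "u \<noteq> 0"
  proof -
    have "0 \<le> c * (norm u)\<^sup>2" using c[of u] by simp
    then show ?thesis using that by (simp add: zero_le_mult_iff)
  qed
  then show ?thesis using True linear_0[OF linear] by (cases "u = 0") auto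
next
  case False
  \<comment> \<open>A multiple of \<open>A u\<close> of the same norm as \<open>u\<close>, so that
    \<open>inner (A u) v\<close> is \<open>norm u * norm (A u)\<close>.\<close>
  define v where "v = (norm u / norm (A u)) *\<^sub>R A u"
  have nv: "norm v = norm u" using False by (simp add: v_def)
  have "4 * inner (A u) v = inner (u + v) (A (u + v)) - inner (u - v) (A (u - v))"
    using symmetric[of u v] inner_commute[of v "A u"]
    by (simp add: linear_add[OF linear] linear_diff[OF linear] inner_add_left inner_add_right
        inner_diff_left inner_diff_right)
  also have "\<dots> \<le> c * (norm (u + v))\<^sup>2 + c * (norm (u - v))\<^sup>2"
    using c[of "u + v"] c[of "u - v"] by linarith
  also have "\<dots> = c * (2 * (norm u)\<^sup>2 + 2 * (norm v)\<^sup>2)"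
    using inner_commute[of v u]
    by (simp add: power2_norm_eq_inner inner_add_left inner_add_right inner_diff_left inner_diff_right
        algebra_simps)
  finally have "inner (A u) v \<le> c * (norm u)\<^sup>2" by (simp add: nv)
  moreover have "inner (A u) v = norm u * norm (A u)"
    using False by (simp add: v_def power2_norm_eq_inner[symmetric] power2_eq_square)
  ultimately have "norm u * norm (A u) \<le> norm u * (c * norm u)"
    by (simp add: power2_eq_square mult_ac)
  then show ?thesis using False by simp
qed

end

section \<open>Spectral measures of a bounded symmetric operator as solutions of moment
  problems\<close>

locale bounded_symmetric_operator = symmetric_operator A
  for A :: "'a::{real_inner, complete_space} \<Rightarrow> 'a" +
  fixes R :: real
  assumes bound: "norm (A x) \<le> R * norm x" and R_pos: "0 < R"
begin

lemma inner_A_bound: "\<bar>inner x (A x)\<bar> \<le> R * (norm x)\<^sup>2"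
proof -
  have "\<bar>inner x (A x)\<bar> \<le> norm x * norm (A x)" by (rule Cauchy_Schwarz_ineq2)
  also have "\<dots> \<le> norm x * (R * norm x)" by (intro mult_left_mono bound) auto
  finally show ?thesis by (simp add: power2_eq_square mult_ac)
qed

definition positive_poly :: "real poly \<Rightarrow> bool" where
  "positive_poly p \<longleftrightarrow> (\<forall>u. 0 \<le> inner u (poly_op A p u))"

text \<open>The symmetric operator q(A) commutes with p(A), so the form of q(A)^2 p(A) at u is the
  form of p(A) at q(A) u.\<close>

lemma positive_poly_square: "positive_poly p \<Longrightarrow> positive_poly (q * q * p)"
  using poly_op_symmetric[of q _ "poly_op A p (poly_op A q _)"]
  by (simp add: positive_poly_def mult.assoc mult.commute[of q p] poly_op_mult flip: poly_op_symmetric[of q])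

lemma positive_poly_add: "positive_poly p \<Longrightarrow> positive_poly q \<Longrightarrow> positive_poly (p + q)"
  by (simp add: positive_poly_def poly_op_add inner_add_right)

lemma positive_poly_smult: "positive_poly p \<Longrightarrow> 0 \<le> c \<Longrightarrow> positive_poly (smult c p)"
  by (simp add: positive_poly_def poly_op_smult)

lemma positive_poly_factors: "positive_poly [:R, 1:]" "positive_poly [:R, -1:]"
proof -
  have "R * inner u u + inner u (A u) \<ge> 0" "R * inner u u - inner u (A u) \<ge> 0" for u
    using inner_A_bound[of u] by (auto simp: power2_norm_eq_inner abs_le_iff)
  then show "positive_poly [:R, 1:]" "positive_poly [:R, -1:]"
    by (auto simp: positive_poly_def poly_op_pCons linear_0[OF linear] linear_scale[OF linear]
        linear_neg[OF linear] inner_add_right inner_diff_right)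
qed

text \<open>The case of two odd exponents uses
  \<open>2R (R + x)(R - x) = (R - x)\<^sup>2 (R + x) + (R + x)\<^sup>2 (R - x)\<close>.\<close>

lemma positive_poly_bernstein: "positive_poly ([:R, 1:] ^ j * [:R, -1:] ^ k)"
proof -
  define s t where "s = [:R, 1:]" and "t = [:R, -1:]"
  have 1: "positive_poly 1" by (simp add: positive_poly_def)
  have p: "positive_poly s" "positive_poly t"
    using positive_poly_factors by (simp_all add: s_def t_def)
  have "s * t = smult (1 / (2 * R)) (t * t * s + s * s * t)"
    using R_pos by (simp add: s_def t_def field_simps)
  moreover have "positive_poly (smult (1 / (2 * R)) (t * t * s + s * s * t))"
    using R_pos by (intro positive_poly_smult positive_poly_add positive_poly_square p) simp
  ultimately have st: "positive_poly (s * t)" by simp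
  have "positive_poly (s ^ (j mod 2) * t ^ (k mod 2))"
    using 1 st p by (cases "odd j"; cases "odd k") (auto simp: odd_iff_mod_2_eq_one)
  from positive_poly_square[OF this, of "s ^ (j div 2) * t ^ (k div 2)"]
  have "positive_poly (s ^ (j div 2 + j div 2 + j mod 2) * t ^ (k div 2 + k div 2 + k mod 2))"
    by (simp add: power_add mult_ac)
  moreover have "j div 2 + j div 2 + j mod 2 = j" for j :: nat by presburger
  ultimately show ?thesis by (simp add: s_def t_def)
qed

definition is_spectral_measure :: "'a \<Rightarrow> real measure \<Rightarrow> bool" where
  "is_spectral_measure u \<mu> \<longleftrightarrow> finite_borel_measure \<mu> \<and> (AE x in \<mu>. x \<in> {-R..R}) \<and>
     (\<forall>p. (LINT x|\<mu>. poly p x) = inner u (poly_op A p u))"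

text \<open>The moment problem yields a probability measure, so the form is divided by
  \<open>(norm u)\<^sup>2\<close> first and a constant density multiplies it back.\<close>

lemma is_spectral_measure_exists: "\<exists>\<mu>. is_spectral_measure u \<mu>"
proof (cases "u = 0")
  case True
  then show ?thesis
    by (intro exI[of _ "null_measure borel"])
       (auto simp: is_spectral_measure_def finite_borel_measure_def finite_borel_measure_axioms_def
         AE_iff_null null_sets_def intro!: finite_measureI)
next
  case False
  define L where "L p = inner u (poly_op A p u) / (norm u)\<^sup>2" for p
  obtain M where M: "real_distribution M" "AE x in M. x \<in> {-R..R}" "\<And>p. (\<integral>x. poly p x \<partial>M) = L p"
  proof (rule hausdorff_moment_problem[OF R_pos])
    show "L (p + q) = L p + L q" for p q by (simp add: L_def poly_op_add inner_add_right add_divide_distrib)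
    show "L (smult c p) = c * L p" for c p by (simp add: L_def poly_op_smult)
    show "L 1 = 1" using False by (simp add: L_def power2_norm_eq_inner)
    show "0 \<le> L ([:R, 1:] ^ j * [:R, -1:] ^ k)" for j k
      using positive_poly_bernstein by (simp add: L_def positive_poly_def)
  qed (rule that)
  interpret M: real_distribution M by fact
  define c where "c = (norm u)\<^sup>2"
  have c: "c > 0" using False by (simp add: c_def)
  define N where "N = density M (\<lambda>x. ennreal c)"
  have "finite_borel_measure N"
  proof -
    have "finite_measure N"
      by (rule finite_measureI) (simp add: N_def emeasure_density M.emeasure_space_1[unfolded M.space_eq_univ])
    then show ?thesis by (simp add: finite_borel_measure_def finite_borel_measure_axioms_def N_def)
  qed
  moreover have "AE x in N. x \<in> {-R..R}"
    unfolding N_def using M(2) by (subst AE_density) (auto elim: eventually_mono)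
  moreover have "(LINT x|N. poly p x) = inner u (poly_op A p u)" for p
  proof -
    have "poly p \<in> borel_measurable borel" by (intro borel_measurable_continuous_onI continuous_intros)
    then show ?thesis using M(3)[of p] c by (simp add: N_def integral_density c_def L_def)
  qed
  ultimately show ?thesis unfolding is_spectral_measure_def by (intro exI[of _ N] conjI allI)
qed

end

section \<open>Finite measures on an interval and their polynomial moments\<close>

lemma (in finite_borel_measure) integrable_continuous_Icc:
  fixes f :: "real \<Rightarrow> real"
  assumes "continuous_on UNIV f" "AE x in M. x \<in> {a..b}"
  shows "integrable M f"
proof -
  note [measurable_cong] = M_is_borel
  have [measurable]: "f \<in> borel_measurable borel" by (rule borel_measurable_continuous_onI) fact
  obtain B where B: "\<And>x. x \<in> {a..b} \<Longrightarrow> norm (f x) \<le> B"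
    using continuous_on_Icc_bounded[OF continuous_on_subset[OF assms(1) subset_UNIV]] by blast
  have "AE x in M. norm (f x) \<le> B" using assms(2) by (rule eventually_mono) (rule B)
  then show ?thesis by (intro integrable_const_bound[where B=B]) auto
qed

lemma (in finite_borel_measure) integrable_poly:
  assumes "AE x in M. x \<in> {a..b}"
  shows "integrable M (poly p)"
  by (intro integrable_continuous_Icc[OF _ assms] continuous_intros)

text \<open>Pointwise convergence everywhere on the interval, so that one sequence serves all measures.\<close>

lemma polynomial_limit_of_cdf:
  obtains q :: "nat \<Rightarrow> real poly" where
    "\<And>M. finite_borel_measure M \<Longrightarrow> AE x in M. x \<in> {a..b} \<Longrightarrow>
       (\<lambda>k. LINT x|M. poly (q k) x) \<longlonglongrightarrow> cdf M t"
proof -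
  obtain f :: "nat \<Rightarrow> real \<Rightarrow> real" where fc: "\<And>n. continuous_on UNIV (f n)"
      and f1: "\<And>n x. \<bar>f n x\<bar> \<le> 1" and flim: "\<And>x. (\<lambda>n. f n x) \<longlonglongrightarrow> indicator {..t} x"
    using indicator_closed_limit[OF closed_atMost] by metis
  obtain q where q: "\<And>k x. x \<in> {a..b} \<Longrightarrow> \<bar>poly (q k) x\<bar> \<le> 1 + 1"
      "\<And>x l. x \<in> {a..b} \<Longrightarrow> (\<lambda>k. f k x) \<longlonglongrightarrow> l \<Longrightarrow> (\<lambda>k. poly (q k) x) \<longlonglongrightarrow> l"
    by (rule polynomial_sequence_limit[of f 1 a b, OF fc f1]) (rule that)
  show ?thesis
  proof (rule that)
    fix M :: "real measure" assume M: "finite_borel_measure M" and ae: "AE x in M. x \<in> {a..b}"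
    interpret finite_borel_measure M by fact
    note [measurable_cong] = M_is_borel
    have "(\<lambda>k. LINT x|M. poly (q k) x) \<longlonglongrightarrow> (LINT x|M. indicator {..t} x)"
    proof (rule integral_dominated_convergence[where w="\<lambda>_. 1 + 1"])
      show "AE x in M. (\<lambda>k. poly (q k) x) \<longlonglongrightarrow> indicator {..t} x"
        using ae by (rule eventually_mono) (rule q(2)[OF _ flim])
      show "AE x in M. norm (poly (q k) x) \<le> 1 + 1" for k
        using ae by (rule eventually_mono) (simp only: real_norm_def q(1))
    qed auto
    then show "(\<lambda>k. LINT x|M. poly (q k) x) \<longlonglongrightarrow> cdf M t"
      by (simp add: cdf_def borel_UNIV)
  qed
qed

text \<open>Each value of the distribution function is a limit of moments, along a sequence of
  polynomials that does not depend on the measure.\<close>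

lemma moments_determine_measure:
  assumes M: "finite_borel_measure M" "AE x in M. x \<in> {a..b}"
    and N: "finite_borel_measure N" "AE x in N. x \<in> {a..b}"
    and eq: "\<And>p. (LINT x|M. poly p x) = (LINT x|N. poly p x)"
  shows "M = N"
proof (rule cdf_unique'[OF M(1) N(1)], rule ext)
  fix t
  obtain q where q: "\<And>M. finite_borel_measure M \<Longrightarrow> AE x in M. x \<in> {a..b} \<Longrightarrow>
       (\<lambda>k. LINT x|M. poly (q k) x) \<longlonglongrightarrow> cdf M t"
    using polynomial_limit_of_cdf[of a b t] by metis
  from q[OF M] q[OF N] show "cdf M t = cdf N t" by (simp add: eq LIMSEQ_unique)
qed

text \<open>Used to choose one sequence of polynomials that converges almost everywhere for two
  measures at once.\<close>

lemma exists_sum_measure: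
  assumes M: "finite_borel_measure M" and N: "finite_borel_measure N"
  obtains S where "finite_borel_measure S" "\<And>A. A \<in> sets borel \<Longrightarrow> emeasure S A = emeasure M A + emeasure N A"
proof -
  interpret M: finite_borel_measure M by fact
  interpret N: finite_borel_measure N by fact
  define S where "S = measure_of UNIV (sets borel) (\<lambda>A::real set. emeasure M A + emeasure N A)"
  have S: "emeasure S A = emeasure M A + emeasure N A" if "A \<in> sets borel" for A
    unfolding S_def
  proof (rule emeasure_measure_of_sigma)
    show "sigma_algebra UNIV (sets (borel :: real measure))" using sets.sigma_algebra_axioms[of borel] by simp
    show "countably_additive (sets borel) (\<lambda>A::real set. emeasure M A + emeasure N A)"
    proof (rule countably_additiveI)
      fix F :: "nat \<Rightarrow> real set" assume F: "range F \<subseteq> sets borel" "disjoint_family F"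
      then show "(\<Sum>i. emeasure M (F i) + emeasure N (F i)) = emeasure M (\<Union> (range F)) + emeasure N (\<Union> (range F))"
        by (simp add: suminf_add[symmetric] suminf_emeasure M.M_is_borel N.M_is_borel)
    qed
  qed (use that in \<open>auto simp: positive_def\<close>)
  have sets: "sets S = sets borel" by (simp add: S_def sets.sigma_sets_eq[of borel, simplified])
  have "finite_borel_measure S"
    unfolding finite_borel_measure_def finite_borel_measure_axioms_def
    using sets S[of UNIV] by (auto intro!: finite_measureI simp: sets_eq_imp_space_eq[OF sets] M.emeasure_eq_measure N.emeasure_eq_measure)
  with S show ?thesis by (rule that[rotated])
qed

section \<open>Borel functional calculus\<close>

context bounded_symmetric_operator begin

definition spectral_meas :: "'a \<Rightarrow> real measure" where
  "spectral_meas u = (SOME \<mu>. is_spectral_measure u \<mu>)"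

lemma is_spectral_measure_spectral_meas: "is_spectral_measure u (spectral_meas u)"
  unfolding spectral_meas_def using is_spectral_measure_exists by (rule someI_ex)

lemma spectral_meas_unique: "is_spectral_measure u \<mu> \<Longrightarrow> \<mu> = spectral_meas u"
  using is_spectral_measure_spectral_meas[of u] moments_determine_measure[of \<mu> "-R" R "spectral_meas u"]
  unfolding is_spectral_measure_def by metis

lemma finite_borel_measure_spectral_meas: "finite_borel_measure (spectral_meas u)"
  using is_spectral_measure_spectral_meas unfolding is_spectral_measure_def by blast

interpretation \<mu>: finite_borel_measure "spectral_meas u" for u
  by (rule finite_borel_measure_spectral_meas)

lemma sets_spectral_meas [simp, measurable_cong]: "sets (spectral_meas u) = sets borel"
  by (rule \<mu>.M_is_borel)

lemma space_spectral_meas [simp]: "space (spectral_meas u) = UNIV"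
  using sets_eq_imp_space_eq[OF sets_spectral_meas] by simp

lemma AE_spectral_meas: "AE x in spectral_meas u. x \<in> {-R..R}"
  using is_spectral_measure_spectral_meas unfolding is_spectral_measure_def by blast

lemma integral_poly_spectral_meas: "(LINT x|spectral_meas u. poly p x) = inner u (poly_op A p u)"
  using is_spectral_measure_spectral_meas unfolding is_spectral_measure_def by blast

lemma integrable_poly_spectral_meas [simp]: "integrable (spectral_meas u) (poly p)"
  by (rule \<mu>.integrable_poly[OF AE_spectral_meas])

lemma norm_poly_op_integral: "(norm (poly_op A p u))\<^sup>2 = (LINT x|spectral_meas u. (poly p x)\<^sup>2)"
  unfolding norm_poly_op_power2 integral_poly_spectral_meas[symmetric] by (simp add: power2_eq_square cong: Bochner_Integration.integral_cong)

lemma measure_spectral_meas_UNIV: "measure (spectral_meas u) UNIV = (norm u)\<^sup>2"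
  using integral_poly_spectral_meas[where p=1 and u=u] by (simp add: power2_norm_eq_inner)

lemma norm_poly_op_le:
  assumes "\<And>x. x \<in> {-R..R} \<Longrightarrow> \<bar>poly p x\<bar> \<le> C"
  shows "norm (poly_op A p u) \<le> C * norm u"
proof -
  have C: "0 \<le> C" using assms[of 0] R_pos by auto
  have "(norm (poly_op A p u))\<^sup>2 \<le> (LINT x|spectral_meas u. C\<^sup>2)"
    unfolding norm_poly_op_integral
  proof (rule integral_mono_AE)
    show "integrable (spectral_meas u) (\<lambda>x. (poly p x)\<^sup>2)"
      using integrable_poly_spectral_meas[of u "p * p"]
      by (rule Bochner_Integration.integrable_cong[THEN iffD1, OF refl, rotated]) (simp add: power2_eq_square)
    show "AE x in spectral_meas u. (poly p x)\<^sup>2 \<le> C\<^sup>2"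
      using AE_spectral_meas[of u]
    proof (rule eventually_mono)
      fix x assume "x \<in> {-R..R}"
      from power_mono[OF assms[OF this], of 2] show "(poly p x)\<^sup>2 \<le> C\<^sup>2" by simp
    qed
  qed simp
  also have "\<dots> = (C * norm u)\<^sup>2" by (simp add: measure_spectral_meas_UNIV power_mult_distrib)
  finally show ?thesis using C by (simp add: power2_le_iff_abs_le)
qed

text \<open>Uniform boundedness on the interval and convergence almost everywhere for all spectral
  measures simultaneously are what dominated convergence asks for at every vector. Uniform
  convergence is not demanded, so that indicators can qualify.\<close>

definition approximates :: "(nat \<Rightarrow> real poly) \<Rightarrow> (real \<Rightarrow> real) \<Rightarrow> bool" where
  "approximates p g \<longleftrightarrow> g \<in> borel_measurable borel \<and>
     (\<exists>C. \<forall>k. \<forall>x\<in>{-R..R}. \<bar>poly (p k) x\<bar> \<le> C) \<and>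
     (\<forall>u. AE x in spectral_meas u. (\<lambda>k. poly (p k) x) \<longlonglongrightarrow> g x)"

lemma approximatesI:
  assumes "g \<in> borel_measurable borel" "\<And>k x. x \<in> {-R..R} \<Longrightarrow> \<bar>poly (p k) x\<bar> \<le> C"
    "\<And>u. AE x in spectral_meas u. (\<lambda>k. poly (p k) x) \<longlonglongrightarrow> g x"
  shows "approximates p g"
  using assms unfolding approximates_def by blast

lemma approximates_poly: "approximates (\<lambda>_. p) (poly p)"
proof -
  obtain C where "\<And>x. x \<in> {-R..R} \<Longrightarrow> norm (poly p x) \<le> C"
    using continuous_on_Icc_bounded[OF continuous_on_poly[OF continuous_on_id]] by blast
  then show ?thesis by (intro approximatesI[where C=C]) auto
qed

lemma approximates_diff:
  assumes "approximates p g" "approximates q h"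
  shows "approximates (\<lambda>k. p k - q k) (\<lambda>x. g x - h x)"
proof -
  obtain C D where C: "\<And>k x. x \<in> {-R..R} \<Longrightarrow> \<bar>poly (p k) x\<bar> \<le> C"
    and D: "\<And>k x. x \<in> {-R..R} \<Longrightarrow> \<bar>poly (q k) x\<bar> \<le> D"
    using assms unfolding approximates_def by blast
  show ?thesis
  proof (rule approximatesI[where C="C + D"])
    fix k x assume "x \<in> {-R..R}"
    then show "\<bar>poly (p k - q k) x\<bar> \<le> C + D" using C[of x k] D[of x k] by simp
  next
    fix u
    have "AE x in spectral_meas u. (\<lambda>k. poly (p k) x) \<longlonglongrightarrow> g x" "AE x in spectral_meas u. (\<lambda>k. poly (q k) x) \<longlonglongrightarrow> h x"
      using assms unfolding approximates_def by auto
    then show "AE x in spectral_meas u. (\<lambda>k. poly (p k - q k) x) \<longlonglongrightarrow> g x - h x"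
      by eventually_elim (simp add: tendsto_diff)
  qed (use assms in \<open>auto simp: approximates_def\<close>)
qed

lemma approximates_mult:
  assumes "approximates p g" "approximates q h"
  shows "approximates (\<lambda>k. p k * q k) (\<lambda>x. g x * h x)"
proof -
  obtain C D where C: "\<And>k x. x \<in> {-R..R} \<Longrightarrow> \<bar>poly (p k) x\<bar> \<le> C"
    and D: "\<And>k x. x \<in> {-R..R} \<Longrightarrow> \<bar>poly (q k) x\<bar> \<le> D"
    using assms unfolding approximates_def by blast
  show ?thesis
  proof (rule approximatesI[where C="C * D"])
    fix k x assume x: "x \<in> {-R..R}"
    show "\<bar>poly (p k * q k) x\<bar> \<le> C * D"
      using mult_mono'[OF C[OF x, of k] D[OF x, of k]] by (simp add: abs_mult)
  next
    fix u
    have "AE x in spectral_meas u. (\<lambda>k. poly (p k) x) \<longlonglongrightarrow> g x" "AE x in spectral_meas u. (\<lambda>k. poly (q k) x) \<longlonglongrightarrow> h x"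
      using assms unfolding approximates_def by auto
    then show "AE x in spectral_meas u. (\<lambda>k. poly (p k * q k) x) \<longlonglongrightarrow> g x * h x"
      by eventually_elim (simp add: tendsto_mult)
  qed (use assms in \<open>auto simp: approximates_def\<close>)
qed

lemma approximates_integral:
  assumes "approximates p g"
  shows "(\<lambda>k. LINT x|spectral_meas u. poly (p k) x) \<longlonglongrightarrow> (LINT x|spectral_meas u. g x)"
    and "integrable (spectral_meas u) g"
proof -
  obtain C where C: "\<And>k x. x \<in> {-R..R} \<Longrightarrow> \<bar>poly (p k) x\<bar> \<le> C"
    using assms unfolding approximates_def by blast
  have [measurable]: "g \<in> borel_measurable borel"
    and l: "AE x in spectral_meas u. (\<lambda>k. poly (p k) x) \<longlonglongrightarrow> g x"
    using assms unfolding approximates_def by auto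
  have b: "AE x in spectral_meas u. norm (poly (p k) x) \<le> C" for k
    using AE_spectral_meas by (rule eventually_mono) (simp only: real_norm_def C)
  show "(\<lambda>k. LINT x|spectral_meas u. poly (p k) x) \<longlonglongrightarrow> (LINT x|spectral_meas u. g x)"
    "integrable (spectral_meas u) g"
    by (rule integral_dominated_convergence[where w="\<lambda>_. C", OF _ _ _ l b]
        integrable_dominated_convergence[where w="\<lambda>_. C", OF _ _ _ l b]; simp)+
qed

lemma approximates_norm:
  assumes "approximates p g"
  shows "(\<lambda>k. (norm (poly_op A (p k) u))\<^sup>2) \<longlonglongrightarrow> (LINT x|spectral_meas u. (g x)\<^sup>2)"
  using approximates_integral(1)[OF approximates_mult[OF assms assms]]
  unfolding norm_poly_op_integral by (simp add: power2_eq_square)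

text \<open>By \<open>norm_poly_op_integral\<close> the squared norm of the difference is the
  integral of a bounded sequence of squares tending to 0 almost everywhere.\<close>

lemma approximates_same:
  assumes "approximates p g" "approximates q g"
  shows "(\<lambda>k. poly_op A (p k) u - poly_op A (q k) u) \<longlonglongrightarrow> 0"
proof -
  have "(\<lambda>k. (norm (poly_op A (p k - q k) u))\<^sup>2) \<longlonglongrightarrow> 0"
    using approximates_norm[OF approximates_diff[OF assms], of u] by simp
  from tendsto_real_sqrt[OF this] have "(\<lambda>k. norm (poly_op A (p k - q k) u)) \<longlonglongrightarrow> 0" by simp
  then show ?thesis by (simp add: poly_op_diff tendsto_norm_zero_iff)
qed

text \<open>A non-Cauchy sequence would have two subsequences violating the previous lemma.\<close>

lemma approximates_convergent:
  assumes "approximates p g"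
  shows "convergent (\<lambda>k. poly_op A (p k) u)"
proof -
  have sub: "approximates (p \<circ> r) g" if "filterlim r at_top sequentially" for r :: "nat \<Rightarrow> nat"
  proof -
    obtain C where C: "\<And>k x. x \<in> {-R..R} \<Longrightarrow> \<bar>poly (p k) x\<bar> \<le> C"
      using assms unfolding approximates_def by blast
    show ?thesis
    proof (rule approximatesI[where C=C])
      fix u
      have "AE x in spectral_meas u. (\<lambda>k. poly (p k) x) \<longlonglongrightarrow> g x"
        using assms by (simp add: approximates_def)
      then show "AE x in spectral_meas u. (\<lambda>k. poly ((p \<circ> r) k) x) \<longlonglongrightarrow> g x"
        unfolding comp_def by (rule eventually_mono) (rule filterlim_compose[OF _ that])
    qed (use assms C in \<open>auto simp: approximates_def\<close>)
  qed
  have "Cauchy (\<lambda>k. poly_op A (p k) u)"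
  proof (rule ccontr)
    assume "\<not> ?thesis"
    then obtain e where e: "e > 0"
      and "\<forall>M. \<exists>m n. m \<ge> M \<and> n \<ge> M \<and> \<not> norm (poly_op A (p m) u - poly_op A (p n) u) < e"
      unfolding Cauchy_def dist_norm by (auto 0 3)
    then obtain r s where rs: "\<And>M. r M \<ge> M \<and> s M \<ge> M \<and> \<not> norm (poly_op A (p (r M)) u - poly_op A (p (s M)) u) < e"
      by metis
    have r: "filterlim r at_top sequentially" "filterlim s at_top sequentially"
      using rs by (auto intro!: filterlim_at_top_mono[OF filterlim_ident] always_eventually)
    have "(\<lambda>k. poly_op A ((p \<circ> r) k) u - poly_op A ((p \<circ> s) k) u) \<longlonglongrightarrow> 0"
      by (rule approximates_same[OF sub sub]) (fact r)+
    then have "\<forall>\<^sub>F k in sequentially. norm (poly_op A (p (r k)) u - poly_op A (p (s k)) u) < e"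
      using e by (simp add: tendsto_iff dist_norm)
    then show False using rs by (auto dest: eventually_happens)
  qed
  then show ?thesis by (rule Cauchy_convergent)
qed

definition approximable :: "(real \<Rightarrow> real) \<Rightarrow> bool" where
  "approximable g \<longleftrightarrow> (\<exists>p. approximates p g)"

text \<open>By \<open>approximates_same\<close> the choice of the sequence does not affect the
  limit. The value is meaningful for \<open>approximable\<close> functions only.\<close>

definition fcalc :: "(real \<Rightarrow> real) \<Rightarrow> 'a \<Rightarrow> 'a" where
  "fcalc g u = lim (\<lambda>k. poly_op A ((SOME p. approximates p g) k) u)"

lemma fcalc_tendsto:
  assumes "approximates p g"
  shows "(\<lambda>k. poly_op A (p k) u) \<longlonglongrightarrow> fcalc g u"
proof -
  define q where "q = (SOME p. approximates p g)"
  have q: "approximates q g" unfolding q_def using someI[of "\<lambda>p. approximates p g", OF assms] .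
  have "(\<lambda>k. poly_op A (q k) u) \<longlonglongrightarrow> fcalc g u"
    using approximates_convergent[OF q] by (simp add: fcalc_def q_def convergent_LIMSEQ_iff)
  from tendsto_add[OF approximates_same[OF assms q, of u] this] show ?thesis by simp
qed

lemma approximable_continuous:
  assumes g: "continuous_on UNIV g" "\<And>x. \<bar>g x\<bar> \<le> C"
  shows "approximable g"
proof -
  obtain p where p: "\<And>k x. x \<in> {-R..R} \<Longrightarrow> \<bar>poly (p k) x\<bar> \<le> C + 1"
      "\<And>x l. x \<in> {-R..R} \<Longrightarrow> (\<lambda>k. g x) \<longlonglongrightarrow> l \<Longrightarrow> (\<lambda>k. poly (p k) x) \<longlonglongrightarrow> l"
    by (rule polynomial_sequence_limit[of "\<lambda>_. g" C "-R" R, OF g]) (rule that)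
  have "approximates p g"
  proof (rule approximatesI[OF borel_measurable_continuous_onI[OF g(1)] p(1)])
    show "AE x in spectral_meas u. (\<lambda>k. poly (p k) x) \<longlonglongrightarrow> g x" for u
      using AE_spectral_meas by (rule eventually_mono) (intro p(2) tendsto_const)
  qed
  then show ?thesis by (auto simp: approximable_def)
qed

lemma approximable_poly: "approximable (poly p)"
  using approximates_poly unfolding approximable_def by blast

lemma approximable_diff: "approximable g \<Longrightarrow> approximable h \<Longrightarrow> approximable (\<lambda>x. g x - h x)"
  using approximates_diff unfolding approximable_def by blast

lemma approximable_mult: "approximable g \<Longrightarrow> approximable h \<Longrightarrow> approximable (\<lambda>x. g x * h x)"
  using approximates_mult unfolding approximable_def by blast

lemma fcalc_poly: "fcalc (poly p) u = poly_op A p u"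
  using fcalc_tendsto[OF approximates_poly] LIMSEQ_unique tendsto_const by blast

lemma fcalc_diff:
  assumes "approximable g" "approximable h"
  shows "fcalc (\<lambda>x. g x - h x) u = fcalc g u - fcalc h u"
proof -
  obtain p q where pq: "approximates p g" "approximates q h" using assms unfolding approximable_def by blast
  from tendsto_diff[OF fcalc_tendsto[OF pq(1), of u] fcalc_tendsto[OF pq(2), of u]]
    fcalc_tendsto[OF approximates_diff[OF pq], of u]
  show ?thesis by (simp add: poly_op_diff LIMSEQ_unique)
qed

lemma fcalc_symmetric:
  assumes "approximable g"
  shows "inner (fcalc g u) v = inner u (fcalc g v)"
proof -
  obtain p where p: "approximates p g" using assms unfolding approximable_def by blast
  have "(\<lambda>k. inner (poly_op A (p k) u) v) \<longlonglongrightarrow> inner (fcalc g u) v"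
    "(\<lambda>k. inner u (poly_op A (p k) v)) \<longlonglongrightarrow> inner u (fcalc g v)"
    by (intro tendsto_intros fcalc_tendsto[OF p])+
  then show ?thesis by (simp add: poly_op_symmetric LIMSEQ_unique)
qed

lemma linear_fcalc:
  assumes "approximable g"
  shows "linear (fcalc g)"
proof -
  obtain p where p: "approximates p g" using assms unfolding approximable_def by blast
  note lin = linear_poly_op
  show ?thesis
  proof (rule linearI)
    fix u v c
    from tendsto_add[OF fcalc_tendsto[OF p, of u] fcalc_tendsto[OF p, of v]] fcalc_tendsto[OF p, of "u + v"]
    show "fcalc g (u + v) = fcalc g u + fcalc g v" by (simp add: linear_add[OF lin] LIMSEQ_unique)
    from tendsto_scaleR[OF tendsto_const fcalc_tendsto[OF p, of u], of c] fcalc_tendsto[OF p, of "c *\<^sub>R u"]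
    show "fcalc g (c *\<^sub>R u) = c *\<^sub>R fcalc g u" by (simp add: linear_scale[OF lin] LIMSEQ_unique)
  qed
qed

text \<open>The operators p_k(A) are bounded uniformly in k, so q_k(A) u may be replaced by its
  limit inside them.\<close>

lemma fcalc_mult:
  assumes "approximable g" "approximable h"
  shows "fcalc (\<lambda>x. g x * h x) u = fcalc g (fcalc h u)"
proof -
  obtain p q where pq: "approximates p g" "approximates q h" using assms unfolding approximable_def by blast
  obtain C where C: "\<And>k x. x \<in> {-R..R} \<Longrightarrow> \<bar>poly (p k) x\<bar> \<le> C"
    using pq(1) unfolding approximates_def by blast
  have "(\<lambda>k. poly_op A (p k) (poly_op A (q k) u - fcalc h u)) \<longlonglongrightarrow> 0"
  proof (rule Lim_null_comparison)
    show "\<forall>\<^sub>F k in sequentially. norm (poly_op A (p k) (poly_op A (q k) u - fcalc h u))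
            \<le> C * norm (poly_op A (q k) u - fcalc h u)"
      using norm_poly_op_le[OF C] by simp
    have "(\<lambda>k. poly_op A (q k) u - fcalc h u) \<longlonglongrightarrow> fcalc h u - fcalc h u"
      by (intro tendsto_intros fcalc_tendsto[OF pq(2)])
    then show "(\<lambda>k. C * norm (poly_op A (q k) u - fcalc h u)) \<longlonglongrightarrow> 0"
      by (intro tendsto_mult_right_zero tendsto_norm_zero) simp
  qed
  from tendsto_add[OF this fcalc_tendsto[OF pq(1), of "fcalc h u"]]
  have "(\<lambda>k. poly_op A (p k * q k) u) \<longlonglongrightarrow> fcalc g (fcalc h u)"
    by (simp add: linear_diff[OF linear_poly_op] poly_op_mult)
  from LIMSEQ_unique[OF fcalc_tendsto[OF approximates_mult[OF pq]] this] show ?thesis .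
qed

text \<open>Applied later with \<open>J\<close> equal to the operator itself and to multiplication
  by i, so that spectral projections commute with complex shifts of the operator.\<close>

lemma fcalc_commute:
  assumes "approximable g" and J: "bounded_linear J" "\<And>x. J (A x) = A (J x)"
  shows "J (fcalc g u) = fcalc g (J u)"
proof -
  obtain p where p: "approximates p g" using assms(1) unfolding approximable_def by blast
  have "(\<lambda>k. J (poly_op A (p k) u)) \<longlonglongrightarrow> J (fcalc g u)"
    by (intro bounded_linear.tendsto[OF J(1)] fcalc_tendsto[OF p])
  moreover have "J (poly_op A q u) = poly_op A q (J u)" for q
    using bounded_linear.linear[OF J(1)] J(2) by (rule poly_op_commute)
  ultimately show ?thesis using fcalc_tendsto[OF p, of "J u"] by (simp add: LIMSEQ_unique)
qed

lemma inner_fcalc: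
  assumes "approximable g"
  shows "inner u (fcalc g u) = (LINT x|spectral_meas u. g x)"
proof -
  obtain p where p: "approximates p g" using assms unfolding approximable_def by blast
  have "(\<lambda>k. inner u (poly_op A (p k) u)) \<longlonglongrightarrow> inner u (fcalc g u)"
    by (intro tendsto_intros fcalc_tendsto[OF p])
  then show ?thesis
    using approximates_integral(1)[OF p, of u] by (simp add: integral_poly_spectral_meas LIMSEQ_unique)
qed

lemma norm_fcalc:
  assumes "approximable g"
  shows "(norm (fcalc g u))\<^sup>2 = (LINT x|spectral_meas u. (g x)\<^sup>2)"
  using inner_fcalc[OF approximable_mult[OF assms assms], of u] fcalc_symmetric[OF assms, of u "fcalc g u"]
  unfolding power2_norm_eq_inner by (simp add: fcalc_mult[OF assms assms] power2_eq_square)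

end

section \<open>Uniqueness of the spectral resolution\<close>

text \<open>Only the real structure is kept, so that the projections of the functional calculus and
  those of an arbitrary spectral resolution can be treated alike.\<close>

locale projection_measure =
  fixes E :: "real set \<Rightarrow> 'a::real_inner \<Rightarrow> 'a"
  assumes E_linear: "B \<in> sets borel \<Longrightarrow> linear (E B)"
    and E_symmetric: "B \<in> sets borel \<Longrightarrow> inner (E B u) v = inner u (E B v)"
    and E_idem: "B \<in> sets borel \<Longrightarrow> E B (E B u) = E B u"
    and E_UNIV: "E UNIV u = u"
    and E_sums: "range F \<subseteq> sets borel \<Longrightarrow> disjoint_family F \<Longrightarrow> (\<lambda>i. E (F i) u) sums E (\<Union>i. F i) u"
begin

definition vmeas :: "'a \<Rightarrow> real measure" where
  "vmeas u = measure_of UNIV (sets borel) (\<lambda>B. ennreal (inner u (E B u)))"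

lemma E_empty [simp]: "E {} u = 0"
proof -
  \<comment> \<open>A constant series converges only if its term is 0.\<close>
  have "(\<lambda>i::nat. E {} u) sums E {} u"
    using E_sums[of "\<lambda>_. {}" u] by (auto simp: disjoint_family_on_def)
  then show ?thesis using summable_LIMSEQ_zero[OF sums_summable] LIMSEQ_const_iff by blast
qed

lemma E_Un:
  assumes "B \<in> sets borel" "C \<in> sets borel" "B \<inter> C = {}"
  shows "E (B \<union> C) u = E B u + E C u"
proof -
  define F where "F = binaryset B C"
  have F: "range F \<subseteq> sets borel" "disjoint_family F" "(\<Union>i. F i) = B \<union> C"
    using assms by (auto simp: F_def disjoint_family_on_def binaryset_def UN_binaryset_eq[unfolded binaryset_def])
  have "(\<lambda>i. E (F i) u) sums (\<Sum>i\<in>{0, 1}. E (F i) u)"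
    by (rule sums_finite) (auto simp: F_def binaryset_def)
  then show ?thesis using sums_unique2[OF E_sums[OF F(1,2)]] F(3)
    by (simp add: F_def binaryset_def)
qed

lemma E_UN:
  assumes "finite I" "\<And>i. i \<in> I \<Longrightarrow> J i \<in> sets borel" "disjoint_family_on J I"
  shows "E (\<Union>i\<in>I. J i) u = (\<Sum>i\<in>I. E (J i) u)"
  using assms
proof (induction I rule: finite_induct)
  case (insert i I)
  have "E (J i \<union> (\<Union>i\<in>I. J i)) u = E (J i) u + E (\<Union>i\<in>I. J i) u"
    using insert by (intro E_Un) (auto simp: disjoint_family_on_def)
  moreover have "disjoint_family_on J I" using insert.prems(2) by (rule disjoint_family_on_mono[rotated]) auto
  ultimately show ?case using insert by simp
qed simp

lemma inner_E: "B \<in> sets borel \<Longrightarrow> inner u (E B u) = (norm (E B u))\<^sup>2"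
  using E_symmetric[of B u "E B u"] by (simp add: E_idem power2_norm_eq_inner)

text \<open>A vector v in the range of E C splits along B, C and the rest of the line. Since E C v
  is already v, the other two components add up to 0, and pairing their sum with v gives a vanishing
  sum of two squares.\<close>

lemma E_orthogonal:
  assumes "B \<in> sets borel" "C \<in> sets borel" "B \<inter> C = {}"
  shows "E B (E C u) = 0"
proof -
  define v where "v = E C u"
  have U: "B \<union> C \<union> - (B \<union> C) = UNIV" by auto
  have "E (B \<union> C \<union> - (B \<union> C)) v = E (B \<union> C) v + E (- (B \<union> C)) v"
    by (intro E_Un) (use assms in auto)
  then have "v = E B v + E C v + E (- (B \<union> C)) v"
    unfolding U E_UNIV using E_Un[OF assms, of v] by simp
  moreover have "E C v = v" using assms by (simp add: v_def E_idem)
  ultimately have "inner v (E B v + E (- (B \<union> C)) v) = 0" by simp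
  then have "(norm (E B v))\<^sup>2 + (norm (E (- (B \<union> C)) v))\<^sup>2 = 0"
    using assms by (simp add: inner_add_right inner_E)
  then show ?thesis by (simp add: v_def sum_power2_eq_zero_iff)
qed

lemma E_mono_zero:
  assumes "B \<in> sets borel" "C \<in> sets borel" "B \<subseteq> C" "E C u = 0"
  shows "E B u = 0"
proof -
  have "E (B \<union> (C - B)) u = E B u + E (C - B) u" using assms by (intro E_Un) auto
  moreover have "B \<union> (C - B) = C" using assms by auto
  ultimately have "inner u (E B u + E (C - B) u) = 0" using assms by simp
  then have "(norm (E B u))\<^sup>2 + (norm (E (C - B) u))\<^sup>2 = 0"
    using assms by (simp add: inner_add_right inner_E)
  then show ?thesis by (simp add: sum_power2_eq_zero_iff)
qed

lemma sets_vmeas [simp, measurable_cong]: "sets (vmeas u) = sets borel"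
  by (simp add: vmeas_def sets.sigma_sets_eq[of borel, simplified])

lemma space_vmeas [simp]: "space (vmeas u) = UNIV"
  using sets_eq_imp_space_eq[OF sets_vmeas] by simp

lemma emeasure_vmeas:
  assumes "B \<in> sets borel"
  shows "emeasure (vmeas u) B = ennreal (inner u (E B u))"
  unfolding vmeas_def
proof (rule emeasure_measure_of_sigma)
  show "sigma_algebra UNIV (sets (borel :: real measure))" using sets.sigma_algebra_axioms[of borel] by simp
  show "countably_additive (sets borel) (\<lambda>B. ennreal (inner u (E B u)))"
  proof (rule countably_additiveI)
    fix F :: "nat \<Rightarrow> real set" assume F: "range F \<subseteq> sets borel" "disjoint_family F"
    have "(\<lambda>i. inner u (E (F i) u)) sums inner u (E (\<Union>i. F i) u)"
      using bounded_linear.sums[OF bounded_linear_inner_right E_sums[OF F]] .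
    then show "(\<Sum>i. ennreal (inner u (E (F i) u))) = ennreal (inner u (E (\<Union> (range F)) u))"
      using F(1) by (intro suminf_ennreal_eq) (auto simp: inner_E range_subsetD)
  qed
qed (use assms in \<open>auto simp: positive_def\<close>)

lemma finite_borel_measure_vmeas: "finite_borel_measure (vmeas u)"
  unfolding finite_borel_measure_def finite_borel_measure_axioms_def
  by (auto intro!: finite_measureI simp: emeasure_vmeas)

lemma measure_vmeas: "B \<in> sets borel \<Longrightarrow> measure (vmeas u) B = inner u (E B u)"
  by (simp add: measure_def emeasure_vmeas inner_E)

end

text \<open>A symmetric operator given by a form \<open>\<integral>x dE\<close> is norm-close to the step operators \<open>\<Sum> (i/m) E[i/m, (i+1)/m)\<close>.\<close>

locale resolution = projection_measure E + symmetric_operator A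
  for E :: "real set \<Rightarrow> 'a::real_inner \<Rightarrow> 'a" and A :: "'a \<Rightarrow> 'a" +
  fixes r :: real
  assumes A_bounded: "bounded_linear A"
    and E_support: "E (- {-r..r}) u = 0"
    and form: "inner u (A u) = (LINT x|vmeas u. x)"
begin

text \<open>Half-open, so that the cells are the level sets of a floor function;
  \<open>Suc m\<close> keeps the mesh finite at m = 0.\<close>

definition cell :: "nat \<Rightarrow> int \<Rightarrow> real set" where
  "cell m i = {real_of_int i / real (Suc m) ..< (real_of_int i + 1) / real (Suc m)}"

definition cells :: "nat \<Rightarrow> int set" where
  "cells m = {- \<lceil>real (Suc m) * r\<rceil> - 1 .. \<lceil>real (Suc m) * r\<rceil> + 1}"

definition step :: "nat \<Rightarrow> real \<Rightarrow> real" where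
  "step m x = real_of_int \<lfloor>real (Suc m) * x\<rfloor> / real (Suc m)"

definition step_op :: "nat \<Rightarrow> 'a \<Rightarrow> 'a" where
  "step_op m u = (\<Sum>i\<in>cells m. (real_of_int i / real (Suc m)) *\<^sub>R E (cell m i) u)"

lemma cell_borel [measurable, simp]: "cell m i \<in> sets borel"
  by (simp add: cell_def)

lemma in_cell_iff: "x \<in> cell m i \<longleftrightarrow> \<lfloor>real (Suc m) * x\<rfloor> = i"
  unfolding cell_def floor_eq_iff atLeastLessThan_iff
  by (simp add: divide_le_eq less_divide_eq mult.commute del: of_nat_Suc)

lemma disjoint_cells: "disjoint_family_on (cell m) I"
  by (auto simp: disjoint_family_on_def in_cell_iff)

lemma floor_in_cells:
  assumes "x \<in> {-r..r}"
  shows "\<lfloor>real (Suc m) * x\<rfloor> \<in> cells m"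
proof -
  have "real (Suc m) * x \<le> real (Suc m) * r" "real (Suc m) * (-r) \<le> real (Suc m) * x"
    using assms by (intro mult_left_mono; simp)+
  then show ?thesis unfolding cells_def atLeastAtMost_iff by linarith
qed

lemma sum_E_cells: "(\<Sum>i\<in>cells m. E (cell m i) u) = u"
proof -
  define C where "C = (\<Union>i\<in>cells m. cell m i)"
  have C[measurable]: "C \<in> sets borel" by (auto simp: C_def cells_def)
  have "- C \<subseteq> - {-r..r}" using floor_in_cells by (auto simp: C_def in_cell_iff simp del: of_nat_Suc)
  then have "E (- C) u = 0" using E_support by (intro E_mono_zero[of "- C" "- {-r..r}"]) auto
  moreover have "E (C \<union> - C) u = E C u + E (- C) u" by (intro E_Un) auto
  ultimately have "E C u = u" by (simp add: E_UNIV)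
  moreover have "E C u = (\<Sum>i\<in>cells m. E (cell m i) u)"
    unfolding C_def by (rule E_UN) (auto simp: cells_def disjoint_cells)
  ultimately show ?thesis by simp
qed

lemma symmetric_step_op: "symmetric_operator (step_op m)"
proof (rule symmetric_operator.intro)
  have "linear (\<lambda>u. \<Sum>i\<in>cells m. (real_of_int i / real (Suc m)) *\<^sub>R E (cell m i) u)"
    by (intro linear_compose_sum ballI linear_compose_scale_right E_linear cell_borel)
  then show "linear (step_op m)" by (simp add: step_op_def[abs_def])
  show "inner (step_op m x) y = inner x (step_op m y)" for x y
    by (simp add: step_op_def inner_sum_left inner_sum_right E_symmetric)
qed

interpretation S: symmetric_operator "step_op m" for m
  by (rule symmetric_step_op)

text \<open>The cell projections are mutually orthogonal idempotents that add up to the identity, so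
  a polynomial acts on each cell through its value at the left endpoint.\<close>

lemma poly_step_op:
  "poly_op (step_op m) p u = (\<Sum>i\<in>cells m. poly p (real_of_int i / real (Suc m)) *\<^sub>R E (cell m i) u)"
proof (induction p)
  case (pCons a p)
  let ?x = "\<lambda>i. real_of_int i / real (Suc m)"
  have fin: "finite (cells m)" by (simp add: cells_def)
  have "E (cell m j) (poly_op (step_op m) p u) = poly p (?x j) *\<^sub>R E (cell m j) u" if j: "j \<in> cells m" for j
  proof -
    have "E (cell m j) (poly_op (step_op m) p u) = (\<Sum>i\<in>cells m. poly p (?x i) *\<^sub>R E (cell m j) (E (cell m i) u))"
      unfolding pCons.IH by (simp add: linear_sum[OF E_linear] linear_scale[OF E_linear])
    also have "\<dots> = (\<Sum>i\<in>cells m. if i = j then poly p (?x j) *\<^sub>R E (cell m j) u else 0)"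
    proof (rule sum.cong[OF refl])
      fix i
      have "i \<noteq> j \<Longrightarrow> cell m j \<inter> cell m i = {}" by (auto simp: in_cell_iff)
      then show "poly p (?x i) *\<^sub>R E (cell m j) (E (cell m i) u) = (if i = j then poly p (?x j) *\<^sub>R E (cell m j) u else 0)"
        by (auto simp: E_idem E_orthogonal)
    qed
    also have "\<dots> = poly p (?x j) *\<^sub>R E (cell m j) u" using j fin by simp
    finally show ?thesis .
  qed
  then have "step_op m (poly_op (step_op m) p u) = (\<Sum>i\<in>cells m. ?x i *\<^sub>R poly p (?x i) *\<^sub>R E (cell m i) u)"
    unfolding step_op_def[of m "poly_op (step_op m) p u"] by (intro sum.cong refl) simp
  moreover have "a *\<^sub>R u = (\<Sum>i\<in>cells m. a *\<^sub>R E (cell m i) u)"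
    by (subst sum_E_cells[of m u, symmetric]) (rule scaleR_sum_right)
  ultimately show ?case
    by (simp add: S.poly_op_pCons sum.distrib[symmetric] scaleR_add_left del: of_nat_Suc)
qed simp

lemma AE_vmeas: "AE x in vmeas u. x \<in> {-r..r}"
proof (rule AE_I[of _ _ "- {-r..r}"])
  show "emeasure (vmeas u) (- {-r..r}) = 0" by (simp add: emeasure_vmeas E_support)
qed auto

interpretation V: finite_borel_measure "vmeas u" for u
  by (rule finite_borel_measure_vmeas)

lemma inner_poly_step_op: "inner u (poly_op (step_op m) p u) = (LINT x|vmeas u. poly p (step m x))"
proof -
  have "(LINT x|vmeas u. poly p (step m x)) =
        (LINT x|vmeas u. (\<Sum>i\<in>cells m. poly p (real_of_int i / real (Suc m)) * indicator (cell m i) x))"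
  proof (rule integral_cong_AE)
    show "AE x in vmeas u. poly p (step m x) =
        (\<Sum>i\<in>cells m. poly p (real_of_int i / real (Suc m)) * indicator (cell m i) x)"
      using AE_vmeas
    proof (rule eventually_mono)
      fix x assume "x \<in> {-r..r}"
      from floor_in_cells[OF this, of m]
      have "(\<Sum>i\<in>cells m. if i = \<lfloor>real (Suc m) * x\<rfloor> then poly p (step m x) else 0) = poly p (step m x)"
        by (simp add: cells_def del: of_nat_Suc)
      then show "poly p (step m x) = (\<Sum>i\<in>cells m. poly p (real_of_int i / real (Suc m)) * indicator (cell m i) x)"
        by (subst (asm) sum.cong[OF refl, of _ _ "\<lambda>i. poly p (real_of_int i / real (Suc m)) * indicator (cell m i) x"])
           (auto simp: step_def in_cell_iff indicator_def simp del: of_nat_Suc)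
    qed
  qed (simp_all add: step_def)
  also have "\<dots> = (\<Sum>i\<in>cells m. poly p (real_of_int i / real (Suc m)) * measure (vmeas u) (cell m i))"
    by (subst Bochner_Integration.integral_sum) (auto simp: V.emeasure_eq_measure)
  also have "\<dots> = inner u (poly_op (step_op m) p u)"
    by (simp add: poly_step_op inner_sum_right measure_vmeas)
  finally show ?thesis ..
qed

lemma step_close: "\<bar>x - step m x\<bar> \<le> 1 / real (Suc m)"
proof -
  have "\<bar>real (Suc m) * x - real_of_int \<lfloor>real (Suc m) * x\<rfloor>\<bar> \<le> 1" by linarith
  moreover have "x - step m x = (real (Suc m) * x - real_of_int \<lfloor>real (Suc m) * x\<rfloor>) / real (Suc m)"
    by (simp add: step_def diff_divide_distrib)
  ultimately show ?thesis by (simp add: divide_right_mono del: of_nat_Suc)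
qed

lemma step_bounded: "x \<in> {-r..r} \<Longrightarrow> step m x \<in> {-(r+1)..r+1}"
proof -
  assume "x \<in> {-r..r}"
  moreover have "1 / real (Suc m) \<le> 1" by simp
  ultimately show ?thesis using step_close[of x m] unfolding atLeastAtMost_iff by linarith
qed

lemma step_measurable [measurable]: "step m \<in> borel_measurable borel"
  unfolding step_def by measurable

text \<open>The quadratic form of the difference is the integral of x - \<open>step m x\<close>,
  whose integrand is at most the mesh size. \<open>numerical_radius\<close> upgrades this form
  estimate to a norm estimate.\<close>

lemma step_op_close: "norm (A u - step_op m u) \<le> 1 / real (Suc m) * norm u"
proof -
  interpret D: symmetric_operator "\<lambda>u. A u - step_op m u"
    by (rule symmetric_operator.intro)
       (auto intro!: linear_compose_sub linear S.linear simp: inner_diff_left inner_diff_right symmetric S.symmetric)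
  show ?thesis
  proof (rule D.numerical_radius)
    fix u
    have i1: "integrable (vmeas u) (\<lambda>x. x)"
      by (rule V.integrable_continuous_Icc[OF _ AE_vmeas]) (intro continuous_intros)
    have "AE x in vmeas u. norm (step m x) \<le> r + 1"
      using AE_vmeas
    proof (rule eventually_mono)
      fix x assume "x \<in> {-r..r}"
      from step_bounded[OF this, of m] show "norm (step m x) \<le> r + 1" by auto
    qed
    then have i2: "integrable (vmeas u) (step m)" by (intro V.integrable_const_bound) auto
    have "inner u (A u - step_op m u) = (LINT x|vmeas u. x) - (LINT x|vmeas u. step m x)"
      using inner_poly_step_op[of u m "[:0,1:]"] by (simp add: inner_diff_right form)
    also have "\<dots> = (LINT x|vmeas u. x - step m x)" using i1 i2 by simp
    also have "\<bar>\<dots>\<bar> \<le> (LINT x|vmeas u. \<bar>x - step m x\<bar>)" by (rule integral_abs_bound)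
    also have "\<dots> \<le> (LINT x|vmeas u. 1 / real (Suc m))"
      using i1 i2 step_close by (intro integral_mono) auto
    also have "\<dots> = 1 / real (Suc m) * (norm u)\<^sup>2"
      by (simp add: measure_vmeas E_UNIV power2_norm_eq_inner)
    finally show "\<bar>inner u (A u - step_op m u)\<bar> \<le> 1 / real (Suc m) * (norm u)\<^sup>2" .
  qed
qed

lemma poly_step_op_tendsto: "(\<lambda>m. poly_op (step_op m) p u) \<longlonglongrightarrow> poly_op A p u"
proof (induction p)
  case (pCons a p)
  have "(\<lambda>m. A (poly_op (step_op m) p u) - step_op m (poly_op (step_op m) p u)) \<longlonglongrightarrow> 0"
  proof (rule Lim_null_comparison)
    show "\<forall>\<^sub>F m in sequentially. norm (A (poly_op (step_op m) p u) - step_op m (poly_op (step_op m) p u))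
            \<le> inverse (real (Suc m)) * norm (poly_op (step_op m) p u)"
      using step_op_close by (intro always_eventually allI) (simp add: inverse_eq_divide)
    have "(\<lambda>m. inverse (real (Suc m)) * norm (poly_op (step_op m) p u)) \<longlonglongrightarrow> 0 * norm (poly_op A p u)"
      by (intro tendsto_mult LIMSEQ_inverse_real_of_nat tendsto_norm pCons.IH)
    then show "(\<lambda>m. inverse (real (Suc m)) * norm (poly_op (step_op m) p u)) \<longlonglongrightarrow> 0" by simp
  qed
  from tendsto_diff[OF bounded_linear.tendsto[OF A_bounded pCons.IH] this]
  have "(\<lambda>m. step_op m (poly_op (step_op m) p u)) \<longlonglongrightarrow> A (poly_op A p u)" by simp
  then show ?case unfolding S.poly_op_pCons poly_op_pCons by (intro tendsto_intros)
qed simp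

text \<open>The assumption \<open>form\<close> speaks of the first moment alone. For step operators
  all moments are explicit, and refining the mesh carries them over to A: strong convergence of the
  polynomials on one side, dominated convergence on the other.\<close>

lemma integral_poly_vmeas: "(LINT x|vmeas u. poly p x) = inner u (poly_op A p u)"
proof -
  obtain C where C: "\<And>x. x \<in> {-(r+1)..r+1} \<Longrightarrow> norm (poly p x) \<le> C"
    using continuous_on_Icc_bounded[OF continuous_on_poly[OF continuous_on_id]] by blast
  have st: "(\<lambda>m. step m x) \<longlonglongrightarrow> x" for x
  proof -
    have "(\<lambda>m. x - step m x) \<longlonglongrightarrow> 0"
      by (rule Lim_null_comparison[OF always_eventually LIMSEQ_inverse_real_of_nat])
         (use step_close in \<open>simp add: inverse_eq_divide\<close>)
    from tendsto_diff[OF tendsto_const this, of x] show ?thesis by simp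
  qed
  have "(\<lambda>m. LINT x|vmeas u. poly p (step m x)) \<longlonglongrightarrow> (LINT x|vmeas u. poly p x)"
  proof (rule integral_dominated_convergence[where w="\<lambda>_. C"])
    show "AE x in vmeas u. (\<lambda>m. poly p (step m x)) \<longlonglongrightarrow> poly p x"
      by (intro AE_I2 tendsto_poly st)
    show "AE x in vmeas u. norm (poly p (step m x)) \<le> C" for m
      using AE_vmeas by (rule eventually_mono) (intro C step_bounded)
  qed auto
  moreover have "(\<lambda>m. LINT x|vmeas u. poly p (step m x)) \<longlonglongrightarrow> inner u (poly_op A p u)"
    unfolding inner_poly_step_op[symmetric] by (intro tendsto_intros poly_step_op_tendsto)
  ultimately show ?thesis by (rule LIMSEQ_unique)
qed

end

lemma (in bounded_symmetric_operator) resolution_spectral_meas: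
  assumes "resolution E A r"
  shows "projection_measure.vmeas E u = spectral_meas u"
proof -
  interpret resolution E A r by fact
  let ?r = "max r R"
  have "AE x in vmeas u. x \<in> {-?r..?r}" using AE_vmeas by (rule eventually_mono) auto
  moreover have "AE x in spectral_meas u. x \<in> {-?r..?r}" using AE_spectral_meas by (rule eventually_mono) auto
  ultimately show ?thesis
    using finite_borel_measure_vmeas finite_borel_measure_spectral_meas
    by (intro moments_determine_measure) (auto simp: integral_poly_vmeas integral_poly_spectral_meas)
qed

section \<open>Maximal spectral type and spectral projections\<close>

text \<open>The geometric distribution provides the weights 2^-(i+1). All of them are positive, so
  the null sets of the average are the common null sets of the family.\<close>

definition mixture :: "(nat \<Rightarrow> real measure) \<Rightarrow> real measure" where
  "mixture \<mu> = measure_pmf (geometric_pmf (1/2)) \<bind> \<mu>"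

lemma emeasure_mixture:
  assumes "\<And>i. real_distribution (\<mu> i)" "B \<in> sets borel"
  shows "emeasure (mixture \<mu>) B = (\<integral>\<^sup>+i. emeasure (\<mu> i) B \<partial>geometric_pmf (1/2))"
  unfolding mixture_def
proof (rule emeasure_bind)
  have "subprob_space (\<mu> i)" "sets (\<mu> i) = sets borel" for i
    using assms(1)[of i] real_distribution.events_eq_borel
    by (auto simp: real_distribution_def intro: prob_space_imp_subprob_space)
  then show "\<mu> \<in> measurable (measure_pmf (geometric_pmf (1/2))) (subprob_algebra borel)"
    by (auto simp: measurable_pmf_measure1 space_subprob_algebra)
qed (use assms in auto)

lemma real_distribution_mixture:
  assumes "\<And>i. real_distribution (\<mu> i)"
  shows "real_distribution (mixture \<mu>)"
proof -
  have k: "sets (\<mu> i) = sets borel" for i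
    using assms[of i] real_distribution.events_eq_borel by auto
  have s: "sets (mixture \<mu>) = sets borel"
    unfolding mixture_def by (rule sets_bind) (auto simp: k)
  have "emeasure (\<mu> i) UNIV = 1" for i
    using prob_space.emeasure_space_1[of "\<mu> i"] assms[of i] real_distribution.space_eq_univ[OF assms[of i]]
    by (simp add: real_distribution_def)
  then have "emeasure (mixture \<mu>) UNIV = 1"
    using emeasure_mixture[OF assms, of UNIV] by (simp add: measure_pmf.emeasure_space_1[simplified])
  then have "prob_space (mixture \<mu>)"
    using sets_eq_imp_space_eq[OF s] by (intro prob_spaceI) simp
  with s show ?thesis by (simp add: real_distribution_def real_distribution_axioms_def)
qed

lemma emeasure_mixture_eq_0_iff:
  assumes "\<And>i. real_distribution (\<mu> i)" "B \<in> sets borel"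
  shows "emeasure (mixture \<mu>) B = 0 \<longleftrightarrow> (\<forall>i. emeasure (\<mu> i) B = 0)"
proof -
  have "emeasure (mixture \<mu>) B = 0 \<longleftrightarrow> (AE i in geometric_pmf (1/2). emeasure (\<mu> i) B = 0)"
    unfolding emeasure_mixture[OF assms] by (rule nn_integral_0_iff_AE) simp
  also have "\<dots> \<longleftrightarrow> (\<forall>i. emeasure (\<mu> i) B = 0)"
    by (simp add: AE_measure_pmf_iff set_pmf_geometric)
  finally show ?thesis .
qed

text \<open>Unit vectors have probability measures as spectral measures, as averaging requires;
  density of their real span makes the average dominate every spectral measure.\<close>

locale separable_operator = bounded_symmetric_operator A R
  for A :: "'a::{real_inner, complete_space} \<Rightarrow> 'a" and R +
  fixes e :: "nat \<Rightarrow> 'a"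
  assumes norm_e: "norm (e i) = 1" and dense: "closure (span (range e)) = UNIV"
begin

interpretation \<mu>: finite_borel_measure "spectral_meas u" for u
  by (rule finite_borel_measure_spectral_meas)

definition max_meas :: "real measure" where
  "max_meas = mixture (\<lambda>i. spectral_meas (e i))"

lemma real_distribution_spectral_meas: "norm u = 1 \<Longrightarrow> real_distribution (spectral_meas u)"
  unfolding real_distribution_def real_distribution_axioms_def
  by (auto intro!: prob_spaceI simp: \<mu>.emeasure_eq_measure measure_spectral_meas_UNIV)

lemma real_distribution_max_meas: "real_distribution max_meas"
  unfolding max_meas_def by (intro real_distribution_mixture real_distribution_spectral_meas norm_e)

lemma max_meas_eq_0_iff:
  "B \<in> sets borel \<Longrightarrow> emeasure max_meas B = 0 \<longleftrightarrow> (\<forall>i. emeasure (spectral_meas (e i)) B = 0)"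
  unfolding max_meas_def by (intro emeasure_mixture_eq_0_iff real_distribution_spectral_meas norm_e)

interpretation \<nu>: real_distribution max_meas
  by (rule real_distribution_max_meas)

text \<open>Indicators are not yet known to be \<open>approximable\<close>; that will rest on this
  very lemma. So polynomials p_k are chosen that converge to the indicator of N almost everywhere
  merely for the sum of \<open>max_meas\<close> and the spectral measure of u. The vectors v with
  p_k(A) v tending to 0 include each \<open>e i\<close> and form a subspace, closed because of the
  uniform bound 2, hence include u. But the squared norms at u converge to the spectral mass of
  N.\<close>

lemma null_sets_max_meas_spectral_meas:
  assumes N[measurable]: "N \<in> sets borel" and 0: "emeasure max_meas N = 0"
  shows "emeasure (spectral_meas u) N = 0"
proof -
  obtain S where "finite_borel_measure S"
    and S: "\<And>B. B \<in> sets borel \<Longrightarrow> emeasure S B = emeasure max_meas B + emeasure (spectral_meas u) B"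
    using exists_sum_measure[OF \<nu>.finite_borel_measure_M finite_borel_measure_spectral_meas] by metis
  interpret S: finite_borel_measure S by fact
  have sets: "sets S = sets borel" by (rule S.M_is_borel)
  obtain p where p2: "\<And>k x. x \<in> {-R..R} \<Longrightarrow> \<bar>poly (p k) x\<bar> \<le> 2"
    and pS: "AE x in S. x \<in> {-R..R} \<longrightarrow> (\<lambda>k. poly (p k) x) \<longlonglongrightarrow> indicator N x"
    by (rule S.indicator_polynomial_limit[OF N, of "-R" R]) (rule that)
  have lim: "(\<lambda>k. (norm (poly_op A (p k) v))\<^sup>2) \<longlonglongrightarrow> measure (spectral_meas v) N"
    if null: "\<And>B. B \<in> sets borel \<Longrightarrow> emeasure S B = 0 \<Longrightarrow> emeasure (spectral_meas v) B = 0" for v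
  proof -
    have ac: "absolutely_continuous S (spectral_meas v)"
      using null sets unfolding absolutely_continuous_def null_sets_def by auto
    have "AE x in spectral_meas v. x \<in> {-R..R} \<longrightarrow> (\<lambda>k. poly (p k) x) \<longlonglongrightarrow> indicator N x"
      using absolutely_continuous_AE[OF _ ac pS] sets by simp
    then have "AE x in spectral_meas v. (\<lambda>k. (poly (p k) x)\<^sup>2) \<longlonglongrightarrow> indicator N x"
      using AE_spectral_meas[of v]
    proof eventually_elim
      case (elim x)
      then have "(\<lambda>k. (poly (p k) x)\<^sup>2) \<longlonglongrightarrow> (indicator N x)\<^sup>2" by (intro tendsto_power) blast
      then show ?case by (cases "x \<in> N") simp_all
    qed
    moreover have "AE x in spectral_meas v. norm ((poly (p k) x)\<^sup>2) \<le> 4" for k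
      using AE_spectral_meas[of v]
    proof (rule eventually_mono)
      fix x assume "x \<in> {-R..R}"
      from power_mono[OF p2[OF this, of k], of 2] show "norm ((poly (p k) x)\<^sup>2) \<le> 4" by simp
    qed
    ultimately have "(\<lambda>k. LINT x|spectral_meas v. (poly (p k) x)\<^sup>2) \<longlonglongrightarrow> (LINT x|spectral_meas v. indicator N x)"
      by (intro integral_dominated_convergence[where w="\<lambda>_. 4"]) auto
    then show ?thesis by (simp add: norm_poly_op_integral)
  qed
  define V where "V = {v. (\<lambda>k. poly_op A (p k) v) \<longlonglongrightarrow> 0}"
  have "e i \<in> V" for i
  proof -
    have "(\<lambda>k. (norm (poly_op A (p k) (e i)))\<^sup>2) \<longlonglongrightarrow> measure (spectral_meas (e i)) N"
      by (rule lim) (auto simp: S max_meas_eq_0_iff)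
    moreover have "measure (spectral_meas (e i)) N = 0"
      using 0 by (auto simp: max_meas_eq_0_iff measure_def)
    ultimately have "(\<lambda>k. sqrt ((norm (poly_op A (p k) (e i)))\<^sup>2)) \<longlonglongrightarrow> sqrt 0"
      by (intro tendsto_real_sqrt) simp
    then show ?thesis by (simp add: V_def tendsto_norm_zero_iff)
  qed
  moreover have "subspace V"
    unfolding subspace_def V_def
    by (auto simp: linear_0[OF linear_poly_op] linear_add[OF linear_poly_op] linear_scale[OF linear_poly_op]
        intro: tendsto_add_zero tendsto_scaleR[OF tendsto_const, of _ 0, simplified])
  ultimately have span: "span (range e) \<subseteq> V" by (intro span_minimal) auto
  have "u \<in> V"
    unfolding V_def mem_Collect_eq
  proof (rule LIMSEQ_I)
    fix \<epsilon> :: real assume \<epsilon>: "0 < \<epsilon>"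
    have "u \<in> closure (span (range e))" using dense by simp
    \<comment> \<open>The quarter leaves room for the operator bound 2 coming from
      \<open>p2\<close>.\<close>
    then obtain v where v: "v \<in> span (range e)" "dist v u < \<epsilon> / 4"
      using \<epsilon> by (auto simp: closure_approachable dest!: spec[of _ "\<epsilon> / 4"])
    have "(\<lambda>k. poly_op A (p k) v) \<longlonglongrightarrow> 0" using v(1) span by (auto simp: V_def)
    from LIMSEQ_D[OF this, of "\<epsilon> / 2"] \<epsilon> obtain K where
      K: "\<And>k. k \<ge> K \<Longrightarrow> norm (poly_op A (p k) v) < \<epsilon> / 2" by auto
    show "\<exists>K. \<forall>k\<ge>K. norm (poly_op A (p k) u - 0) < \<epsilon>"
    proof (intro exI allI impI)
      fix k assume "k \<ge> K"
      have "poly_op A (p k) u = poly_op A (p k) (u - v) + poly_op A (p k) v"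
        by (simp add: linear_diff[OF linear_poly_op])
      moreover have "norm (poly_op A (p k) (u - v)) \<le> 2 * norm (u - v)"
        by (rule norm_poly_op_le[OF p2])
      moreover have "norm (u - v) < \<epsilon> / 4" using v(2) by (simp add: dist_norm norm_minus_commute)
      ultimately show "norm (poly_op A (p k) u - 0) < \<epsilon>"
        using K[OF \<open>k \<ge> K\<close>] norm_triangle_ineq[of "poly_op A (p k) (u - v)" "poly_op A (p k) v"] by auto
    qed
  qed
  then have "(\<lambda>k. (norm (poly_op A (p k) u))\<^sup>2) \<longlonglongrightarrow> 0"
    unfolding V_def by (auto intro!: tendsto_eq_intros)
  moreover have "(\<lambda>k. (norm (poly_op A (p k) u))\<^sup>2) \<longlonglongrightarrow> measure (spectral_meas u) N"
    by (rule lim) (simp add: S)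
  ultimately have "measure (spectral_meas u) N = 0" using LIMSEQ_unique by blast
  then show ?thesis by (simp add: \<mu>.emeasure_eq_measure)
qed

lemma AE_max_meas_spectral_meas:
  assumes "AE x in max_meas. P x"
  shows "AE x in spectral_meas u. P x"
proof -
  have "absolutely_continuous max_meas (spectral_meas u)"
    using null_sets_max_meas_spectral_meas unfolding absolutely_continuous_def null_sets_def by auto
  from absolutely_continuous_AE[OF _ this assms] show ?thesis by simp
qed

text \<open>One sequence chosen for \<open>max_meas\<close> serves every vector, because its
  exceptional null set is null for all spectral measures.\<close>

lemma approximable_indicator [simp]:
  assumes B[measurable]: "B \<in> sets borel"
  shows "approximable (indicator B)"
proof -
  obtain p where p: "\<And>k x. x \<in> {-R..R} \<Longrightarrow> \<bar>poly (p k) x\<bar> \<le> 2"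
    and lim: "AE x in max_meas. x \<in> {-R..R} \<longrightarrow> (\<lambda>k. poly (p k) x) \<longlonglongrightarrow> indicator B x"
    by (rule \<nu>.indicator_polynomial_limit[OF B, of "-R" R]) (rule that)
  have "approximates p (indicator B)"
  proof (rule approximatesI[OF _ p])
    fix u
    show "AE x in spectral_meas u. (\<lambda>k. poly (p k) x) \<longlonglongrightarrow> indicator B x"
      using AE_max_meas_spectral_meas[OF lim, of u] AE_spectral_meas[of u] by eventually_elim blast
  qed auto
  then show ?thesis by (auto simp: approximable_def)
qed

lemma fcalc_cong_AE:
  assumes "approximable g" "approximable h" "AE x in spectral_meas u. g x = h x"
  shows "fcalc g u = fcalc h u"
proof -
  have "(norm (fcalc (\<lambda>x. g x - h x) u))\<^sup>2 = 0"
    unfolding norm_fcalc[OF approximable_diff[OF assms(1,2)]]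
    using assms(3) by (intro integral_eq_zero_AE) (auto elim: eventually_mono)
  then show ?thesis by (simp add: fcalc_diff[OF assms(1,2)])
qed

section \<open>Spectral projections and their countable additivity\<close>

definition proj :: "real set \<Rightarrow> 'a \<Rightarrow> 'a" where
  "proj B = fcalc (indicator B)"

lemma linear_proj: "B \<in> sets borel \<Longrightarrow> linear (proj B)"
  by (simp add: proj_def linear_fcalc)

lemma proj_symmetric: "B \<in> sets borel \<Longrightarrow> inner (proj B u) v = inner u (proj B v)"
  by (simp add: proj_def fcalc_symmetric)

lemma proj_Int: "B \<in> sets borel \<Longrightarrow> C \<in> sets borel \<Longrightarrow> proj B (proj C u) = proj (B \<inter> C) u"
  using fcalc_mult[of "indicator B" "indicator C" u]
  by (simp add: proj_def indicator_inter_arith[abs_def])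

lemma inner_proj: "B \<in> sets borel \<Longrightarrow> inner u (proj B u) = measure (spectral_meas u) B"
  by (simp add: proj_def inner_fcalc)

lemma norm_proj: "B \<in> sets borel \<Longrightarrow> (norm (proj B u))\<^sup>2 = measure (spectral_meas u) B"
  by (simp add: power2_norm_eq_inner proj_symmetric proj_Int inner_proj)

lemma proj_diff:
  assumes "B \<in> sets borel" "C \<in> sets borel" "B \<subseteq> C"
  shows "proj (C - B) u = proj C u - proj B u"
proof -
  have "indicator (C - B) = (\<lambda>x. indicator C x - indicator B x :: real)"
    using assms(3) by (auto simp: indicator_def fun_eq_iff)
  then show ?thesis using assms by (simp add: proj_def fcalc_diff)
qed

lemma proj_UNIV [simp]: "proj UNIV u = u"
proof -
  have "indicator UNIV = poly (1 :: real poly)" by auto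
  then show ?thesis by (simp add: proj_def fcalc_poly)
qed

lemma proj_Un_disjoint:
  assumes "B \<in> sets borel" "C \<in> sets borel" "B \<inter> C = {}"
  shows "proj (B \<union> C) u = proj B u + proj C u"
proof -
  have "B \<union> C - B = C" using assms(3) by auto
  then show ?thesis using proj_diff[of B "B \<union> C" u] assms by (simp add: algebra_simps)
qed

lemma projection_measure_proj: "projection_measure proj"
proof (rule projection_measure.intro)
  fix B :: "real set" and u v assume [measurable]: "B \<in> sets borel"
  show "inner (proj B u) v = inner u (proj B v)" by (rule proj_symmetric) fact
  show "proj B (proj B u) = proj B u" by (simp add: proj_Int)
next
  fix F :: "nat \<Rightarrow> real set" and u assume F: "range F \<subseteq> sets borel" "disjoint_family F"
  have [measurable]: "F i \<in> sets borel" for i using F by auto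
  define U where "U N = (\<Union>i<N. F i)" for N
  have [measurable]: "U N \<in> sets borel" for N by (simp add: U_def)
  have UU: "(\<Union>N. U N) = (\<Union>i. F i)" by (auto simp: U_def) 
  have sum: "(\<Sum>i<N. proj (F i) u) = proj (U N) u" for N
  proof (induction N)
    case 0
    show ?case using norm_proj[of "{}" u] by (simp add: U_def)
  next
    case (Suc N)
    have "F i \<inter> F N = {}" if "i < N" for i
      using F(2) that by (intro disjoint_family_onD[OF F(2)]) auto
    then have "U N \<inter> F N = {}" unfolding U_def by blast
    moreover have "U (Suc N) = U N \<union> F N" by (auto simp: U_def lessThan_Suc)
    ultimately show ?case using Suc by (simp add: proj_Un_disjoint)
  qed
  \<comment> \<open>The squared norm of the remainder is the spectral mass not yet covered, which
    vanishes by continuity from below.\<close>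
  have "(\<lambda>N. (norm (proj (\<Union>i. F i) u - proj (U N) u))\<^sup>2) \<longlonglongrightarrow> 0"
  proof -
    have sub: "U N \<subseteq> (\<Union>i. F i)" for N by (auto simp: U_def)
    have norm: "(norm (proj (\<Union>i. F i) u - proj (U N) u))\<^sup>2 = measure (spectral_meas u) (\<Union>i. F i) - measure (spectral_meas u) (U N)" for N
    proof -
      have "(norm (proj ((\<Union>i. F i) - U N) u))\<^sup>2 = measure (spectral_meas u) ((\<Union>i. F i) - U N)"
        by (rule norm_proj) simp
      then show ?thesis using sub[of N] by (subst (asm) proj_diff) (auto simp: \<mu>.finite_measure_Diff)
    qed
    have "(\<lambda>N. measure (spectral_meas u) (U N)) \<longlonglongrightarrow> measure (spectral_meas u) (\<Union>N. U N)"
      by (rule \<mu>.finite_Lim_measure_incseq) (auto simp: incseq_def U_def, meson lessThan_iff order_less_le_trans)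
    from tendsto_diff[OF tendsto_const this, of "measure (spectral_meas u) (\<Union>N. U N)"]
    show ?thesis by (simp add: UU norm)
  qed
  from tendsto_real_sqrt[OF this] have "(\<lambda>N. norm (proj (U N) u - proj (\<Union>i. F i) u)) \<longlonglongrightarrow> 0"
    by (simp add: norm_minus_commute)
  then show "(\<lambda>i. proj (F i) u) sums proj (\<Union>i. F i) u"
    by (simp add: sums_def sum LIM_zero_iff tendsto_norm_zero_iff)
qed (auto simp: linear_proj)

interpretation P: projection_measure proj
  by (rule projection_measure_proj)

lemma vmeas_proj: "P.vmeas u = spectral_meas u"
  by (rule measure_eqI) (auto simp: P.emeasure_vmeas inner_proj \<mu>.emeasure_eq_measure)

lemma resolution_proj: "resolution proj A R"
proof (intro resolution.intro resolution_axioms.intro projection_measure_proj)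
  show "symmetric_operator A" by unfold_locales
  show "bounded_linear A"
    using bound by (intro bounded_linear_intro[where K=R] linear_add[OF linear] linear_scale[OF linear])
       (simp add: mult.commute)
  fix u
  have "emeasure (spectral_meas u) (- {-R..R}) = 0"
    by (rule AE_iff_measurable[THEN iffD1, OF _ _ AE_spectral_meas[of u]]) auto
  then have "measure (spectral_meas u) (- {-R..R}) = 0" by (simp add: measure_def)
  then show "proj (- {-R..R}) u = 0" using norm_proj[of "- {-R..R}" u] by simp
  show "inner u (A u) = (LINT x|P.vmeas u. x)"
    using integral_poly_spectral_meas[where p="[:0, 1:]" and u=u] by (simp add: vmeas_proj)
qed

text \<open>The complementary projection of u has squared norm equal to the spectral mass outside B.
  This is how subspaces defined by the type of a spectral measure become ranges of
  projections.\<close>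

lemma proj_eq_self_iff:
  assumes [measurable]: "B \<in> sets borel"
  shows "proj B u = u \<longleftrightarrow> emeasure (spectral_meas u) (- B) = 0"
proof -
  have "proj (UNIV - B) u = u - proj B u" by (subst proj_diff) auto
  then have "proj B u = u \<longleftrightarrow> proj (- B) u = 0" by (auto simp: Compl_eq_Diff_UNIV)
  also have "\<dots> \<longleftrightarrow> emeasure (spectral_meas u) (- B) = 0"
    using norm_proj[of "- B" u] by (auto simp: \<mu>.emeasure_eq_measure)
  finally show ?thesis .
qed

end

section \<open>Spectrum on the range of a spectral projection\<close>

text \<open>\<open>J\<close> stands for multiplication by i: skewness says that the inner product is
  the real part of a hermitian one, and commutation that \<open>A\<close> is complex linear.\<close>

locale complex_operator = separable_operator A R e
  for A :: "'a::{real_inner, complete_space} \<Rightarrow> 'a" and R e +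
  fixes J :: "'a \<Rightarrow> 'a"
  assumes J_bounded: "bounded_linear J" and J_commute: "J (A x) = A (J x)"
    and J_J: "J (J x) = - x" and J_skew: "inner (J x) y = - inner x (J y)"
begin

interpretation \<mu>: finite_borel_measure "spectral_meas u" for u
  by (rule finite_borel_measure_spectral_meas)

definition shifted :: "real \<Rightarrow> real \<Rightarrow> 'a \<Rightarrow> 'a" where
  "shifted a b u = A u - a *\<^sub>R u - b *\<^sub>R J u"

text \<open>The squared distance from x to a + ib as a polynomial in the real variable x; applied to
  A it is the product of the shifts by a + ib and by a - ib.\<close>

definition dist2 :: "real \<Rightarrow> real \<Rightarrow> real poly" where
  "dist2 a b = [:a\<^sup>2 + b\<^sup>2, - 2 * a, 1:]"

lemma poly_dist2: "poly (dist2 a b) x = (x - a)\<^sup>2 + b\<^sup>2"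
  by (simp add: dist2_def power2_eq_square algebra_simps)

lemma J_linear: "linear J"
  using J_bounded by (rule bounded_linear.linear)

lemma A_bounded: "bounded_linear A"
  using resolution_proj by (simp add: resolution_def resolution_axioms_def)

lemma linear_shifted: "linear (shifted a b)"
  unfolding shifted_def
  by (intro linear_compose_sub linear linear_compose_scale_right linear_id[unfolded id_def] J_linear)

lemma shifted_shifted: "shifted a b (shifted a (-b) u) = poly_op A (dist2 a b) u"
proof -
  have "poly_op A (dist2 a b) u = (a\<^sup>2 + b\<^sup>2) *\<^sub>R u - (2 * a) *\<^sub>R A u + A (A u)"
    by (simp add: dist2_def poly_op_pCons linear_0[OF linear] linear_scale[OF linear] linear_add[OF linear]
        linear_neg[OF linear] linear_diff[OF linear])
  then show ?thesis
    by (simp add: shifted_def linear_diff[OF linear] linear_add[OF linear] linear_scale[OF linear]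
        linear_diff[OF J_linear] linear_add[OF J_linear] linear_scale[OF J_linear] J_commute J_J
        scaleR_diff_right scaleR_add_right scaleR_add_left scaleR_diff_left power2_eq_square)
       (simp add: algebra_simps flip: scaleR_add_left)
qed

lemma inner_shifted: "inner (shifted a b u) v = inner u (shifted a (-b) v)"
  by (simp add: shifted_def inner_diff_left inner_diff_right inner_add_right symmetric J_skew)

lemma norm_shifted: "(norm (shifted a b u))\<^sup>2 = (LINT x|spectral_meas u. poly (dist2 a b) x)"
  using shifted_shifted[of a "-b" u]
  unfolding integral_poly_spectral_meas by (simp add: power2_norm_eq_inner inner_shifted dist2_def)

lemma proj_shifted: "B \<in> sets borel \<Longrightarrow> proj B (shifted a b u) = shifted a b (proj B u)"
  using fcalc_commute[of "indicator B", OF _ A_bounded refl, of u]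
    fcalc_commute[of "indicator B", OF _ J_bounded J_commute, of u]
  unfolding shifted_def
  by (simp add: proj_def linear_diff[OF linear_fcalc] linear_scale[OF linear_fcalc])

text \<open>Write z = a + ib. On the range of \<open>proj B\<close> the spectral measures avoid the
  points with |x - z|^2 < \<delta>, which bounds the integral of |x - z|^2 from below. A preimage of
  u is obtained by applying A minus the conjugate of z to g(A) u, with g the reciprocal of |x - z|^2
  on B.\<close>

lemma shifted_bij_on_range:
  assumes B[measurable]: "B \<in> sets borel" and \<delta>: "0 < \<delta>"
    and null: "emeasure max_meas (B \<inter> {x. poly (dist2 a b) x < \<delta>}) = 0"
  defines "X \<equiv> {u. proj B u = u}"
  shows "bij_betw (shifted a b) X X" and "\<And>u. u \<in> X \<Longrightarrow> \<delta> * (norm u)\<^sup>2 \<le> (norm (shifted a b u))\<^sup>2"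
proof -
  let ?q = "poly (dist2 a b)"
  have AE_B: "AE x in spectral_meas u. x \<in> B \<longrightarrow> \<delta> \<le> ?q x" for u
  proof (rule AE_I[where N="B \<inter> {x. ?q x < \<delta>}"])
    show "emeasure (spectral_meas u) (B \<inter> {x. ?q x < \<delta>}) = 0"
      by (rule null_sets_max_meas_spectral_meas[OF _ null]) measurable
  qed (auto simp: not_le)
  have AE_X: "AE x in spectral_meas u. x \<in> B" if "u \<in> X" for u
    using that proj_eq_self_iff[OF B, of u] by (intro AE_I[where N="- B"]) (auto simp: X_def)
  show lower: "\<delta> * (norm u)\<^sup>2 \<le> (norm (shifted a b u))\<^sup>2" if u: "u \<in> X" for u
  proof -
    have "\<delta> * (norm u)\<^sup>2 = (LINT x|spectral_meas u. \<delta>)"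
      by (simp add: measure_spectral_meas_UNIV)
    also have "\<dots> \<le> (LINT x|spectral_meas u. ?q x)"
      by (rule integral_mono_AE) (use AE_B[of u] AE_X[OF u] in auto)
    finally show ?thesis by (simp add: norm_shifted)
  qed
  \<comment> \<open>The maximum with \<delta> makes the reciprocal bounded and continuous on the
    whole line; on B it changes nothing up to a null set.\<close>
  define g where "g x = indicator B x * (1 / max \<delta> (?q x))" for x
  have "approximable (\<lambda>x. 1 / max \<delta> (?q x))"
  proof (rule approximable_continuous[where C="1 / \<delta>"])
    have "max \<delta> (?q x) \<noteq> 0" for x using \<delta> by linarith
    then show "continuous_on UNIV (\<lambda>x. 1 / max \<delta> (?q x))" by (intro continuous_intros) auto
    show "\<bar>1 / max \<delta> (?q x)\<bar> \<le> 1 / \<delta>" for x using \<delta> by (auto simp: divide_simps)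
  qed
  then have g[simp]: "approximable g"
    unfolding g_def[abs_def] by (intro approximable_mult approximable_indicator B)
  show "bij_betw (shifted a b) X X"
    unfolding bij_betw_def
  proof (intro conjI equalityI subsetI)
    show "inj_on (shifted a b) X"
    proof (rule inj_onI)
      fix u v assume uv: "u \<in> X" "v \<in> X" "shifted a b u = shifted a b v"
      then have "u - v \<in> X" by (simp add: X_def linear_diff[OF linear_proj])
      from lower[OF this] uv(3) \<delta> show "u = v"
        by (simp add: linear_diff[OF linear_shifted] mult_le_0_iff)
    qed
    fix w assume "w \<in> shifted a b ` X"
    then show "w \<in> X" by (auto simp: X_def proj_shifted)
  next
    fix u assume u: "u \<in> X"
    define w where "w = shifted a (-b) (fcalc g u)"
    have "(\<lambda>x. indicator B x * g x) = g" by (auto simp: g_def indicator_def)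
    then have "proj B (fcalc g u) = fcalc g u"
      using fcalc_mult[of "indicator B" g u] by (simp add: proj_def)
    then have wX: "w \<in> X" by (simp add: X_def w_def proj_shifted)
    have "shifted a b w = fcalc (\<lambda>x. ?q x * g x) u"
      by (simp add: w_def shifted_shifted fcalc_mult approximable_poly fcalc_poly)
    also have "\<dots> = fcalc (indicator B) u"
      using AE_B[of u] \<delta>
      by (intro fcalc_cong_AE approximable_mult approximable_poly g approximable_indicator B)
         (auto elim!: eventually_mono simp: g_def indicator_def max_def)
    also have "\<dots> = u" using u by (simp add: X_def proj_def)
    finally show "u \<in> shifted a b ` X" using wX by auto
  qed
qed

text \<open>Projecting a suitable \<open>e i\<close> onto a charged part of B within distance sqrt
  \<delta> of z = a + ib gives a nonzero vector whose norm A - z multiplies by at most sqrt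
  \<delta>.\<close>

lemma shifted_not_bounded_below:
  assumes B[measurable]: "B \<in> sets borel"
    and pos: "\<And>\<delta>. 0 < \<delta> \<Longrightarrow> emeasure max_meas (B \<inter> {x. poly (dist2 a b) x < \<delta>}) \<noteq> 0"
  shows "\<not> (\<exists>C. \<forall>u. proj B u = u \<longrightarrow> norm u \<le> C * norm (shifted a b u))"
proof
  let ?q = "poly (dist2 a b)"
  assume "\<exists>C. \<forall>u. proj B u = u \<longrightarrow> norm u \<le> C * norm (shifted a b u)"
  then obtain C where C: "\<And>u. proj B u = u \<Longrightarrow> norm u \<le> C * norm (shifted a b u)" by blast
  \<comment> \<open>Chosen so that C^2 \<delta> < 1, whatever the sign of C.\<close>
  define \<delta> where "\<delta> = 1 / (C\<^sup>2 + 1)"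
  have \<delta>: "0 < \<delta>" by (simp add: \<delta>_def add_nonneg_pos)
  define D where "D = B \<inter> {x. ?q x < \<delta>}"
  have D[measurable]: "D \<in> sets borel" by (simp add: D_def)
  obtain i where i: "emeasure (spectral_meas (e i)) D \<noteq> 0"
    using pos[OF \<delta>] D unfolding D_def[symmetric] by (auto simp: max_meas_eq_0_iff)
  define u where "u = proj D (e i)"
  have "(norm u)\<^sup>2 \<noteq> 0" using i by (simp add: u_def norm_proj \<mu>.emeasure_eq_measure)
  then have u0: "0 < (norm u)\<^sup>2" by simp
  have uB: "proj B u = u" by (simp add: u_def proj_Int) (simp add: D_def Int_assoc[symmetric])
  have uD: "proj D u = u" by (simp add: u_def proj_Int)
  have "AE x in spectral_meas u. x \<in> D"
    using uD proj_eq_self_iff[OF D, of u] by (intro AE_I[where N="- D"]) auto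
  then have "AE x in spectral_meas u. ?q x \<le> \<delta>"
    by (rule eventually_mono) (simp add: D_def)
  then have "(LINT x|spectral_meas u. ?q x) \<le> (LINT x|spectral_meas u. \<delta>)"
    by (intro integral_mono_AE) auto
  then have "(norm (shifted a b u))\<^sup>2 \<le> \<delta> * (norm u)\<^sup>2"
    by (simp add: norm_shifted measure_spectral_meas_UNIV mult.commute)
  then have "C\<^sup>2 * (norm (shifted a b u))\<^sup>2 \<le> C\<^sup>2 * (\<delta> * (norm u)\<^sup>2)"
    by (rule mult_left_mono) simp
  moreover have "(norm u)\<^sup>2 \<le> C\<^sup>2 * (norm (shifted a b u))\<^sup>2"
    using power_mono[OF C[OF uB], of 2] by (simp add: power_mult_distrib)
  ultimately have "1 * (norm u)\<^sup>2 \<le> (C\<^sup>2 * \<delta>) * (norm u)\<^sup>2" by simp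
  then have "1 \<le> C\<^sup>2 * \<delta>" using u0 by (simp del: mult_1_left)
  moreover have "C\<^sup>2 * \<delta> < 1" by (simp add: \<delta>_def divide_simps add_nonneg_pos)
  ultimately show False by simp
qed

lemma shifted_invertible_iff:
  assumes B: "B \<in> sets borel"
  defines "X \<equiv> {u. proj B u = u}"
  shows "bij_betw (shifted a b) X X \<and> (\<exists>C. \<forall>u\<in>X. norm u \<le> C * norm (shifted a b u)) \<longleftrightarrow>
     (\<exists>\<delta>>0. emeasure max_meas (B \<inter> {x. (x - a)\<^sup>2 + b\<^sup>2 < \<delta>}) = 0)" (is "?L \<longleftrightarrow> ?R")
proof
  assume ?L
  then show ?R using shifted_not_bounded_below[OF B, of a b] by (auto simp: X_def poly_dist2)
next
  assume ?R
  then obtain \<delta> where \<delta>: "\<delta> > 0" and null: "emeasure max_meas (B \<inter> {x. poly (dist2 a b) x < \<delta>}) = 0"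
    by (auto simp: poly_dist2)
  note * = shifted_bij_on_range[OF B \<delta> null, folded X_def]
  have "norm u \<le> (1 / sqrt \<delta>) * norm (shifted a b u)" if "u \<in> X" for u
  proof -
    have "sqrt (\<delta> * (norm u)\<^sup>2) \<le> sqrt ((norm (shifted a b u))\<^sup>2)"
      using *(2)[OF that] by (rule real_sqrt_le_mono)
    then have "sqrt \<delta> * norm u \<le> norm (shifted a b u)" by (simp add: real_sqrt_mult)
    then show ?thesis using \<delta> by (simp add: field_simps)
  qed
  with *(1) show ?L by blast
qed

end

section \<open>Decomposition of a finite measure by dyadic densities\<close>

text \<open>The support of \<nu> restricted to D, placed in the complex plane: the inner set is the
  trace on the real line of the disc of radius sqrt \<delta> about z. A non-real z drops out by
  itself, since a small disc about it misses the line.\<close>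

definition complex_support :: "real measure \<Rightarrow> real set \<Rightarrow> complex set" where
  "complex_support \<nu> D = {z. \<forall>\<delta>>0. emeasure \<nu> (D \<inter> {x. (x - Re z)\<^sup>2 + (Im z)\<^sup>2 < \<delta>}) \<noteq> 0}"

definition dyadic :: "nat \<Rightarrow> int \<Rightarrow> real set" where
  "dyadic k i = {real_of_int i / 2 ^ k ..< (real_of_int i + 1) / 2 ^ k}"

lemma in_dyadic_iff: "x \<in> dyadic k i \<longleftrightarrow> \<lfloor>2 ^ k * x\<rfloor> = i"
  unfolding dyadic_def floor_eq_iff atLeastLessThan_iff
  by (simp add: divide_le_eq less_divide_eq mult.commute)

lemma dyadic_borel [measurable, simp]: "dyadic k i \<in> sets borel"
  by (simp add: dyadic_def)

lemma emeasure_lborel_dyadic: "emeasure lborel (dyadic k i) = ennreal (1 / 2 ^ k)"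
  by (simp add: dyadic_def divide_right_mono diff_divide_distrib[symmetric])

text \<open>Integer division of the index passes to the ancestor of a dyadic interval at a coarser
  level.\<close>

lemma floor_dyadic_coarser:
  fixes x :: real
  assumes "l \<le> k"
  shows "\<lfloor>2 ^ l * x\<rfloor> = \<lfloor>2 ^ k * x\<rfloor> div 2 ^ (k - l)"
proof -
  have "(2::real) ^ l = 2 ^ k / 2 ^ (k - l)" using assms by (simp add: power_diff)
  then have "\<lfloor>2 ^ l * x\<rfloor> = \<lfloor>(2 ^ k * x) / real_of_int (2 ^ (k - l))\<rfloor>" by simp
  also have "\<dots> = \<lfloor>2 ^ k * x\<rfloor> div 2 ^ (k - l)" by (rule floor_divide_real_eq_div) simp
  finally show ?thesis .
qed

text \<open>The maximal intervals among those satisfying \<open>P\<close> are disjoint and have the same union.\<close>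

lemma emeasure_dyadic_union_le:
  fixes M N :: "real measure" and c :: ennreal
  assumes sets: "sets M = sets borel" "sets N = sets borel"
    and le: "\<And>k i. P k i \<Longrightarrow> emeasure M (dyadic k i) \<le> c * emeasure N (dyadic k i)"
  shows "emeasure M {x. \<exists>k. P k \<lfloor>2 ^ k * x\<rfloor>} \<le> c * emeasure N {x. \<exists>k. P k \<lfloor>2 ^ k * x\<rfloor>}"
proof -
  define F where "F = {(k, i). P k i \<and> (\<forall>l<k. \<not> P l (i div 2 ^ (k - l)))}"
  have union: "{x. \<exists>k. P k \<lfloor>2 ^ k * x\<rfloor>} = (\<Union>(k, i)\<in>F. dyadic k i)"
  proof (intro equalityI subsetI)
    fix x :: real assume "x \<in> {x. \<exists>k. P k \<lfloor>2 ^ k * x\<rfloor>}"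
    then have ex: "\<exists>k. P k \<lfloor>2 ^ k * x\<rfloor>" by simp
    define k where "k = (LEAST k. P k \<lfloor>2 ^ k * x\<rfloor>)"
    have "P k \<lfloor>2 ^ k * x\<rfloor>" unfolding k_def using ex by (rule LeastI_ex)
    moreover have "\<not> P l (\<lfloor>2 ^ k * x\<rfloor> div 2 ^ (k - l))" if "l < k" for l
      using not_less_Least[OF that[unfolded k_def]] that by (simp add: floor_dyadic_coarser[of l k])
    ultimately have "(k, \<lfloor>2 ^ k * x\<rfloor>) \<in> F" by (auto simp: F_def)
    then show "x \<in> (\<Union>(k, i)\<in>F. dyadic k i)" by (force simp: in_dyadic_iff)
  qed (auto simp: F_def in_dyadic_iff)
  have disj: "disjoint_family_on (\<lambda>(k, i). dyadic k i) F"
  proof -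
    have "k = l \<and> i = j" if "(k, i) \<in> F" "(l, j) \<in> F" "x \<in> dyadic k i" "x \<in> dyadic l j" for k i l j x
    proof -
      have "\<not> l < k" if "(k, i) \<in> F" "(l, j) \<in> F" "x \<in> dyadic k i" "x \<in> dyadic l j" for k i l j
        using that floor_dyadic_coarser[of l k x] by (auto simp: F_def in_dyadic_iff)
      from this[OF that] this[OF that(2,1,4,3)] have "k = l" by simp
      then show ?thesis using that by (auto simp: in_dyadic_iff)
    qed
    then show ?thesis unfolding disjoint_family_on_def by fastforce
  qed
  have e: "emeasure L (\<Union>(k, i)\<in>F. dyadic k i) = (\<integral>\<^sup>+(k, i). emeasure L (dyadic k i) \<partial>count_space F)"
    if "sets L = sets borel" for L
    using that disj by (subst emeasure_UN_countable) (auto simp: case_prod_unfold)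
  have "emeasure M (\<Union>(k, i)\<in>F. dyadic k i) \<le> (\<integral>\<^sup>+(k, i). c * emeasure N (dyadic k i) \<partial>count_space F)"
    unfolding e[OF sets(1)] by (intro nn_integral_mono) (auto simp: F_def le)
  also have "\<dots> = c * emeasure N (\<Union>(k, i)\<in>F. dyadic k i)"
    unfolding e[OF sets(2)] by (simp add: case_prod_unfold nn_integral_cmult)
  finally show ?thesis unfolding union .
qed

definition dyadic_density :: "real measure \<Rightarrow> nat \<Rightarrow> real \<Rightarrow> real" where
  "dyadic_density \<nu> k x = 2 ^ k * measure \<nu> (dyadic k \<lfloor>2 ^ k * x\<rfloor>)"

text \<open>Boundedness of the averages is all that is asked, never their convergence, so no
  differentiation theorem enters: two covering estimates show that this set is Lebesgue null and
  that \<nu> is absolutely continuous off it. Quantifying over n and k only keeps the condition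
  measurable in \<nu> as well as in x.\<close>

definition sing_set :: "real measure \<Rightarrow> real set" where
  "sing_set \<nu> = {x. \<forall>n::nat. \<exists>k. real n < dyadic_density \<nu> k x}"

definition pp_set :: "real measure \<Rightarrow> real set" where
  "pp_set \<nu> = {x. measure \<nu> {x} \<noteq> 0}"

definition sc_set :: "real measure \<Rightarrow> real set" where
  "sc_set \<nu> = sing_set \<nu> - pp_set \<nu>"

definition ac_set :: "real measure \<Rightarrow> real set" where
  "ac_set \<nu> = - (sing_set \<nu> \<union> pp_set \<nu>)"

lemma dyadic_density_measurable [measurable]: "dyadic_density \<nu> k \<in> borel_measurable borel"
proof -
  have "(\<lambda>i. measure \<nu> (dyadic k i)) \<in> borel_measurable (count_space UNIV)" by simp
  then show ?thesis unfolding dyadic_density_def by measurable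
qed

lemma sing_set_borel [measurable, simp]: "sing_set \<nu> \<in> sets borel"
  unfolding sing_set_def by measurable

context finite_borel_measure begin

lemma countable_pp_set: "countable (pp_set M)"
  unfolding pp_set_def by (rule countable_support)

lemma pp_set_borel [measurable, simp]: "pp_set M \<in> sets borel"
  using countable_pp_set by (rule sets.countable[rotated]) simp

lemma sc_set_borel [measurable, simp]: "sc_set M \<in> sets borel"
  by (simp add: sc_set_def sets.Diff)

lemma ac_set_borel [measurable, simp]: "ac_set M \<in> sets borel"
  by (simp add: ac_set_def sets.Un)

text \<open>A maximal inequality: disjoint dyadic intervals of density above n + 1 have total length
  at most the total mass divided by n + 1.\<close>

lemma lborel_sing_set: "emeasure lborel (sing_set M) = 0"
proof -
  have "emeasure lborel (sing_set M) \<le> ennreal (measure M (space M) / Suc n)" for n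
  proof -
    define P where "P k i \<longleftrightarrow> real (Suc n) < 2 ^ k * measure M (dyadic k i)" for k i
    have "emeasure lborel (sing_set M) \<le> emeasure lborel {x. \<exists>k. P k \<lfloor>2 ^ k * (x::real)\<rfloor>}"
    proof (rule emeasure_mono)
      show "sing_set M \<subseteq> {x. \<exists>k. P k \<lfloor>2 ^ k * x\<rfloor>}"
        by (auto simp: sing_set_def P_def dyadic_density_def simp del: of_nat_Suc)
      show "{x. \<exists>k. P k \<lfloor>2 ^ k * (x::real)\<rfloor>} \<in> sets lborel" by measurable
    qed
    also have "\<dots> \<le> ennreal (1 / Suc n) * emeasure M {x. \<exists>k. P k \<lfloor>2 ^ k * (x::real)\<rfloor>}"
    proof (rule emeasure_dyadic_union_le)
      fix k i assume "P k i"
      then have "1 / 2 ^ k \<le> 1 / Suc n * measure M (dyadic k i)"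
        by (simp add: P_def field_simps del: of_nat_Suc)
      then show "emeasure lborel (dyadic k i) \<le> ennreal (1 / Suc n) * emeasure M (dyadic k i)"
        unfolding emeasure_lborel_dyadic emeasure_eq_measure
        by (subst ennreal_mult[symmetric]) (auto intro: ennreal_leI)
    qed (auto simp: M_is_borel)
    also have "\<dots> \<le> ennreal (1 / Suc n) * emeasure M (space M)"
      by (intro mult_left_mono emeasure_space) auto
    also have "\<dots> = ennreal (measure M (space M) / Suc n)"
      by (simp add: emeasure_eq_measure ennreal_mult[symmetric])
    finally show ?thesis .
  qed
  moreover have "(\<lambda>n. ennreal (measure M (space M) / Suc n)) \<longlonglongrightarrow> ennreal 0"
    by (intro tendsto_ennrealI LIMSEQ_Suc lim_const_over_n)
  ultimately have "emeasure lborel (sing_set M) \<le> ennreal 0"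
    by (intro LIMSEQ_le_const[where X="\<lambda>n. ennreal (measure M (space M) / Suc n)"]) auto
  then show ?thesis by simp
qed

text \<open>Cut N into pieces by the bound n on the averages. Around the points of one piece, small
  dyadic intervals inside an open set U of Lebesgue measure at most \<epsilon> have mass at most n
  times their length, so the piece has mass at most n \<epsilon>.\<close>

lemma null_off_sing_set:
  assumes N[measurable]: "N \<in> sets borel" and null: "emeasure lborel N = 0" and disj: "N \<inter> sing_set M = {}"
  shows "emeasure M N = 0"
proof -
  define Nn where "Nn n = {x \<in> N. \<forall>k. dyadic_density M k x \<le> real n}" for n
  have Nn[measurable]: "Nn n \<in> sets borel" for n unfolding Nn_def by measurable
  have "emeasure M (Nn n) = 0" for n
  proof -
    have "emeasure M (Nn n) \<le> ennreal (real n) * ennreal \<epsilon>" if \<epsilon>: "0 < \<epsilon>" for \<epsilon>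
    proof -
      have Nl: "emeasure lborel (Nn n) = 0"
        using emeasure_mono[of "Nn n" N lborel] null by (auto simp: Nn_def)
      obtain U where U: "open U" "Nn n \<subseteq> U" "emeasure lborel (U - Nn n) < ennreal \<epsilon>"
        using outer_regular_lborel[OF Nn[of n] \<epsilon>] by metis
      have [measurable]: "U \<in> sets borel" using U(1) by simp
      have "emeasure lborel U \<le> emeasure lborel (U - Nn n) + emeasure lborel (Nn n)"
        using emeasure_subadditive[of "U - Nn n" lborel "Nn n"] U(2) by (auto simp: Un_absorb2)
      then have Ul: "emeasure lborel U \<le> ennreal \<epsilon>" using U(3) Nl by simp
      \<comment> \<open>The inclusion in U limits the total length of the selected intervals; the
        density bound holds at every level around points of \<open>Nn n\<close>.\<close>
      define P where "P k i \<longleftrightarrow> dyadic k i \<subseteq> U \<and> 2 ^ k * measure M (dyadic k i) \<le> real n" for k i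
      let ?G = "{x::real. \<exists>k. P k \<lfloor>2 ^ k * x\<rfloor>}"
      have sub: "Nn n \<subseteq> ?G"
      proof
        fix x assume x: "x \<in> Nn n"
        then obtain d where d: "d > 0" "ball x d \<subseteq> U" using U(1,2) open_contains_ball by blast
        obtain k where k: "(1/2::real) ^ k < d" using real_arch_pow_inv[OF d(1), of "1/2"] by auto
        have "dyadic k \<lfloor>2 ^ k * x\<rfloor> \<subseteq> ball x d"
        proof
          fix y assume "y \<in> dyadic k \<lfloor>2 ^ k * x\<rfloor>"
          then have "\<bar>2 ^ k * x - 2 ^ k * y\<bar> < 1" unfolding in_dyadic_iff by linarith
          then have "2 ^ k * \<bar>x - y\<bar> < 1" by (simp add: abs_mult flip: right_diff_distrib)
          then have "\<bar>x - y\<bar> < (1/2) ^ k" by (simp add: field_simps power_one_over)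
          with k show "y \<in> ball x d" by (simp add: dist_real_def)
        qed
        then have "P k \<lfloor>2 ^ k * x\<rfloor>" using d(2) x by (auto simp: P_def Nn_def dyadic_density_def)
        then show "x \<in> ?G" by blast
      qed
      have "emeasure M (Nn n) \<le> emeasure M ?G"
        using sub by (rule emeasure_mono) (simp add: M_is_borel)
      also have "\<dots> \<le> ennreal (real n) * emeasure lborel ?G"
      proof (rule emeasure_dyadic_union_le)
        fix k i assume "P k i"
        then have "measure M (dyadic k i) \<le> real n * (1 / 2 ^ k)" by (simp add: P_def field_simps)
        then show "emeasure M (dyadic k i) \<le> ennreal (real n) * emeasure lborel (dyadic k i)"
          unfolding emeasure_lborel_dyadic emeasure_eq_measure
          by (subst ennreal_mult[symmetric]) (auto intro: ennreal_leI)
      qed (auto simp: M_is_borel)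
      also have "\<dots> \<le> ennreal (real n) * emeasure lborel U"
        by (intro mult_left_mono emeasure_mono) (auto simp: P_def in_dyadic_iff)
      also have "\<dots> \<le> ennreal (real n) * ennreal \<epsilon>" by (intro mult_left_mono Ul) simp
      finally show ?thesis .
    qed
    then have le: "measure M (Nn n) \<le> real n * \<epsilon>" if "0 < \<epsilon>" for \<epsilon>
      using that by (simp add: emeasure_eq_measure ennreal_mult[symmetric] less_imp_le)
    have "measure M (Nn n) \<le> real n * (1 / Suc m)" for m by (rule le) simp
    moreover have "(\<lambda>m. real n * (1 / Suc m)) \<longlonglongrightarrow> real n * 0"
      by (intro tendsto_mult tendsto_const LIMSEQ_Suc lim_const_over_n)
    ultimately have "measure M (Nn n) \<le> real n * 0"
      by (intro LIMSEQ_le_const[where X="\<lambda>m. real n * (1 / Suc m)"]) auto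
    then show ?thesis by (simp add: emeasure_eq_measure measure_le_0_iff)
  qed
  then have "emeasure M (\<Union>n. Nn n) = 0"
    by (intro emeasure_UN_eq_0) (auto simp: M_is_borel)
  moreover have "N \<subseteq> (\<Union>n. Nn n)"
    using disj by (force simp: Nn_def sing_set_def not_less)
  ultimately show ?thesis
    using emeasure_mono[of N "\<Union>n. Nn n" M] by (auto simp: M_is_borel)
qed

lemma lborel_pp_set: "emeasure lborel (pp_set M) = 0"
  using countable_pp_set by (rule emeasure_lborel_countable)

lemma emeasure_singleton_off_pp_set: "x \<notin> pp_set M \<Longrightarrow> emeasure M {x} = 0"
  by (simp add: pp_set_def emeasure_eq_measure)

end

text \<open>The complement of \<open>ac_set \<nu>\<close> is Lebesgue null, and inside
  \<open>ac_set \<nu>\<close> Lebesgue null sets are \<nu>-null, hence \<mu>-null; this settles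
  absolute continuity. By domination all atoms of \<mu> lie in \<open>pp_set \<nu>\<close>, which
  together with the first observation settles the other two types.\<close>

lemma classify_by_decomposition:
  fixes \<nu> \<mu> :: "real measure"
  assumes "finite_borel_measure \<nu>" "finite_borel_measure \<mu>"
    and dom: "\<And>N. N \<in> sets borel \<Longrightarrow> emeasure \<nu> N = 0 \<Longrightarrow> emeasure \<mu> N = 0"
  shows "absolutely_continuous lborel \<mu> \<longleftrightarrow> emeasure \<mu> (- ac_set \<nu>) = 0" (is ?ac)
    and "singular_continuous \<mu> \<longleftrightarrow> emeasure \<mu> (- sc_set \<nu>) = 0" (is ?sc)
    and "pure_point \<mu> \<longleftrightarrow> emeasure \<mu> (- pp_set \<nu>) = 0" (is ?pp)
proof -
  interpret \<nu>: finite_borel_measure \<nu> by fact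
  interpret \<mu>: finite_borel_measure \<mu> by fact
  note sets = \<mu>.M_is_borel
  have split: "emeasure \<mu> N = 0" if "emeasure \<mu> N1 = 0" "emeasure \<mu> N2 = 0" "N \<subseteq> N1 \<union> N2"
    "N1 \<in> sets borel" "N2 \<in> sets borel" for N N1 N2 :: "real set"
    using emeasure_mono[OF that(3), of \<mu>] emeasure_subadditive[of N1 \<mu> N2] that by (auto simp: sets)
  have pt: "emeasure \<mu> {x} = 0" if "x \<notin> pp_set \<nu>" for x
    using \<nu>.emeasure_singleton_off_pp_set[OF that] by (rule dom[rotated]) simp
  have cnt: "emeasure \<mu> S = 0" if "countable S" "S \<inter> pp_set \<nu> = {}" for S
  proof -
    have "(\<Union>x\<in>S. {x}) \<in> null_sets \<mu>"
      by (rule null_sets_UN'[OF that(1)]) (use that(2) pt in \<open>auto simp: sets null_sets_def\<close>)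
    then show ?thesis by (simp add: null_sets_def)
  qed
  show ?ac
  proof
    assume ac: "absolutely_continuous lborel \<mu>"
    have "- ac_set \<nu> = sing_set \<nu> \<union> pp_set \<nu>" by (simp add: ac_set_def)
    moreover have "emeasure lborel (sing_set \<nu> \<union> pp_set \<nu>) = 0"
      using emeasure_subadditive[of "sing_set \<nu>" lborel "pp_set \<nu>"]
      by (simp add: \<nu>.lborel_sing_set \<nu>.lborel_pp_set)
    ultimately have "- ac_set \<nu> \<in> null_sets lborel" by (simp add: null_sets_def sets.Un)
    with ac show "emeasure \<mu> (- ac_set \<nu>) = 0" unfolding absolutely_continuous_def null_sets_def by blast
  next
    assume 0: "emeasure \<mu> (- ac_set \<nu>) = 0"
    show "absolutely_continuous lborel \<mu>"
      unfolding absolutely_continuous_def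
    proof
      fix N :: "real set" assume "N \<in> null_sets lborel"
      then have N[measurable]: "N \<in> sets borel" and N0: "emeasure lborel N = 0" by (auto simp: null_sets_def)
      have "emeasure lborel (N \<inter> ac_set \<nu>) = 0"
        using emeasure_mono[of "N \<inter> ac_set \<nu>" N lborel] N0 by simp
      then have "emeasure \<nu> (N \<inter> ac_set \<nu>) = 0"
        by (rule \<nu>.null_off_sing_set[rotated]) (auto simp: ac_set_def[of \<nu>] intro!: sets.Int sets.Un borel_comp)
      then have "emeasure \<mu> (N \<inter> ac_set \<nu>) = 0" by (rule dom[rotated]) simp
      from split[OF this 0, of N] show "N \<in> null_sets \<mu>" by (auto simp: null_sets_def sets)
    qed
  qed
  show ?sc
  proof
    assume "singular_continuous \<mu>"
    then obtain S where S[measurable]: "S \<in> sets borel" and S0: "emeasure lborel S = 0" "emeasure \<mu> (- S) = 0"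
      and p: "\<And>x. emeasure \<mu> {x} = 0" unfolding singular_continuous_def by blast
    \<comment> \<open>A Lebesgue null carrier of \<mu> meets \<open>ac_set \<nu>\<close> in a
      Lebesgue null set disjoint from \<open>sing_set \<nu>\<close>, to which
      \<open>null_off_sing_set\<close> applies.\<close>
    have "emeasure lborel (S \<inter> ac_set \<nu>) = 0"
      using emeasure_mono[of "S \<inter> ac_set \<nu>" S lborel] S0 by simp
    then have "emeasure \<nu> (S \<inter> ac_set \<nu>) = 0"
      by (rule \<nu>.null_off_sing_set[rotated]) (auto simp: ac_set_def[of \<nu>] intro!: sets.Int sets.Un borel_comp)
    then have "emeasure \<mu> (S \<inter> ac_set \<nu>) = 0" by (rule dom[rotated]) simp
    with S0(2) have a: "emeasure \<mu> (ac_set \<nu>) = 0" by (rule split) auto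
    have "(\<Union>x\<in>pp_set \<nu>. {x}) \<in> null_sets \<mu>"
      by (rule null_sets_UN'[OF \<nu>.countable_pp_set]) (use p in \<open>auto simp: sets null_sets_def\<close>)
    then have b: "emeasure \<mu> (pp_set \<nu>) = 0" by (simp add: null_sets_def)
    from a b show "emeasure \<mu> (- sc_set \<nu>) = 0" by (rule split) (auto simp: ac_set_def[of \<nu>] sc_set_def intro!: sets.Un borel_comp)
  next
    assume 0: "emeasure \<mu> (- sc_set \<nu>) = 0"
    show "singular_continuous \<mu>"
      unfolding singular_continuous_def
    proof (intro conjI allI bexI)
      show "emeasure lborel (sc_set \<nu>) = 0"
        using emeasure_mono[of "sc_set \<nu>" "sing_set \<nu>" lborel] \<nu>.lborel_sing_set by (auto simp: sc_set_def)
      fix x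
      show "emeasure \<mu> {x} = 0"
      proof (cases "x \<in> pp_set \<nu>")
        case True
        then have "{x} \<subseteq> - sc_set \<nu>" by (auto simp: sc_set_def)
        from emeasure_mono[OF this, of \<mu>] 0 show ?thesis by (simp add: sets)
      qed (rule pt)
    qed (use 0 in auto)
  qed
  show ?pp
  proof
    assume "pure_point \<mu>"
    then obtain S where S: "countable S" "emeasure \<mu> (- S) = 0" unfolding pure_point_def by blast
    have Sb: "S \<in> sets borel" using S(1) by (rule sets.countable[rotated]) simp
    have "emeasure \<mu> (S - pp_set \<nu>) = 0" using S(1) by (intro cnt) auto
    with S(2) show "emeasure \<mu> (- pp_set \<nu>) = 0" by (rule split) (use Sb in auto)
  next
    assume "emeasure \<mu> (- pp_set \<nu>) = 0"
    then show "pure_point \<mu>" unfolding pure_point_def using \<nu>.countable_pp_set by blast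
  qed
qed

section \<open>The sequence space as a real Hilbert space\<close>

lemma ell2_cmult:
  assumes "u \<in> ell2"
  shows "(\<lambda>n. c * u n) \<in> ell2"
  using assms summable_on_cmult_right[of "\<lambda>n. (cmod (u n))\<^sup>2" UNIV "(cmod c)\<^sup>2"]
  by (simp add: ell2_def norm_mult power_mult_distrib)

lemma ell2_bounded_mult:
  assumes "u \<in> ell2" "\<And>n. cmod (c n) \<le> K"
  shows "(\<lambda>n. c n * u n) \<in> ell2"
proof -
  have "(\<lambda>n. K\<^sup>2 * (cmod (u n))\<^sup>2) summable_on UNIV"
    using assms(1) by (intro summable_on_cmult_right) (simp add: ell2_def)
  then have "(\<lambda>n. (cmod (c n * u n))\<^sup>2) summable_on UNIV"
  proof (rule summable_on_comparison_test)
    fix n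
    have "(cmod (c n))\<^sup>2 \<le> K\<^sup>2" using assms(2) by (intro power_mono) auto
    then show "(cmod (c n * u n))\<^sup>2 \<le> K\<^sup>2 * (cmod (u n))\<^sup>2"
      by (simp add: norm_mult power_mult_distrib mult_right_mono)
  qed auto
  then show ?thesis by (simp add: ell2_def)
qed

lemma ell2_add:
  assumes "u \<in> ell2" "v \<in> ell2"
  shows "(\<lambda>n. u n + v n) \<in> ell2"
proof -
  have "(\<lambda>n. 2 * (cmod (u n))\<^sup>2 + 2 * (cmod (v n))\<^sup>2) summable_on UNIV"
    using assms by (intro summable_on_add summable_on_cmult_right) (simp_all add: ell2_def)
  then have "(\<lambda>n. (cmod (u n + v n))\<^sup>2) summable_on UNIV"
  proof (rule summable_on_comparison_test)
    fix n
    have "(cmod (u n + v n))\<^sup>2 \<le> (cmod (u n) + cmod (v n))\<^sup>2"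
      by (intro power_mono norm_triangle_ineq) auto
    also have "\<dots> \<le> 2 * (cmod (u n))\<^sup>2 + 2 * (cmod (v n))\<^sup>2"
      using sum_squares_bound[of "cmod (u n)" "cmod (v n)"] by (simp add: power2_sum)
    finally show "(cmod (u n + v n))\<^sup>2 \<le> 2 * (cmod (u n))\<^sup>2 + 2 * (cmod (v n))\<^sup>2" .
  qed auto
  then show ?thesis by (simp add: ell2_def)
qed

lemma ell2_shift:
  assumes "u \<in> ell2"
  shows "(\<lambda>n. u (n + k)) \<in> ell2"
proof -
  have bij: "bij_betw (\<lambda>n::int. n + k) UNIV UNIV" by (rule bij_plus_right)
  show ?thesis
    using assms summable_on_reindex_bij_betw[OF bij, of "\<lambda>n. (cmod (u n))\<^sup>2"] by (simp add: ell2_def)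
qed

lemma ell2_product_summable:
  assumes "u \<in> ell2" "v \<in> ell2"
  shows "(\<lambda>n. cnj (u n) * v n) summable_on UNIV"
proof (rule abs_summable_summable)
  have "(\<lambda>n. (cmod (u n))\<^sup>2 + (cmod (v n))\<^sup>2) summable_on UNIV"
    using assms by (intro summable_on_add) (simp_all add: ell2_def)
  then show "(\<lambda>n. norm (cnj (u n) * v n)) summable_on UNIV"
  proof (rule summable_on_comparison_test)
    fix n
    show "norm (cnj (u n) * v n) \<le> (cmod (u n))\<^sup>2 + (cmod (v n))\<^sup>2"
      using sum_squares_bound[of "cmod (u n)" "cmod (v n)"] mult_nonneg_nonneg[of "cmod (u n)" "cmod (v n)"]
      unfolding norm_mult complex_mod_cnj mult.assoc using norm_ge_zero[of "u n"] norm_ge_zero[of "v n"] by linarith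
  qed auto
qed

lemma ell2_inner_add_left: "u \<in> ell2 \<Longrightarrow> v \<in> ell2 \<Longrightarrow> w \<in> ell2 \<Longrightarrow>
    ell2_inner (\<lambda>n. u n + v n) w = ell2_inner u w + ell2_inner v w"
  by (simp add: ell2_inner_def distrib_right infsum_add ell2_product_summable)

lemma ell2_inner_scale_left: "ell2_inner (\<lambda>n. c * u n) w = cnj c * ell2_inner u w"
  by (simp add: ell2_inner_def mult.assoc infsum_cmult_right')

lemma ell2_inner_commute: "ell2_inner u v = cnj (ell2_inner v u)"
  by (simp add: ell2_inner_def flip: infsum_cnj) (simp add: mult.commute)

lemma ell2_inner_self:
  assumes "u \<in> ell2"
  shows "ell2_inner u u = of_real (\<Sum>\<^sub>\<infinity>n. (cmod (u n))\<^sup>2)"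
proof -
  have "ell2_inner u u = (\<Sum>\<^sub>\<infinity>n. of_real ((cmod (u n))\<^sup>2))"
    unfolding ell2_inner_def by (intro infsum_cong) (metis complex_norm_square mult.commute)
  also have "\<dots> = of_real (\<Sum>\<^sub>\<infinity>n. (cmod (u n))\<^sup>2)"
    using assms by (intro infsumI has_sum_bounded_linear[OF bounded_linear_of_real] has_sum_infsum) (simp add: ell2_def)
  finally show ?thesis .
qed

section \<open>The Hilbert space type and its completeness\<close>

typedef l2 = "ell2 :: (int \<Rightarrow> complex) set" morphisms coord Abs_l2
  by (rule exI[of _ "\<lambda>_. 0"]) (simp add: ell2_def)

setup_lifting type_definition_l2

instantiation l2 :: real_vector
begin

lift_definition zero_l2 :: l2 is "\<lambda>_. 0" by (simp add: ell2_def)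
lift_definition plus_l2 :: "l2 \<Rightarrow> l2 \<Rightarrow> l2" is "\<lambda>u v n. u n + v n" by (rule ell2_add)
lift_definition uminus_l2 :: "l2 \<Rightarrow> l2" is "\<lambda>u n. - u n" by (simp add: ell2_def)
lift_definition minus_l2 :: "l2 \<Rightarrow> l2 \<Rightarrow> l2" is "\<lambda>u v n. u n - v n"
  subgoal for u v using ell2_add[of u "\<lambda>n. - v n"] by (simp add: ell2_def)
  done
lift_definition scaleR_l2 :: "real \<Rightarrow> l2 \<Rightarrow> l2" is "\<lambda>c u n. complex_of_real c * u n" by (rule ell2_cmult)

instance
  by standard (transfer; simp add: algebra_simps fun_eq_iff)+

end

lemmas coord_simps [simp] = zero_l2.rep_eq plus_l2.rep_eq uminus_l2.rep_eq minus_l2.rep_eq scaleR_l2.rep_eq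

instantiation l2 :: real_inner
begin

definition inner_l2 :: "l2 \<Rightarrow> l2 \<Rightarrow> real" where
  "inner_l2 u v = Re (ell2_inner (coord u) (coord v))"
definition norm_l2 :: "l2 \<Rightarrow> real" where
  "norm_l2 u = sqrt (inner u u)"
definition dist_l2 :: "l2 \<Rightarrow> l2 \<Rightarrow> real" where
  "dist_l2 u v = norm (u - v)"
definition sgn_l2 :: "l2 \<Rightarrow> l2" where
  "sgn_l2 u = u /\<^sub>R norm u"
definition uniformity_l2 :: "(l2 \<times> l2) filter" where
  "uniformity_l2 = (INF e\<in>{0<..}. principal {(x, y). dist x y < e})"
definition open_l2 :: "l2 set \<Rightarrow> bool" where
  "open_l2 U \<longleftrightarrow> (\<forall>x\<in>U. eventually (\<lambda>(x', y). x' = x \<longrightarrow> y \<in> U) uniformity)"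

lemma inner_self_l2: "inner u u = (\<Sum>\<^sub>\<infinity>n. (cmod (coord u n))\<^sup>2)"
  using coord[of u] by (simp add: inner_l2_def ell2_inner_self)

instance
proof
  fix x y z :: l2 and c :: real
  show "inner x y = inner y x"
    unfolding inner_l2_def by (subst ell2_inner_commute) simp
  show "inner (x + y) z = inner x z + inner y z"
    using coord[of x] coord[of y] coord[of z] by (simp add: inner_l2_def ell2_inner_add_left)
  show "inner (c *\<^sub>R x) y = c * inner x y"
    by (simp add: inner_l2_def ell2_inner_scale_left)
  show "0 \<le> inner x x"
    unfolding inner_self_l2 by (intro infsum_nonneg) auto
  show "inner x x = 0 \<longleftrightarrow> x = 0"
  proof
    assume "inner x x = 0"
    then have "(cmod (coord x n))\<^sup>2 = 0" for n
      using coord[of x] unfolding inner_self_l2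
      by (intro nonneg_infsum_le_0D[where A=UNIV and f="\<lambda>n. (cmod (coord x n))\<^sup>2"]) (auto simp: ell2_def)
    then have "coord x = coord 0" by auto
    then show "x = 0" unfolding coord_inject .
  qed (simp add: inner_l2_def ell2_inner_def)
qed (simp_all add: norm_l2_def dist_l2_def sgn_l2_def uniformity_l2_def open_l2_def)

end

lemma norm_l2_eq: "norm u = ell2_norm (coord u)"
  by (simp add: norm_l2_def inner_self_l2 ell2_norm_def)

lemma power2_norm_l2: "(norm u)\<^sup>2 = (\<Sum>\<^sub>\<infinity>n. (cmod (coord u n))\<^sup>2)"
  by (simp add: power2_norm_eq_inner inner_self_l2)

lemma coord_summable: "(\<lambda>n. (cmod (coord u n))\<^sup>2) summable_on UNIV"
  using coord[of u] by (simp add: ell2_def)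

lemma sum_coord_le_norm: "finite F \<Longrightarrow> (\<Sum>n\<in>F. (cmod (coord u n))\<^sup>2) \<le> (norm u)\<^sup>2"
  unfolding power2_norm_l2 by (rule finite_sum_le_infsum[OF coord_summable]) auto

lemma cmod_coord_le_norm: "cmod (coord u n) \<le> norm u"
  using sum_coord_le_norm[of "{n}" u] by (simp add: power2_le_iff_abs_le)

text \<open>The coordinates of a Cauchy sequence converge. The Cauchy bound passes to the limit over
  finite sets of coordinates, where limit and sum commute, and from there to the full sum.\<close>

instance l2 :: complete_space
proof
  fix X :: "nat \<Rightarrow> l2" assume X: "Cauchy X"
  have "Cauchy (\<lambda>k. coord (X k) n)" for n
    unfolding Cauchy_def
  proof (intro allI impI)
    fix e :: real assume "e > 0"
    then obtain K where "\<And>k l. k \<ge> K \<Longrightarrow> l \<ge> K \<Longrightarrow> dist (X k) (X l) < e"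
      using X unfolding Cauchy_def by meson
    moreover have "dist (coord (X k) n) (coord (X l) n) \<le> dist (X k) (X l)" for k l
      using cmod_coord_le_norm[of "X k - X l" n] by (simp add: dist_norm)
    ultimately show "\<exists>K. \<forall>k\<ge>K. \<forall>l\<ge>K. dist (coord (X k) n) (coord (X l) n) < e"
      by (meson le_less_trans)
  qed
  then have "\<forall>n. \<exists>l. (\<lambda>k. coord (X k) n) \<longlonglongrightarrow> l"
    by (simp add: Cauchy_convergent_iff convergent_def)
  then obtain c where c: "\<And>n. (\<lambda>k. coord (X k) n) \<longlonglongrightarrow> c n" by metis
  have close: "\<exists>K. \<forall>k\<ge>K. (\<lambda>n. coord (X k) n - c n) \<in> ell2 \<and> (\<Sum>\<^sub>\<infinity>n. (cmod (coord (X k) n - c n))\<^sup>2) \<le> e\<^sup>2"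
    if e: "e > 0" for e
  proof -
    obtain K where K: "\<And>k l. k \<ge> K \<Longrightarrow> l \<ge> K \<Longrightarrow> dist (X k) (X l) < e"
      using X e unfolding Cauchy_def by meson
    have fin: "(\<Sum>n\<in>F. (cmod (coord (X k) n - c n))\<^sup>2) \<le> e\<^sup>2" if k: "k \<ge> K" and F: "finite F" for k F
    proof (rule LIMSEQ_le_const2)
      show "(\<lambda>l. \<Sum>n\<in>F. (cmod (coord (X k) n - coord (X l) n))\<^sup>2) \<longlonglongrightarrow> (\<Sum>n\<in>F. (cmod (coord (X k) n - c n))\<^sup>2)"
        by (intro tendsto_intros c)
      show "\<exists>N. \<forall>l\<ge>N. (\<Sum>n\<in>F. (cmod (coord (X k) n - coord (X l) n))\<^sup>2) \<le> e\<^sup>2"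
      proof (intro exI[of _ K] allI impI)
        fix l assume "l \<ge> K"
        have "(\<Sum>n\<in>F. (cmod (coord (X k) n - coord (X l) n))\<^sup>2) \<le> (norm (X k - X l))\<^sup>2"
          using sum_coord_le_norm[OF F, of "X k - X l"] by simp
        also have "\<dots> \<le> e\<^sup>2"
          using K[OF k \<open>l \<ge> K\<close>] by (intro power_mono) (auto simp: dist_norm)
        finally show "(\<Sum>n\<in>F. (cmod (coord (X k) n - coord (X l) n))\<^sup>2) \<le> e\<^sup>2" .
      qed
    qed
    have "(\<lambda>n. coord (X k) n - c n) \<in> ell2" if k: "k \<ge> K" for k
      unfolding ell2_def mem_Collect_eq
      by (rule nonneg_bounded_partial_sums_imp_summable_on[where C="e\<^sup>2"])
         (auto intro!: eventually_finite_subsets_at_top_weakI fin k)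
    moreover from this have "(\<Sum>\<^sub>\<infinity>n. (cmod (coord (X k) n - c n))\<^sup>2) \<le> e\<^sup>2" if k: "k \<ge> K" for k
      using k by (intro infsum_le_finite_sums fin k) (simp_all add: ell2_def)
    ultimately show ?thesis by blast
  qed
  \<comment> \<open>Any tolerance would do; the aim is that c differs from some \<open>X k0\<close>
    by a square-summable sequence.\<close>
  obtain k0 where "(\<lambda>n. coord (X k0) n - c n) \<in> ell2" using close[of 1] by auto
  from ell2_add[OF coord[of "X k0"] ell2_cmult[OF this, of "-1"]] have cl: "c \<in> ell2" by simp
  have "X \<longlonglongrightarrow> Abs_l2 c"
  proof (rule LIMSEQ_I)
    fix e :: real assume e: "e > 0"
    obtain K where K: "\<And>k. k \<ge> K \<Longrightarrow> (\<Sum>\<^sub>\<infinity>n. (cmod (coord (X k) n - c n))\<^sup>2) \<le> (e/2)\<^sup>2"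
      using close[of "e/2"] e by auto
    have "(norm (X k - Abs_l2 c))\<^sup>2 \<le> (e/2)\<^sup>2" if "k \<ge> K" for k
      using K[OF that] by (simp add: power2_norm_l2 Abs_l2_inverse[OF cl])
    then have "norm (X k - Abs_l2 c) \<le> e/2" if "k \<ge> K" for k
      using that e by (simp add: power2_le_iff_abs_le)
    moreover have "e / 2 < e" using e by simp
    ultimately show "\<exists>K. \<forall>k\<ge>K. norm (X k - Abs_l2 c) < e"
      by (meson le_less_trans)
  qed
  then show "convergent X" by (auto simp: convergent_def)
qed

section \<open>Multiplication by i and a countable total family\<close>

lift_definition imag_unit :: "l2 \<Rightarrow> l2" is "\<lambda>u n. \<i> * u n" by (rule ell2_cmult)

lemma coord_imag_unit [simp]: "coord (imag_unit u) = (\<lambda>n. \<i> * coord u n)"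
  by (rule imag_unit.rep_eq)

lemma coord_eqI: "(\<And>n. coord u n = coord v n) \<Longrightarrow> u = v"
  using coord_inject[of u v] by auto

text \<open>Multiplying the first argument by i brings the imaginary part to the front. Identities
  between complex inner products thus reduce to real ones for operators that commute with
  \<open>imag_unit\<close>.\<close>

lemma ell2_inner_coord: "ell2_inner (coord u) (coord v) = Complex (inner u v) (inner (imag_unit u) v)"
  by (simp add: inner_l2_def ell2_inner_scale_left complex_eq_iff)

lemma imag_unit_imag_unit: "imag_unit (imag_unit u) = - u"
  by (rule coord_eqI) (simp flip: mult.assoc)

lemma imag_unit_skew: "inner (imag_unit u) v = - inner u (imag_unit v)"
  using ell2_inner_scale_left[of \<i> "coord v" "coord u"] ell2_inner_commute[of "coord v" "coord u"]
  by (subst inner_commute[of u]) (simp add: inner_l2_def ell2_inner_scale_left)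

lemma linear_imag_unit: "linear imag_unit"
  by (intro linearI) (auto intro!: coord_eqI simp: algebra_simps)

lemma norm_imag_unit [simp]: "norm (imag_unit u) = norm u"
  by (simp add: norm_l2_eq ell2_norm_def norm_mult)

lemma bounded_linear_imag_unit: "bounded_linear imag_unit"
  using linear_imag_unit by (intro bounded_linear_intro[where K=1]) (auto simp: linear_add linear_scale)

lift_definition delta :: "int \<Rightarrow> l2" is "\<lambda>k n. if n = k then 1 else 0"
proof -
  fix k :: int
  have "(\<lambda>n. (cmod (if n = k then 1 else 0))\<^sup>2) summable_on UNIV \<longleftrightarrow> (\<lambda>n. (cmod (if n = k then 1 else 0))\<^sup>2) summable_on {k}"
    by (rule summable_on_cong_neutral) auto
  then show "(\<lambda>n. if n = k then 1 else 0) \<in> ell2" by (simp add: ell2_def)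
qed

lemma coord_delta: "coord (delta k) n = (if n = k then 1 else 0)"
  by (simp add: delta.rep_eq)

lemma ell2_inner_delta: "ell2_inner (coord (delta k)) u = u k"
proof -
  have "ell2_inner (coord (delta k)) u = (\<Sum>\<^sub>\<infinity>n\<in>{k}. cnj (coord (delta k) n) * u n)"
    unfolding ell2_inner_def by (rule infsum_cong_neutral) (auto simp: coord_delta)
  then show ?thesis by (simp add: coord_delta)
qed

lemma inner_delta: "inner (delta k) u = Re (coord u k)"
  by (simp add: inner_l2_def ell2_inner_delta)

lemma norm_delta [simp]: "norm (delta k) = 1"
  by (simp add: norm_eq_sqrt_inner inner_delta coord_delta)

text \<open>Over the reals the span of the \<open>delta k\<close> is not dense; the vectors \<open>\<i> delta k\<close> are needed as well.\<close>

definition basis_vec :: "nat \<Rightarrow> l2" where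
  "basis_vec i = (if even i then delta (int_decode (i div 2)) else imag_unit (delta (int_decode (i div 2))))"

lemma norm_basis_vec: "norm (basis_vec i) = 1"
  by (simp add: basis_vec_def)

lemma coord_sum: "coord (\<Sum>i\<in>I. g i) n = (\<Sum>i\<in>I. coord (g i) n)"
  by (induction I rule: infinite_finite_induct) auto

lemma dense_basis_vec: "closure (span (range basis_vec)) = UNIV"
proof -
  have d: "delta k \<in> span (range basis_vec)" "imag_unit (delta k) \<in> span (range basis_vec)" for k
  proof -
    have "delta k = basis_vec (2 * int_encode k)" "imag_unit (delta k) = basis_vec (2 * int_encode k + 1)"
      by (simp_all add: basis_vec_def)
    then show "delta k \<in> span (range basis_vec)" "imag_unit (delta k) \<in> span (range basis_vec)"
      by (metis rangeI span_base)+
  qed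
  have "u \<in> closure (span (range basis_vec))" for u
    unfolding closure_approachable
  proof (intro allI impI)
    fix e :: real assume e: "e > 0"
    have hs: "((\<lambda>n. (cmod (coord u n))\<^sup>2) has_sum (norm u)\<^sup>2) UNIV"
      unfolding power2_norm_l2 by (rule has_sum_infsum[OF coord_summable])
    \<comment> \<open>Half of e^2, since the approximation gives only a weak inequality and the
      distance must be strictly less than e.\<close>
    have e2: "0 < e\<^sup>2 / 2" using e by simp
    obtain F where F: "finite F" "dist (\<Sum>n\<in>F. (cmod (coord u n))\<^sup>2) ((norm u)\<^sup>2) \<le> e\<^sup>2 / 2"
      using has_sum_finite_approximation[OF hs e2] by blast
    \<comment> \<open>The truncation of u to F; real scalars force each coordinate to be split into
      its real and imaginary part.\<close>
    define v where "v = (\<Sum>k\<in>F. Re (coord u k) *\<^sub>R delta k + Im (coord u k) *\<^sub>R imag_unit (delta k))"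
    have vs: "v \<in> span (range basis_vec)"
      unfolding v_def by (intro span_sum span_add span_scale d)
    have vc: "coord v n = (if n \<in> F then coord u n else 0)" for n
    proof -
      have "coord v n = (\<Sum>k\<in>F. if k = n then coord u n else 0)"
        unfolding v_def coord_sum by (intro sum.cong) (auto simp: coord_delta complex_eq_iff)
      then show ?thesis using F(1) by simp
    qed
    have "(norm (v - u))\<^sup>2 = (\<Sum>\<^sub>\<infinity>n\<in>-F. (cmod (coord u n))\<^sup>2)"
      unfolding power2_norm_l2 by (rule infsum_cong_neutral) (auto simp: vc)
    also have "\<dots> = (norm u)\<^sup>2 - (\<Sum>n\<in>F. (cmod (coord u n))\<^sup>2)"
      unfolding power2_norm_l2 Compl_eq_Diff_UNIV
      using F(1) by (subst infsum_Diff[OF coord_summable]) auto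
    also have "\<dots> < e\<^sup>2" using F(2) e2 unfolding dist_real_def by linarith
    finally have "norm (v - u) < e" using e by (simp add: power_less_imp_less_base)
    then show "\<exists>y\<in>span (range basis_vec). dist y u < e" using vs by (auto simp: dist_norm)
  qed
  then show ?thesis by auto
qed

section \<open>Discrete Schroedinger operators\<close>

definition schroedinger :: "(int \<Rightarrow> real) \<Rightarrow> operator" where
  "schroedinger V u = (\<lambda>n. u (n - 1) + u (n + 1) + complex_of_real (V n) * u n)"

definition schroedinger_l2 :: "(int \<Rightarrow> real) \<Rightarrow> l2 \<Rightarrow> l2" where
  "schroedinger_l2 V u = Abs_l2 (schroedinger V (coord u))"

lift_definition shift :: "int \<Rightarrow> l2 \<Rightarrow> l2" is "\<lambda>k u n. u (n + k)" by (rule ell2_shift)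

lemma coord_shift [simp]: "coord (shift k u) n = coord u (n + k)"
  by (simp add: shift.rep_eq)

lemma norm_shift [simp]: "norm (shift k u) = norm u"
  unfolding norm_l2_eq ell2_norm_def
  using infsum_reindex_bij_betw[OF bij_plus_right[of k], of "\<lambda>n. (cmod (coord u n))\<^sup>2"] by simp

lemma inner_shift: "inner (shift k u) v = inner u (shift (-k) v)"
proof -
  have "(\<Sum>\<^sub>\<infinity>n. cnj (coord u (n + k)) * coord v n) = (\<Sum>\<^sub>\<infinity>n. cnj (coord u n) * coord v (n - k))"
    using infsum_reindex_bij_betw[OF bij_plus_right[of k], of "\<lambda>n. cnj (coord u n) * coord v (n - k)"] by simp
  then show ?thesis by (simp add: inner_l2_def ell2_inner_def)
qed

locale schroedinger_operator =
  fixes V :: "int \<Rightarrow> real" and C :: real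
  assumes potential_bound: "\<bar>V n\<bar> \<le> C"
begin

lemma C_nonneg: "0 \<le> C"
  using potential_bound[of 0] by linarith

definition potential :: "l2 \<Rightarrow> l2" where
  "potential u = Abs_l2 (\<lambda>n. complex_of_real (V n) * coord u n)"

lemma coord_potential [simp]: "coord (potential u) n = complex_of_real (V n) * coord u n"
  unfolding potential_def using potential_bound
  by (subst Abs_l2_inverse[OF ell2_bounded_mult[OF coord, where K=C]]) auto

lemma norm_potential_le: "norm (potential u) \<le> C * norm u"
proof -
  have "(norm (potential u))\<^sup>2 \<le> (\<Sum>\<^sub>\<infinity>n. C\<^sup>2 * (cmod (coord u n))\<^sup>2)"
    unfolding power2_norm_l2
  proof (rule infsum_mono)
    show "(\<lambda>n. C\<^sup>2 * (cmod (coord u n))\<^sup>2) summable_on UNIV"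
      by (intro summable_on_cmult_right coord_summable)
    fix n
    have "\<bar>V n\<bar>\<^sup>2 \<le> C\<^sup>2" using potential_bound by (intro power_mono) auto
    then show "(cmod (coord (potential u) n))\<^sup>2 \<le> C\<^sup>2 * (cmod (coord u n))\<^sup>2"
      by (simp add: norm_mult power_mult_distrib mult_right_mono)
  qed (rule coord_summable)
  also have "\<dots> = (C * norm u)\<^sup>2"
    by (simp add: infsum_cmult_right' power_mult_distrib power2_norm_l2)
  finally show ?thesis using C_nonneg by (simp add: power2_le_iff_abs_le)
qed

lemma schroedinger_l2_eq: "schroedinger_l2 V u = shift (-1) u + shift 1 u + potential u"
proof -
  have "schroedinger V (coord u) = coord (shift (-1) u + shift 1 u + potential u)"
    by (auto simp: schroedinger_def)
  then show ?thesis by (simp only: schroedinger_l2_def coord_inverse)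
qed

lemma coord_schroedinger_l2 [simp]: "coord (schroedinger_l2 V u) = schroedinger V (coord u)"
  unfolding schroedinger_l2_eq by (auto simp: schroedinger_def)

lemma potential_symmetric: "inner (potential u) v = inner u (potential v)"
  by (simp add: inner_l2_def ell2_inner_def mult_ac)

text \<open>The norm bound 2 + C comes from two isometric shifts and a potential bounded by C; it is
  also the radius of an interval carrying all spectral measures.\<close>

sublocale complex_operator "schroedinger_l2 V" "2 + C" basis_vec imag_unit
proof (intro complex_operator.intro separable_operator.intro bounded_symmetric_operator.intro
    symmetric_operator.intro bounded_symmetric_operator_axioms.intro separable_operator_axioms.intro
    complex_operator_axioms.intro)
  fix u v :: l2 and i
  show "linear (schroedinger_l2 V)"
    by (rule linearI) (auto intro!: coord_eqI simp: schroedinger_def algebra_simps)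
  show "inner (schroedinger_l2 V u) v = inner u (schroedinger_l2 V v)"
    by (simp add: schroedinger_l2_eq inner_add_left inner_add_right inner_shift potential_symmetric)
  have "norm (schroedinger_l2 V u) \<le> norm (shift (-1) u + shift 1 u) + norm (potential u)"
    unfolding schroedinger_l2_eq by (rule norm_triangle_ineq)
  also have "\<dots> \<le> norm u + norm u + C * norm u"
    using norm_triangle_ineq[of "shift (-1) u" "shift 1 u"] norm_potential_le[of u] by simp
  finally show "norm (schroedinger_l2 V u) \<le> (2 + C) * norm u" by (simp add: algebra_simps)
  show "0 < 2 + C" using C_nonneg by simp
  show "norm (basis_vec i) = 1" by (rule norm_basis_vec)
  show "closure (span (range basis_vec)) = UNIV" by (rule dense_basis_vec)
  show "bounded_linear imag_unit" by (rule bounded_linear_imag_unit)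
  show "imag_unit (schroedinger_l2 V u) = schroedinger_l2 V (imag_unit u)"
    by (rule coord_eqI) (simp add: schroedinger_def algebra_simps)
  show "imag_unit (imag_unit u) = - u" by (rule imag_unit_imag_unit)
  show "inner (imag_unit u) v = - inner u (imag_unit v)" by (rule imag_unit_skew)
qed

section \<open>Transfer to spectral resolutions on sequences, and their uniqueness\<close>

interpretation P: projection_measure proj
  by (rule projection_measure_proj)

text \<open>\<open>Abs_l2\<close> is arbitrary off \<open>ell2\<close>, which is harmless because
  operators are tested on \<open>ell2\<close> only.\<close>

definition seq_proj :: "real set \<Rightarrow> operator" where
  "seq_proj B u = coord (proj B (Abs_l2 u))"

lemma complex_mult_Re_Im: "complex_of_real (Re a) * x + complex_of_real (Im a) * (\<i> * x) = a * x"
  by (simp add: complex_eq_iff)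

text \<open>A complex scalar acts as a real combination of the identity and
  \<open>imag_unit\<close>. Complex linearity of the projections thus follows from real linearity
  and commutation with \<open>imag_unit\<close>.\<close>

lemma Abs_l2_combination:
  assumes "u \<in> ell2" "v \<in> ell2"
  shows "Abs_l2 (\<lambda>n. a * u n + b * v n) = Re a *\<^sub>R Abs_l2 u + Im a *\<^sub>R imag_unit (Abs_l2 u)
           + (Re b *\<^sub>R Abs_l2 v + Im b *\<^sub>R imag_unit (Abs_l2 v))" (is "_ = ?r")
proof -
  have "(\<lambda>n. a * u n + b * v n) = coord ?r"
    using assms complex_mult_Re_Im[of a] complex_mult_Re_Im[of b] by (intro ext) (simp add: Abs_l2_inverse)
  then show ?thesis by (simp only: coord_inverse)
qed

lemma proj_imag_unit: "B \<in> sets borel \<Longrightarrow> proj B (imag_unit u) = imag_unit (proj B u)"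
  using fcalc_commute[of "indicator B", OF _ J_bounded J_commute, of u] by (simp add: proj_def)

lemma orthogonal_projection_seq_proj:
  assumes B: "B \<in> sets borel"
  shows "orthogonal_projection (seq_proj B)"
  unfolding orthogonal_projection_def
proof (intro conjI allI ballI)
  show "seq_proj B ` ell2 \<subseteq> ell2" using coord by (auto simp: seq_proj_def)
  fix u v :: "int \<Rightarrow> complex" and a b assume uv: "u \<in> ell2" "v \<in> ell2"
  note lin = linear_add[OF linear_proj[OF B]] linear_scale[OF linear_proj[OF B]]
  show "seq_proj B (\<lambda>n. a * u n + b * v n) = (\<lambda>n. a * seq_proj B u n + b * seq_proj B v n)"
    using uv complex_mult_Re_Im[of a] complex_mult_Re_Im[of b]
    by (intro ext) (simp add: seq_proj_def Abs_l2_combination lin proj_imag_unit[OF B])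
  show "seq_proj B (seq_proj B u) = seq_proj B u"
    using B by (simp add: seq_proj_def coord_inverse proj_Int)
  have "ell2_inner (coord (Abs_l2 u)) (seq_proj B v) = ell2_inner (seq_proj B u) (coord (Abs_l2 v))"
    unfolding seq_proj_def ell2_inner_coord
    by (simp add: proj_symmetric[OF B] flip: proj_imag_unit[OF B])
  then show "ell2_inner u (seq_proj B v) = ell2_inner (seq_proj B u) v"
    using uv by (simp add: Abs_l2_inverse)
qed

lemma vector_measure_eq_vmeas:
  assumes "\<And>B. B \<in> sets borel \<Longrightarrow> Re (ell2_inner u (E B u)) = inner U (F B U)" "projection_measure F"
  shows "vector_measure E u = projection_measure.vmeas F U"
  unfolding vector_measure_def projection_measure.vmeas_def[OF assms(2)]
  using assms(1) sets.sigma_sets_eq[of "borel :: real measure"] by (intro measure_of_eq) auto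

lemma vector_measure_seq_proj:
  assumes "u \<in> ell2"
  shows "vector_measure seq_proj u = spectral_meas (Abs_l2 u)"
  unfolding vmeas_proj[symmetric]
  by (rule vector_measure_eq_vmeas[OF _ projection_measure_proj])
     (use assms in \<open>simp add: inner_l2_def seq_proj_def Abs_l2_inverse\<close>)

text \<open>This is the imaginary part of the quadratic form: skewness of \<open>imag_unit\<close>
  and symmetry of the operator make it its own negative.\<close>

lemma inner_imag_schroedinger: "inner (imag_unit u) (schroedinger_l2 V u) = 0"
  using imag_unit_skew[of u "schroedinger_l2 V u"] symmetric[of u "imag_unit u"]
  by (simp add: J_commute inner_commute)

lemma spectral_resolution_seq_proj: "spectral_resolution (schroedinger V) seq_proj"
  unfolding spectral_resolution_def projection_valued_measure_def
proof (intro conjI ballI allI impI)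
  fix B :: "real set" assume "B \<in> sets borel"
  then show "orthogonal_projection (seq_proj B)" by (rule orthogonal_projection_seq_proj)
next
  fix u :: "int \<Rightarrow> complex" assume u: "u \<in> ell2"
  then show "seq_proj UNIV u = u" by (simp add: seq_proj_def Abs_l2_inverse)
  have "ell2_inner (coord (Abs_l2 u)) (coord (schroedinger_l2 V (Abs_l2 u))) =
      complex_of_real (LINT x|spectral_meas (Abs_l2 u). x)"
    unfolding ell2_inner_coord inner_imag_schroedinger
    using integral_poly_spectral_meas[where p="[:0, 1:]" and u="Abs_l2 u"] by (simp add: complex_eq_iff)
  then show "ell2_inner u (schroedinger V u) = complex_of_real (integral\<^sup>L (vector_measure seq_proj u) (\<lambda>x. x))"
    using u by (simp add: vector_measure_seq_proj Abs_l2_inverse)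
next
  fix F :: "nat \<Rightarrow> real set" and u assume F: "range F \<subseteq> sets borel" "disjoint_family F" and u: "u \<in> ell2"
  have "(\<lambda>N. norm ((\<Sum>i<N. proj (F i) (Abs_l2 u)) - proj (\<Union>i. F i) (Abs_l2 u))) \<longlonglongrightarrow> 0"
    using P.E_sums[OF F, of "Abs_l2 u"] by (simp add: sums_def tendsto_norm_zero_iff LIM_zero_iff)
  then show "(\<lambda>N. ell2_norm (\<lambda>n. (\<Sum>i<N. seq_proj (F i) u n) - seq_proj (\<Union>i. F i) u n)) \<longlonglongrightarrow> 0"
    by (simp add: norm_l2_eq coord_sum seq_proj_def fun_diff_def)
next
  have "proj (- {-(2 + C)..2 + C}) u = 0" for u
    using resolution_proj by (simp add: resolution_def resolution_axioms_def)
  then show "\<exists>R. \<forall>u\<in>ell2. seq_proj (- {- R..R}) u = (\<lambda>n. 0)"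
    by (intro exI[of _ "2 + C"]) (simp add: seq_proj_def)
qed

text \<open>An arbitrary competitor E, transported to \<open>l2\<close>, becomes a
  \<open>resolution\<close>, and \<open>resolution_spectral_meas\<close> identifies its measures
  through their moments. Uniqueness of the measure at each vector is what the definite description
  in \<open>spectral_measure\<close> needs.\<close>

lemma spectral_resolution_unique:
  assumes E: "spectral_resolution (schroedinger V) E" and u: "u \<in> ell2"
  shows "vector_measure E u = spectral_meas (Abs_l2 u)"
proof -
  have pvm: "projection_valued_measure E"
    and supp: "\<exists>R. \<forall>u\<in>ell2. E (- {-R..R}) u = (\<lambda>n. 0)"
    and form: "\<And>u. u \<in> ell2 \<Longrightarrow> ell2_inner u (schroedinger V u) = complex_of_real (integral\<^sup>L (vector_measure E u) (\<lambda>x. x))"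
    using E unfolding spectral_resolution_def by blast+
  have op: "orthogonal_projection (E B)" if "B \<in> sets borel" for B
    using pvm that unfolding projection_valued_measure_def by blast
  \<comment> \<open>\<open>spectral_resolution\<close> constrains E on Borel sets only, so the
    coordinates of \<open>F B\<close> are known just for these.\<close>
  define F where "F B U = Abs_l2 (E B (coord U))" for B U
  have mem: "E B (coord U) \<in> ell2" if "B \<in> sets borel" for B U
    using op[OF that] coord[of U] unfolding orthogonal_projection_def by blast
  have cF: "coord (F B U) = E B (coord U)" if "B \<in> sets borel" for B U
    using mem[OF that] by (simp add: F_def Abs_l2_inverse)
  have pm: "projection_measure F"
  proof (rule projection_measure.intro)
    fix B :: "real set" and U W :: l2 assume B: "B \<in> sets borel"
    have lin: "E B (\<lambda>n. a * coord U n + b * coord W n) = (\<lambda>n. a * E B (coord U) n + b * E B (coord W) n)" for a b U W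
      using op[OF B] coord[of U] coord[of W] unfolding orthogonal_projection_def by blast
    show "linear (F B)"
    proof (rule linearI; rule coord_eqI)
      fix U W :: l2 and c :: real and n
      show "coord (F B (U + W)) n = coord (F B U + F B W) n"
        using lin[of 1 U 1 W] by (simp add: cF[OF B])
      show "coord (F B (c *\<^sub>R U)) n = coord (c *\<^sub>R F B U) n"
        using lin[of "of_real c" U 0 U] by (simp add: cF[OF B])
    qed
    have "ell2_inner (coord U) (E B (coord W)) = ell2_inner (E B (coord U)) (coord W)"
      using op[OF B] coord[of U] coord[of W] unfolding orthogonal_projection_def by blast
    then show "inner (F B U) W = inner U (F B W)" by (simp add: inner_l2_def cF[OF B])
    have "E B (E B (coord U)) = E B (coord U)"
      using op[OF B] coord[of U] unfolding orthogonal_projection_def by blast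
    then show "F B (F B U) = F B U" by (intro coord_eqI) (simp add: cF[OF B])
  next
    fix U
    have "E UNIV (coord U) = coord U"
      using pvm coord[of U] unfolding projection_valued_measure_def by blast
    then show "F UNIV U = U" by (simp add: F_def coord_inverse)
  next
    fix B :: "nat \<Rightarrow> real set" and U assume B: "range B \<subseteq> sets borel" "disjoint_family B"
    have Bi: "B i \<in> sets borel" for i using B by auto
    then have BU: "(\<Union>i. B i) \<in> sets borel" by blast
    have "(\<lambda>N. ell2_norm (\<lambda>n. (\<Sum>i<N. E (B i) (coord U) n) - E (\<Union>i. B i) (coord U) n)) \<longlonglongrightarrow> 0"
      using pvm B coord[of U] unfolding projection_valued_measure_def by blast
    then have "(\<lambda>N. norm ((\<Sum>i<N. F (B i) U) - F (\<Union>i. B i) U)) \<longlonglongrightarrow> 0"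
      by (simp add: norm_l2_eq coord_sum cF[OF Bi] cF[OF BU] fun_diff_def)
    then show "(\<lambda>i. F (B i) U) sums F (\<Union>i. B i) U"
      by (simp add: sums_def tendsto_norm_zero_iff LIM_zero_iff)
  qed
  have vm: "vector_measure E (coord U) = projection_measure.vmeas F U" for U
    by (rule vector_measure_eq_vmeas[OF _ pm]) (simp add: inner_l2_def cF)
  obtain r where r: "\<And>u. u \<in> ell2 \<Longrightarrow> E (- {-r..r}) u = (\<lambda>n. 0)" using supp by blast
  have "resolution F (schroedinger_l2 V) r"
  proof (intro resolution.intro resolution_axioms.intro pm)
    show "symmetric_operator (schroedinger_l2 V)" by unfold_locales
    show "bounded_linear (schroedinger_l2 V)" by (rule A_bounded)
    fix U
    show "F (- {-r..r}) U = 0" using r[OF coord[of U]] by (intro coord_eqI) (simp add: cF)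
    show "inner U (schroedinger_l2 V U) = (LINT x|projection_measure.vmeas F U. x)"
      using form[OF coord[of U]] by (simp add: inner_l2_def vm)
  qed
  from resolution_spectral_meas[OF this, of "Abs_l2 u"] vm[of "Abs_l2 u"] show ?thesis
    using u by (simp add: Abs_l2_inverse)
qed

lemma spectral_measure_schroedinger:
  assumes "u \<in> ell2"
  shows "spectral_measure (schroedinger V) u = spectral_meas (Abs_l2 u)"
  unfolding spectral_measure_def
proof (rule the_equality)
  show "\<exists>E. spectral_resolution (schroedinger V) E \<and> spectral_meas (Abs_l2 u) = vector_measure E u"
    using spectral_resolution_seq_proj vector_measure_seq_proj[OF assms] by metis
qed (use spectral_resolution_unique[OF _ assms] in blast)

section \<open>The three subspaces and the spectra on them\<close>

lemma subspaces_eq: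
  shows "ac_subspace (schroedinger V) = coord ` {u. proj (ac_set max_meas) u = u}"
    and "sc_subspace (schroedinger V) = coord ` {u. proj (sc_set max_meas) u = u}"
    and "pp_subspace (schroedinger V) = coord ` {u. proj (pp_set max_meas) u = u}"
proof -
  interpret \<nu>: real_distribution max_meas by (rule real_distribution_max_meas)
  note classify = classify_by_decomposition[OF \<nu>.finite_borel_measure_M finite_borel_measure_spectral_meas
      null_sets_max_meas_spectral_meas, simplified]
  have *: "{u \<in> ell2. Q (spectral_measure (schroedinger V) u)} = coord ` {U. Q (spectral_meas U)}" for Q
  proof (intro equalityI subsetI)
    fix u assume "u \<in> {u \<in> ell2. Q (spectral_measure (schroedinger V) u)}"
    then have "u = coord (Abs_l2 u)" "Q (spectral_meas (Abs_l2 u))"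
      by (auto simp: Abs_l2_inverse spectral_measure_schroedinger)
    then show "u \<in> coord ` {U. Q (spectral_meas U)}" by blast
  qed (use coord in \<open>auto simp: spectral_measure_schroedinger coord_inverse\<close>)
  show "ac_subspace (schroedinger V) = coord ` {u. proj (ac_set max_meas) u = u}"
    unfolding ac_subspace_def * by (simp add: proj_eq_self_iff classify)
  show "sc_subspace (schroedinger V) = coord ` {u. proj (sc_set max_meas) u = u}"
    unfolding sc_subspace_def * by (simp add: proj_eq_self_iff classify)
  show "pp_subspace (schroedinger V) = coord ` {u. proj (pp_set max_meas) u = u}"
    unfolding pp_subspace_def * by (simp add: proj_eq_self_iff classify)
qed

text \<open>\<open>coord\<close> is an isometry onto \<open>ell2\<close> that carries
  \<open>shifted (Re z) (Im z)\<close> to the operator minus z, so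
  \<open>shifted_invertible_iff\<close> can be transported along it.\<close>

lemma spectrum_on_range:
  assumes B: "B \<in> sets borel"
  shows "spectrum_on (coord ` {u. proj B u = u}) (schroedinger V) = complex_support max_meas B"
proof -
  define X where "X = {u. proj B u = u}"
  have "z \<in> spectrum_on (coord ` X) (schroedinger V) \<longleftrightarrow>
     (\<forall>\<delta>>0. emeasure max_meas (B \<inter> {x. (x - Re z)\<^sup>2 + (Im z)\<^sup>2 < \<delta>}) \<noteq> 0)" for z
  proof -
    define S where "S = shifted (Re z) (Im z)"
    define S' where "S' = (\<lambda>u n. schroedinger V u n - z * u n)"
    have S: "S' (coord u) = coord (S u)" for u
      by (auto simp: S_def S'_def shifted_def fun_eq_iff complex_eq_iff)
    have inj: "inj_on coord Y" for Y by (rule inj_onI) (simp add: coord_inject)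
    have "bij_betw S' (coord ` X) (coord ` X) \<longleftrightarrow> bij_betw S X X"
    proof
      assume *: "bij_betw S' (coord ` X) (coord ` X)"
      have "coord ` (S ` X) = coord ` X"
        using * S by (force simp: bij_betw_def image_image)
      then have "S ` X = X" by (simp add: inj_image_eq_iff[OF inj])
      moreover have "inj_on S X"
        using * by (auto simp: bij_betw_def inj_on_def S coord_inject)
      ultimately show "bij_betw S X X" by (simp add: bij_betw_def)
    next
      assume *: "bij_betw S X X"
      have "inj_on S' (coord ` X)"
        using * by (auto simp: bij_betw_def inj_on_def S coord_inject)
      moreover have "S' ` coord ` X = coord ` S ` X" by (simp add: image_image S)
      ultimately show "bij_betw S' (coord ` X) (coord ` X)" using * by (simp add: bij_betw_def)
    qed
    moreover have "(\<exists>C. \<forall>u\<in>coord ` X. ell2_norm u \<le> C * ell2_norm (S' u)) \<longleftrightarrow>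
        (\<exists>C. \<forall>u\<in>X. norm u \<le> C * norm (S u))"
      by (simp add: S norm_l2_eq)
    moreover have "z \<in> spectrum_on (coord ` X) (schroedinger V) \<longleftrightarrow>
        \<not> (bij_betw S' (coord ` X) (coord ` X) \<and> (\<exists>C. \<forall>u\<in>coord ` X. ell2_norm u \<le> C * ell2_norm (S' u)))"
      by (simp add: spectrum_on_def S'_def)
    ultimately show ?thesis
      using shifted_invertible_iff[OF B, of "Re z" "Im z", folded X_def S_def] by (simp only:) blast
  qed
  then show ?thesis unfolding X_def complex_support_def by blast
qed

end

section \<open>Measurability, invariance and ergodicity\<close>

lemma measurable_mixture_kernel:
  assumes rd: "\<And>\<omega> i. \<omega> \<in> space M \<Longrightarrow> real_distribution (\<mu> \<omega> i)"
    and meas: "\<And>i. (\<lambda>\<omega>. \<mu> \<omega> i) \<in> measurable M (subprob_algebra borel)"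
  shows "(\<lambda>\<omega>. mixture (\<mu> \<omega>)) \<in> measurable M (subprob_algebra borel)"
proof (rule measurable_subprob_algebra)
  fix \<omega> assume "\<omega> \<in> space M"
  then have *: "real_distribution (mixture (\<mu> \<omega>))" by (intro real_distribution_mixture rd)
  then show "subprob_space (mixture (\<mu> \<omega>))"
    by (auto simp: real_distribution_def intro: prob_space_imp_subprob_space)
  show "sets (mixture (\<mu> \<omega>)) = sets borel"
    using * by (rule real_distribution.events_eq_borel)
next
  fix B :: "real set" assume B: "B \<in> sets borel"
  have [measurable]: "(\<lambda>\<omega>. emeasure (\<mu> \<omega> i) B) \<in> borel_measurable M" for i
    using measurable_emeasure_kernel[OF meas B] .
  have "(\<lambda>\<omega>. \<Sum>i. ennreal (pmf (geometric_pmf (1/2)) i) * emeasure (\<mu> \<omega> i) B) \<in> borel_measurable M"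
    by measurable
  moreover have "emeasure (mixture (\<mu> \<omega>)) B = (\<Sum>i. ennreal (pmf (geometric_pmf (1/2)) i) * emeasure (\<mu> \<omega> i) B)"
    if "\<omega> \<in> space M" for \<omega>
    using emeasure_mixture[OF rd[OF that] B]
    by (simp only: nn_integral_measure_pmf nn_integral_count_space_nat)
  ultimately show "(\<lambda>\<omega>. emeasure (mixture (\<mu> \<omega>)) B) \<in> borel_measurable M"
    by (simp cong: measurable_cong)
qed

text \<open>Half-lines generate the Borel sets and are stable under intersection, and their masses
  are the values of the distribution function.\<close>

lemma measurable_kernel_of_cdf:
  assumes rd: "\<And>\<omega>. \<omega> \<in> space M \<Longrightarrow> real_distribution (K \<omega>)"
    and cdf: "\<And>t. (\<lambda>\<omega>. cdf (K \<omega>) t) \<in> borel_measurable M"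
  shows "K \<in> measurable M (subprob_algebra borel)"
proof (rule measurable_subprob_algebra_generated[where \<Omega>=UNIV and G="range (\<lambda>t::real. {..t})"])
  show "sets borel = sigma_sets UNIV (range (\<lambda>t::real. {..t}))"
    by (simp add: borel_eq_atMost)
  show "Int_stable (range (\<lambda>t::real. {..t}))"
    by (auto simp: Int_stable_def min_def intro!: range_eqI)
next
  fix \<omega> assume "\<omega> \<in> space M"
  then have *: "real_distribution (K \<omega>)" by (rule rd)
  then show "subprob_space (K \<omega>)"
    by (auto simp: real_distribution_def intro: prob_space_imp_subprob_space)
  show "sets (K \<omega>) = sets borel"
    using * by (rule real_distribution.events_eq_borel)
next
  fix A assume "A \<in> range (\<lambda>t::real. {..t})"
  then obtain t where A: "A = {..t}" by blast
  have "emeasure (K \<omega>) A = ennreal (cdf (K \<omega>) t)" if "\<omega> \<in> space M" for \<omega>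
  proof -
    interpret real_distribution "K \<omega>" using that by (rule rd)
    show ?thesis by (simp add: A cdf_def emeasure_eq_measure)
  qed
  moreover have "(\<lambda>\<omega>. ennreal (cdf (K \<omega>) t)) \<in> borel_measurable M" using cdf by simp
  ultimately show "(\<lambda>\<omega>. emeasure (K \<omega>) A) \<in> borel_measurable M"
    by (simp cong: measurable_cong)
next
  have "emeasure (K \<omega>) UNIV = 1" if "\<omega> \<in> space M" for \<omega>
  proof -
    interpret real_distribution "K \<omega>" using that by (rule rd)
    show ?thesis using emeasure_space_1 by simp
  qed
  then show "(\<lambda>\<omega>. emeasure (K \<omega>) UNIV) \<in> borel_measurable M" by (simp cong: measurable_cong)
qed auto

context
  fixes M :: "'a measure" and K :: "'a \<Rightarrow> real measure"
  assumes K: "K \<in> measurable M (subprob_algebra borel)"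
begin

text \<open>The interval varies with x while the measure varies with \<omega>. The triples whose
  last entry lies in the dyadic interval of x form a measurable set, being given by an equality of
  floors, and a kernel assigns measurable masses to the sections of such a set.\<close>

lemma dyadic_density_kernel_measurable:
  "(\<lambda>z. dyadic_density (K (fst z)) k (snd z)) \<in> borel_measurable (M \<Otimes>\<^sub>M borel)"
proof -
  have "(SIGMA z:space (M \<Otimes>\<^sub>M borel). dyadic k \<lfloor>2 ^ k * snd z\<rfloor>) =
    {w \<in> space ((M \<Otimes>\<^sub>M borel) \<Otimes>\<^sub>M borel). \<lfloor>2 ^ k * (snd w :: real)\<rfloor> = \<lfloor>2 ^ k * (snd (fst w) :: real)\<rfloor>}"
    by (auto simp: space_pair_measure in_dyadic_iff)
  also have "\<dots> \<in> sets ((M \<Otimes>\<^sub>M borel) \<Otimes>\<^sub>M borel)" by measurable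
  finally have "(\<lambda>z. measure (K (fst z)) (dyadic k \<lfloor>2 ^ k * (snd z :: real)\<rfloor>)) \<in> borel_measurable (M \<Otimes>\<^sub>M borel)"
    by (rule measure_measurable_subprob_algebra2[OF _ measurable_compose[OF measurable_fst K]])
  then show ?thesis unfolding dyadic_density_def by measurable
qed

lemma measure_singleton_kernel_measurable:
  "(\<lambda>z. measure (K (fst z)) {snd z}) \<in> borel_measurable (M \<Otimes>\<^sub>M borel)"
proof -
  have "(SIGMA z:space (M \<Otimes>\<^sub>M borel). {snd z :: real}) =
    {w \<in> space ((M \<Otimes>\<^sub>M borel) \<Otimes>\<^sub>M borel). snd w = snd (fst w)}"
    by (auto simp: space_pair_measure)
  also have "\<dots> \<in> sets ((M \<Otimes>\<^sub>M borel) \<Otimes>\<^sub>M borel)" by measurable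
  finally show ?thesis
    by (rule measure_measurable_subprob_algebra2[OF _ measurable_compose[OF measurable_fst K]])
qed

text \<open>Measure and set vary together with \<omega>, so the sets must be measurable as one
  subset of the product space; the countable conditions behind \<open>sing_set\<close> and
  \<open>pp_set\<close> provide this.\<close>

lemma emeasure_decomposition_measurable:
  assumes I[measurable]: "I \<in> sets borel"
  shows "(\<lambda>\<omega>. emeasure (K \<omega>) (ac_set (K \<omega>) \<inter> I)) \<in> borel_measurable M"
    and "(\<lambda>\<omega>. emeasure (K \<omega>) (sc_set (K \<omega>) \<inter> I)) \<in> borel_measurable M"
    and "(\<lambda>\<omega>. emeasure (K \<omega>) (pp_set (K \<omega>) \<inter> I)) \<in> borel_measurable M"
proof -
  note [measurable] = dyadic_density_kernel_measurable measure_singleton_kernel_measurable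
  define S where "S z \<longleftrightarrow> (\<forall>n::nat. \<exists>k. real n < dyadic_density (K (fst z)) k (snd z))" for z
  define P where "P z \<longleftrightarrow> measure (K (fst z)) {snd z} \<noteq> 0" for z
  have [measurable]: "Measurable.pred (M \<Otimes>\<^sub>M borel) S" "Measurable.pred (M \<Otimes>\<^sub>M borel) P"
    unfolding S_def P_def by measurable
  have SP: "S z \<longleftrightarrow> snd z \<in> sing_set (K (fst z))" "P z \<longleftrightarrow> snd z \<in> pp_set (K (fst z))" for z
    by (simp_all add: S_def P_def sing_set_def pp_set_def)
  have eq: "(SIGMA \<omega>:space M. ac_set (K \<omega>) \<inter> I) = {z \<in> space (M \<Otimes>\<^sub>M borel). \<not> S z \<and> \<not> P z \<and> snd z \<in> I}"
    "(SIGMA \<omega>:space M. sc_set (K \<omega>) \<inter> I) = {z \<in> space (M \<Otimes>\<^sub>M borel). S z \<and> \<not> P z \<and> snd z \<in> I}"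
    "(SIGMA \<omega>:space M. pp_set (K \<omega>) \<inter> I) = {z \<in> space (M \<Otimes>\<^sub>M borel). P z \<and> snd z \<in> I}"
    by (auto simp: SP ac_set_def sc_set_def space_pair_measure)
  show "(\<lambda>\<omega>. emeasure (K \<omega>) (ac_set (K \<omega>) \<inter> I)) \<in> borel_measurable M"
    "(\<lambda>\<omega>. emeasure (K \<omega>) (sc_set (K \<omega>) \<inter> I)) \<in> borel_measurable M"
    "(\<lambda>\<omega>. emeasure (K \<omega>) (pp_set (K \<omega>) \<inter> I)) \<in> borel_measurable M"
    by (rule emeasure_measurable_subprob_algebra2[OF _ K]; unfold eq; measurable)+
qed

end

section \<open>Measurability and shift covariance of the random operator\<close>

lemma shift_shift: "shift k (shift l u) = shift (k + l) u"
  by (rule coord_eqI) (simp add: add.assoc)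

lemma shift_0 [simp]: "shift 0 u = u"
  by (rule coord_eqI) simp

lemma linear_shift: "linear (shift k)"
  by (rule linearI; rule coord_eqI) simp_all

locale ergodic_schroedinger =
  fixes M :: "'a measure" and T :: "'a \<Rightarrow> 'a" and f :: "'a \<Rightarrow> real" and C :: real
  assumes inv: "invertible_map M T" and erg: "ergodic M T"
    and f_measurable [measurable]: "f \<in> borel_measurable M"
    and f_bound: "\<omega> \<in> space M \<Longrightarrow> \<bar>f \<omega>\<bar> \<le> C"
begin

lemma T_measurable [measurable]: "T \<in> measurable M M"
  and T_inv_measurable: "inv_into (space M) T \<in> measurable M M"
  and T_bij: "bij_betw T (space M) (space M)"
  using inv by (auto simp: invertible_map_def)

lemma T_space: "\<omega> \<in> space M \<Longrightarrow> T \<omega> \<in> space M"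
  using T_measurable by (rule measurable_space)

lemma int_iterate_measurable [measurable]: "int_iterate M T n \<in> measurable M M"
  unfolding int_iterate_def by (auto intro!: measurable_compose_n T_measurable T_inv_measurable)

lemma int_iterate_shift:
  assumes "\<omega> \<in> space M"
  shows "int_iterate M T n (T \<omega>) = int_iterate M T (n + 1) \<omega>"
proof (cases "n \<ge> 0")
  case True
  then have "nat (n + 1) = Suc (nat n)" by simp
  then show ?thesis using True by (simp add: int_iterate_def funpow_swap1)
next
  case False
  \<comment> \<open>One inverse step is split off a negative power to cancel the application of T.
    For n = -1 the remaining exponent is 0, which \<open>int_iterate\<close> treats as a forward
    power.\<close>
  then have n: "nat (- n) = Suc (nat (- (n + 1)))" by simp
  have "inv_into (space M) T (T \<omega>) = \<omega>"
    using T_bij assms by (simp add: bij_betw_def)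
  then have "int_iterate M T n (T \<omega>) = (inv_into (space M) T ^^ nat (- (n + 1))) \<omega>"
    unfolding int_iterate_def n using False by (simp add: funpow_swap1)
  then show ?thesis using False by (auto simp: int_iterate_def)
qed

definition potential_at :: "'a \<Rightarrow> int \<Rightarrow> real" where
  "potential_at \<omega> n = f (int_iterate M T n \<omega>)"

lemma hamiltonian_eq: "hamiltonian M T f \<omega> = schroedinger (potential_at \<omega>)"
  by (auto simp: hamiltonian_def schroedinger_def potential_at_def)

lemma schroedinger_operator_at: "\<omega> \<in> space M \<Longrightarrow> schroedinger_operator (potential_at \<omega>) C"
  by unfold_locales (simp add: potential_at_def f_bound measurable_space[OF int_iterate_measurable])

definition H :: "'a \<Rightarrow> l2 \<Rightarrow> l2" where
  "H \<omega> = schroedinger_l2 (potential_at \<omega>)"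

definition \<mu> :: "'a \<Rightarrow> l2 \<Rightarrow> real measure" where
  "\<mu> \<omega> = bounded_symmetric_operator.spectral_meas (H \<omega>) (2 + C)"

definition \<nu> :: "'a \<Rightarrow> real measure" where
  "\<nu> \<omega> = separable_operator.max_meas (H \<omega>) (2 + C) basis_vec"

lemma complex_operator_at:
  assumes "\<omega> \<in> space M"
  shows "complex_operator (H \<omega>) (2 + C) basis_vec imag_unit"
proof -
  interpret schroedinger_operator "potential_at \<omega>" C by (rule schroedinger_operator_at) fact
  show ?thesis unfolding H_def by unfold_locales
qed

text \<open>A coordinate of the image involves three neighbouring coordinates and one value of f
  along the orbit, so induction over the polynomial stays with complex-valued functions and asks for
  no measurable structure on \<open>l2\<close>.\<close>

lemma coord_poly_op_measurable:
  "(\<lambda>\<omega>. coord (poly_op (H \<omega>) p u) n) \<in> borel_measurable M"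
proof (induction p arbitrary: n)
  case 0
  have "poly_op (H \<omega>) 0 u = 0" for \<omega> by (simp add: poly_op_def)
  then show ?case by simp
next
  case (pCons a p)
  have "coord (poly_op (H \<omega>) (pCons a p) u) n = complex_of_real a * coord u n +
      (coord (poly_op (H \<omega>) p u) (n - 1) + coord (poly_op (H \<omega>) p u) (n + 1) +
       complex_of_real (f (int_iterate M T n \<omega>)) * coord (poly_op (H \<omega>) p u) n)" if "\<omega> \<in> space M" for \<omega>
  proof -
    interpret schroedinger_operator "potential_at \<omega>" C by (rule schroedinger_operator_at) fact
    show ?thesis unfolding H_def by (simp add: poly_op_pCons) (simp add: schroedinger_def potential_at_def)
  qed
  moreover note [measurable] = pCons.IH
  have "(\<lambda>\<omega>. complex_of_real a * coord u n +
      (coord (poly_op (H \<omega>) p u) (n - 1) + coord (poly_op (H \<omega>) p u) (n + 1) +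
       complex_of_real (f (int_iterate M T n \<omega>)) * coord (poly_op (H \<omega>) p u) n)) \<in> borel_measurable M"
    by measurable
  ultimately show ?case by (simp cong: measurable_cong)
qed

lemma inner_basis_vec_measurable:
  "(\<lambda>\<omega>. inner (basis_vec i) (poly_op (H \<omega>) p u)) \<in> borel_measurable M"
proof -
  note [measurable] = coord_poly_op_measurable
  have "inner (imag_unit (delta k)) w = Im (coord w k)" for k w
    by (simp add: imag_unit_skew inner_delta)
  then show ?thesis by (simp add: basis_vec_def inner_delta)
qed

lemma real_distribution_\<mu>:
  assumes "\<omega> \<in> space M"
  shows "real_distribution (\<mu> \<omega> (basis_vec i))"
proof -
  interpret complex_operator "H \<omega>" "2 + C" basis_vec imag_unit by (rule complex_operator_at) fact
  show ?thesis unfolding \<mu>_def by (rule real_distribution_spectral_meas) (rule norm_basis_vec)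
qed

lemma \<nu>_eq_mixture: "\<omega> \<in> space M \<Longrightarrow> \<nu> \<omega> = mixture (\<lambda>i. \<mu> \<omega> (basis_vec i))"
  unfolding \<nu>_def \<mu>_def using complex_operator_at[THEN complex_operator.axioms(1)]
  by (rule separable_operator.max_meas_def)

text \<open>The polynomials of \<open>polynomial_limit_of_cdf\<close> do not depend on the measure,
  hence not on \<omega>: each distribution function is a pointwise limit of measurable moments, and
  the mixture inherits measurability.\<close>

lemma \<nu>_kernel: "\<nu> \<in> measurable M (subprob_algebra borel)"
proof -
  have "(\<lambda>\<omega>. \<mu> \<omega> (basis_vec i)) \<in> measurable M (subprob_algebra borel)" for i
  proof (rule measurable_kernel_of_cdf)
    fix t
    obtain q where q: "\<And>M. finite_borel_measure M \<Longrightarrow> AE x in M. x \<in> {-(2 + C)..2 + C} \<Longrightarrow>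
       (\<lambda>k. LINT x|M. poly (q k) x) \<longlonglongrightarrow> cdf M t"
      using polynomial_limit_of_cdf[of "-(2 + C)" "2 + C" t] by metis
    show "(\<lambda>\<omega>. cdf (\<mu> \<omega> (basis_vec i)) t) \<in> borel_measurable M"
    proof (rule borel_measurable_LIMSEQ_real)
      fix \<omega> assume "\<omega> \<in> space M"
      then interpret complex_operator "H \<omega>" "2 + C" basis_vec imag_unit by (rule complex_operator_at)
      show "(\<lambda>k. inner (basis_vec i) (poly_op (H \<omega>) (q k) (basis_vec i))) \<longlonglongrightarrow> cdf (\<mu> \<omega> (basis_vec i)) t"
        using q[OF finite_borel_measure_spectral_meas AE_spectral_meas]
        by (simp add: \<mu>_def integral_poly_spectral_meas)
    qed (rule inner_basis_vec_measurable)
  qed (rule real_distribution_\<mu>)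
  then have "(\<lambda>\<omega>. mixture (\<lambda>i. \<mu> \<omega> (basis_vec i))) \<in> measurable M (subprob_algebra borel)"
    by (intro measurable_mixture_kernel real_distribution_\<mu>)
  then show ?thesis by (simp add: \<nu>_eq_mixture cong: measurable_cong)
qed

text \<open>Translation by one site intertwines the operators at \<omega> and
  \<open>T \<omega>\<close> and preserves inner products, so both vectors have the same
  moments.\<close>

lemma \<mu>_shift:
  assumes \<omega>: "\<omega> \<in> space M"
  shows "\<mu> (T \<omega>) (shift 1 u) = \<mu> \<omega> u"
proof -
  interpret a: schroedinger_operator "potential_at \<omega>" C by (rule schroedinger_operator_at) fact
  interpret b: schroedinger_operator "potential_at (T \<omega>)" C by (intro schroedinger_operator_at T_space) fact
  have H: "shift 1 (schroedinger_l2 (potential_at \<omega>) w) = schroedinger_l2 (potential_at (T \<omega>)) (shift 1 w)" for w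
    using int_iterate_shift[OF \<omega>]
    by (intro coord_eqI) (simp add: schroedinger_def potential_at_def)
  have p: "shift 1 (poly_op (schroedinger_l2 (potential_at \<omega>)) p u) =
      poly_op (schroedinger_l2 (potential_at (T \<omega>))) p (shift 1 u)" for p
    by (induction p) (simp_all add: a.poly_op_pCons b.poly_op_pCons H linear_0[OF linear_shift]
        linear_add[OF linear_shift] linear_scale[OF linear_shift])
  have "inner (shift 1 u) (shift 1 w) = inner u w" for w
    by (simp add: inner_shift shift_shift)
  then have "b.is_spectral_measure (shift 1 u) (a.spectral_meas u)"
    using a.is_spectral_measure_spectral_meas[of u]
    by (simp add: a.is_spectral_measure_def b.is_spectral_measure_def flip: p)
  from b.spectral_meas_unique[OF this] show ?thesis by (simp add: \<mu>_def H_def)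
qed

section \<open>Almost sure constancy of the parts of the spectrum\<close>

text \<open>Membership of an interval in the support of a part, expressed through all spectral measures
  and thus independently of the choice of a measure of maximal spectral type.\<close>

lemma part_positive_iff:
  assumes \<omega>: "\<omega> \<in> space M" and D[measurable]: "D \<in> sets borel" and I[measurable]: "I \<in> sets borel"
    and classify: "\<And>u. Q (\<mu> \<omega> u) \<longleftrightarrow> emeasure (\<mu> \<omega> u) (- D) = 0"
  shows "emeasure (\<nu> \<omega>) (D \<inter> I) \<noteq> 0 \<longleftrightarrow> (\<exists>u. Q (\<mu> \<omega> u) \<and> emeasure (\<mu> \<omega> u) I \<noteq> 0)"
proof -
  interpret complex_operator "H \<omega>" "2 + C" basis_vec imag_unit by (rule complex_operator_at) fact
  note defs = \<mu>_def \<nu>_def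
  show ?thesis
  proof
    assume "emeasure (\<nu> \<omega>) (D \<inter> I) \<noteq> 0"
    then obtain i where i: "emeasure (spectral_meas (basis_vec i)) (D \<inter> I) \<noteq> 0"
      by (auto simp: defs max_meas_eq_0_iff)
    define u where "u = proj D (basis_vec i)"
    have "proj D u = u" by (simp add: u_def proj_Int)
    then have "Q (\<mu> \<omega> u)" by (simp add: classify) (simp add: defs proj_eq_self_iff)
    moreover have "(norm (proj I u))\<^sup>2 = measure (spectral_meas (basis_vec i)) (D \<inter> I)"
      by (simp add: u_def proj_Int norm_proj Int_commute)
    then have "measure (spectral_meas u) I \<noteq> 0"
      using i finite_borel_measure.axioms(1)[OF finite_borel_measure_spectral_meas, of "basis_vec i"]
      by (simp add: norm_proj finite_measure.emeasure_eq_measure)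
    then have "emeasure (\<mu> \<omega> u) I \<noteq> 0" by (auto simp: defs measure_def)
    ultimately show "\<exists>u. Q (\<mu> \<omega> u) \<and> emeasure (\<mu> \<omega> u) I \<noteq> 0" by blast
  next
    assume "\<exists>u. Q (\<mu> \<omega> u) \<and> emeasure (\<mu> \<omega> u) I \<noteq> 0"
    then obtain u where u: "emeasure (spectral_meas u) (- D) = 0" "emeasure (spectral_meas u) I \<noteq> 0"
      by (auto simp: classify) (auto simp: defs)
    have "emeasure (spectral_meas u) I \<le> emeasure (spectral_meas u) ((D \<inter> I) \<union> - D)"
      by (intro emeasure_mono) auto
    also have "\<dots> \<le> emeasure (spectral_meas u) (D \<inter> I) + emeasure (spectral_meas u) (- D)"
      by (intro emeasure_subadditive) auto
    finally have "emeasure (spectral_meas u) (D \<inter> I) \<noteq> 0" using u by auto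
    then show "emeasure (\<nu> \<omega>) (D \<inter> I) \<noteq> 0"
      using null_sets_max_meas_spectral_meas[of "D \<inter> I" u] by (auto simp: defs)
  qed
qed

text \<open>\<open>part_positive_iff\<close> rewrites each condition on an interval in terms of all
  spectral measures, a form that \<open>\<mu>_shift\<close> shows to be invariant. Ergodicity then
  decides it, and a support is determined by the rational intervals that are charged. The predicate
  Q stands for one of the three types of measure.\<close>

lemma part_spectrum_constant:
  assumes meas: "\<And>I. I \<in> sets borel \<Longrightarrow> (\<lambda>\<omega>. emeasure (\<nu> \<omega>) (D \<omega> \<inter> I)) \<in> borel_measurable M"
    and D: "\<And>\<omega>. \<omega> \<in> space M \<Longrightarrow> D \<omega> \<in> sets borel"
    and classify: "\<And>\<omega> u. \<omega> \<in> space M \<Longrightarrow> Q (\<mu> \<omega> u) \<longleftrightarrow> emeasure (\<mu> \<omega> u) (- D \<omega>) = 0"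
  obtains S where "compact S"
    "AE \<omega> in M. complex_support (\<nu> \<omega>) (D \<omega>) = complex_of_real ` S"
proof -
  define N where "N a b = {\<omega> \<in> space M. emeasure (\<nu> \<omega>) (D \<omega> \<inter> {a<..<b}) \<noteq> 0}" for a b :: real
  have N_meas: "N a b \<in> sets M" for a b
    unfolding N_def using meas[of "{a<..<b}"] by measurable
  have "T -` N a b \<inter> space M = N a b" for a b
  proof -
    have sh: "(\<exists>u. Q (\<mu> (T \<omega>) u) \<and> emeasure (\<mu> (T \<omega>) u) {a<..<b} \<noteq> 0) \<longleftrightarrow>
          (\<exists>u. Q (\<mu> \<omega> u) \<and> emeasure (\<mu> \<omega> u) {a<..<b} \<noteq> 0)" (is "?l \<longleftrightarrow> ?r") if \<omega>: "\<omega> \<in> space M" for \<omega>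
    proof
      assume ?l
      then obtain u where u: "Q (\<mu> (T \<omega>) u)" "emeasure (\<mu> (T \<omega>) u) {a<..<b} \<noteq> 0" by blast
      have "\<mu> (T \<omega>) u = \<mu> \<omega> (shift (-1) u)"
        using \<mu>_shift[OF \<omega>, of "shift (-1) u"] by (simp add: shift_shift)
      with u show ?r by metis
    next
      assume ?r
      then show ?l using \<mu>_shift[OF \<omega>] by metis
    qed
    \<comment> \<open>This removes \<nu> and D, neither of which is known to be unchanged under
      T.\<close>
    have mem: "\<omega> \<in> N a b \<longleftrightarrow> (\<exists>u. Q (\<mu> \<omega> u) \<and> emeasure (\<mu> \<omega> u) {a<..<b} \<noteq> 0)"
      if \<omega>: "\<omega> \<in> space M" for \<omega>
      using \<omega> part_positive_iff[where Q=Q, OF \<omega> D[OF \<omega>] _ classify[OF \<omega>], of "{a<..<b}"] by (simp add: N_def)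
    have "T \<omega> \<in> N a b \<longleftrightarrow> \<omega> \<in> N a b" if \<omega>: "\<omega> \<in> space M" for \<omega>
      unfolding mem[OF \<omega>] mem[OF T_space[OF \<omega>]] by (rule sh[OF \<omega>])
    moreover have "N a b \<subseteq> space M" by (auto simp: N_def)
    ultimately show ?thesis by auto
  qed
  then have erg01: "emeasure M (N a b) = 0 \<or> emeasure M (space M - N a b) = 0" for a b
    using bspec[OF erg[unfolded ergodic_def] N_meas[of a b]] by simp
  \<comment> \<open>The points all of whose rational neighbourhoods are charged for almost every
    \<omega>; the complement is a union of rational intervals, hence open.\<close>
  define S0 where "S0 = {x. \<forall>a\<in>\<rat>. \<forall>b\<in>\<rat>. a < x \<longrightarrow> x < b \<longrightarrow> emeasure M (N a b) \<noteq> 0}"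
  \<comment> \<open>The norm bound 2 + C supplies compactness; \<open>key\<close> shows that it cuts
    nothing off the support.\<close>
  define S where "S = {-(2 + C)..2 + C} \<inter> S0"
  have "closed S0"
  proof -
    have "- S0 = (\<Union>(a, b)\<in>{(a, b). a \<in> \<rat> \<and> b \<in> \<rat> \<and> emeasure M (N a b) = 0}. {a<..<b})"
      by (auto simp: S0_def)
    then have "open (- S0)" by (auto intro!: open_UN)
    then show ?thesis by (simp add: closed_def)
  qed
  then have "compact S" unfolding S_def by (intro compact_Int_closed compact_Icc)
  have "AE \<omega> in M. \<forall>a\<in>\<rat>. \<forall>b\<in>\<rat>. \<omega> \<in> N a b \<longleftrightarrow> emeasure M (N a b) \<noteq> 0"
  proof -
    have "AE \<omega> in M. \<omega> \<in> N a b \<longleftrightarrow> emeasure M (N a b) \<noteq> 0" for a b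
    proof (cases "emeasure M (N a b) = 0")
      case True
      then show ?thesis using N_meas[of a b] by (intro AE_I[where N="N a b"]) auto
    next
      case False
      then show ?thesis using N_meas[of a b] erg01[of a b] by (intro AE_I[where N="space M - N a b"]) auto
    qed
    then show ?thesis by (simp add: AE_ball_countable countable_rat)
  qed
  then have "AE \<omega> in M. complex_support (\<nu> \<omega>) (D \<omega>) = complex_of_real ` S"
    using AE_space
  proof eventually_elim
    case (elim \<omega>)
    note \<omega> = elim(2)
    interpret complex_operator "H \<omega>" "2 + C" basis_vec imag_unit by (rule complex_operator_at) fact
    have sets: "sets (\<nu> \<omega>) = sets borel"
      unfolding \<nu>_def using real_distribution_max_meas by (rule real_distribution.events_eq_borel)
    have mono: "emeasure (\<nu> \<omega>) (D \<omega> \<inter> B) \<noteq> 0" if "emeasure (\<nu> \<omega>) (D \<omega> \<inter> A) \<noteq> 0" "A \<subseteq> B" "B \<in> sets borel" for A B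
    proof -
      have "D \<omega> \<inter> A \<subseteq> D \<omega> \<inter> B" "D \<omega> \<inter> B \<in> sets (\<nu> \<omega>)" using that(2,3) D[OF \<omega>] by (auto simp: sets)
      from emeasure_mono[OF this] that(1) show ?thesis by (metis le_zero_eq)
    qed
    have key: "(\<forall>\<delta>>0. emeasure (\<nu> \<omega>) (D \<omega> \<inter> {x. (x - r)\<^sup>2 < \<delta>}) \<noteq> 0) \<longleftrightarrow> r \<in> S" for r
    proof
      assume *: "\<forall>\<delta>>0. emeasure (\<nu> \<omega>) (D \<omega> \<inter> {x. (x - r)\<^sup>2 < \<delta>}) \<noteq> 0"
      have "r \<in> {-(2 + C)..2 + C}"
      proof (rule ccontr)
        assume r: "r \<notin> {-(2 + C)..2 + C}"
        \<comment> \<open>The distance from r to the interval, so that the points closer to r than d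
          carry no spectral mass.\<close>
        define d where "d = max (r - (2 + C)) (- (2 + C) - r)"
        have d: "0 < d" using r by (auto simp: d_def)
        have dr: "(x - r)\<^sup>2 \<ge> d\<^sup>2" if "x \<in> {-(2 + C)..2 + C}" for x
          unfolding abs_le_square_iff[symmetric] using d that by (auto simp: d_def)
        have "emeasure (spectral_meas u) (D \<omega> \<inter> {x. (x - r)\<^sup>2 < d\<^sup>2}) = 0" for u
        proof -
          have "AE x in spectral_meas u. x \<notin> D \<omega> \<inter> {x. (x - r)\<^sup>2 < d\<^sup>2}"
            using AE_spectral_meas by (rule eventually_mono) (use dr in force)
          then show ?thesis
            using D[OF \<omega>] by (subst (asm) AE_iff_measurable[of "D \<omega> \<inter> {x. (x - r)\<^sup>2 < d\<^sup>2}"]) auto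
        qed
        then have "emeasure (\<nu> \<omega>) (D \<omega> \<inter> {x. (x - r)\<^sup>2 < d\<^sup>2}) = 0"
          using D[OF \<omega>] by (simp add: \<nu>_def max_meas_eq_0_iff)
        then show False using spec[OF *, of "d\<^sup>2"] d by simp
      qed
      moreover have "r \<in> S0"
        unfolding S0_def
      proof (intro CollectI ballI impI)
        fix a b :: real assume ab: "a \<in> \<rat>" "b \<in> \<rat>" "a < r" "r < b"
        define d where "d = min (r - a) (b - r)"
        have d: "0 < d" using ab by (simp add: d_def)
        have sub: "{x. (x - r)\<^sup>2 < d\<^sup>2} \<subseteq> {a<..<b}"
        proof
          fix x assume "x \<in> {x. (x - r)\<^sup>2 < d\<^sup>2}"
          then have "\<bar>x - r\<bar> < d" using d power2_less_imp_less[of "\<bar>x - r\<bar>" d] by simp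
          then show "x \<in> {a<..<b}" by (auto simp: d_def)
        qed
        have "emeasure (\<nu> \<omega>) (D \<omega> \<inter> {x. (x - r)\<^sup>2 < d\<^sup>2}) \<noteq> 0"
          using spec[OF *, of "d\<^sup>2"] d by simp
        from mono[OF this sub] have "emeasure (\<nu> \<omega>) (D \<omega> \<inter> {a<..<b}) \<noteq> 0" by simp
        then have "\<omega> \<in> N a b" using \<omega> by (simp add: N_def)
        then show "emeasure M (N a b) \<noteq> 0" using elim(1) ab by blast
      qed
      ultimately show "r \<in> S" by (simp add: S_def)
    next
      assume r: "r \<in> S"
      show "\<forall>\<delta>>0. emeasure (\<nu> \<omega>) (D \<omega> \<inter> {x. (x - r)\<^sup>2 < \<delta>}) \<noteq> 0"
      proof (intro allI impI)
        fix \<delta> :: real assume "\<delta> > 0"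
        then have s: "r - sqrt \<delta> < r" "r < r + sqrt \<delta>" by simp_all
        obtain a where a: "a \<in> \<rat>" "r - sqrt \<delta> < a" "a < r" using Rats_dense_in_real[OF s(1)] by blast
        obtain b where b: "b \<in> \<rat>" "r < b" "b < r + sqrt \<delta>" using Rats_dense_in_real[OF s(2)] by blast
        have "emeasure M (N a b) \<noteq> 0" using r a b unfolding S_def S0_def by blast
        then have "\<omega> \<in> N a b" using elim(1) a(1) b(1) by blast
        then have pos: "emeasure (\<nu> \<omega>) (D \<omega> \<inter> {a<..<b}) \<noteq> 0" by (simp add: N_def)
        have sub: "{a<..<b} \<subseteq> {x. (x - r)\<^sup>2 < \<delta>}"
        proof
          fix x assume "x \<in> {a<..<b}"
          then have "\<bar>x - r\<bar> < sqrt \<delta>" using a b by auto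
          then have "\<bar>x - r\<bar>\<^sup>2 < (sqrt \<delta>)\<^sup>2" by (intro power_strict_mono) auto
          then show "x \<in> {x. (x - r)\<^sup>2 < \<delta>}" using \<open>\<delta> > 0\<close> by simp
        qed
        have "{x. (x - r)\<^sup>2 < \<delta>} \<in> sets borel" by measurable
        with mono[OF pos sub] show "emeasure (\<nu> \<omega>) (D \<omega> \<inter> {x. (x - r)\<^sup>2 < \<delta>}) \<noteq> 0" .
      qed
    qed
    show ?case
      unfolding complex_support_def
    proof (intro equalityI subsetI)
      fix z assume "z \<in> {z. \<forall>\<delta>>0. emeasure (\<nu> \<omega>) (D \<omega> \<inter> {x. (x - Re z)\<^sup>2 + (Im z)\<^sup>2 < \<delta>}) \<noteq> 0}"
      then have *: "\<And>\<delta>. \<delta> > 0 \<Longrightarrow> emeasure (\<nu> \<omega>) (D \<omega> \<inter> {x. (x - Re z)\<^sup>2 + (Im z)\<^sup>2 < \<delta>}) \<noteq> 0" by blast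
      have "Im z = 0"
      proof (rule ccontr)
        assume "Im z \<noteq> 0"
        \<comment> \<open>With \<delta> equal to this square, no real x satisfies the
          inequality.\<close>
        then have "(Im z)\<^sup>2 > 0" by simp
        from *[OF this] show False by (simp add: not_less)
      qed
      moreover from this have "Re z \<in> S" using * key[of "Re z"] by simp
      ultimately show "z \<in> complex_of_real ` S" by (intro image_eqI[of _ _ "Re z"]) (simp_all add: complex_eq_iff)
    next
      fix z assume "z \<in> complex_of_real ` S"
      then obtain r where r: "r \<in> S" "z = complex_of_real r" by blast
      show "z \<in> {z. \<forall>\<delta>>0. emeasure (\<nu> \<omega>) (D \<omega> \<inter> {x. (x - Re z)\<^sup>2 + (Im z)\<^sup>2 < \<delta>}) \<noteq> 0}"
        using key[of r] r by simp
    qed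
  qed
  with \<open>compact S\<close> show ?thesis by (rule that)
qed

lemma spectra_eq:
  assumes \<omega>: "\<omega> \<in> space M"
  shows "ac_spectrum (hamiltonian M T f \<omega>) = complex_support (\<nu> \<omega>) (ac_set (\<nu> \<omega>))"
    and "sc_spectrum (hamiltonian M T f \<omega>) = complex_support (\<nu> \<omega>) (sc_set (\<nu> \<omega>))"
    and "pp_spectrum (hamiltonian M T f \<omega>) = complex_support (\<nu> \<omega>) (pp_set (\<nu> \<omega>))"
proof -
  interpret schroedinger_operator "potential_at \<omega>" C by (rule schroedinger_operator_at) fact
  interpret m: real_distribution max_meas by (rule real_distribution_max_meas)
  show "ac_spectrum (hamiltonian M T f \<omega>) = complex_support (\<nu> \<omega>) (ac_set (\<nu> \<omega>))"
    "sc_spectrum (hamiltonian M T f \<omega>) = complex_support (\<nu> \<omega>) (sc_set (\<nu> \<omega>))"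
    "pp_spectrum (hamiltonian M T f \<omega>) = complex_support (\<nu> \<omega>) (pp_set (\<nu> \<omega>))"
    by (simp_all add: hamiltonian_eq ac_spectrum_def sc_spectrum_def pp_spectrum_def subspaces_eq
        spectrum_on_range \<nu>_def H_def)
qed

text \<open>Collects what \<open>part_spectrum_constant\<close> asks for, with Q each type of
  measure in turn.\<close>

lemma decomposition_at:
  assumes \<omega>: "\<omega> \<in> space M"
  shows "ac_set (\<nu> \<omega>) \<in> sets borel" "sc_set (\<nu> \<omega>) \<in> sets borel" "pp_set (\<nu> \<omega>) \<in> sets borel"
    and "absolutely_continuous lborel (\<mu> \<omega> u) \<longleftrightarrow> emeasure (\<mu> \<omega> u) (- ac_set (\<nu> \<omega>)) = 0"
    and "singular_continuous (\<mu> \<omega> u) \<longleftrightarrow> emeasure (\<mu> \<omega> u) (- sc_set (\<nu> \<omega>)) = 0"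
    and "pure_point (\<mu> \<omega> u) \<longleftrightarrow> emeasure (\<mu> \<omega> u) (- pp_set (\<nu> \<omega>)) = 0"
proof -
  interpret complex_operator "H \<omega>" "2 + C" basis_vec imag_unit by (rule complex_operator_at) fact
  interpret m: real_distribution max_meas by (rule real_distribution_max_meas)
  note classify = classify_by_decomposition[OF m.finite_borel_measure_M finite_borel_measure_spectral_meas
      null_sets_max_meas_spectral_meas, simplified]
  show "ac_set (\<nu> \<omega>) \<in> sets borel" "sc_set (\<nu> \<omega>) \<in> sets borel" "pp_set (\<nu> \<omega>) \<in> sets borel"
    by (simp_all add: \<nu>_def)
  show "absolutely_continuous lborel (\<mu> \<omega> u) \<longleftrightarrow> emeasure (\<mu> \<omega> u) (- ac_set (\<nu> \<omega>)) = 0"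
    "singular_continuous (\<mu> \<omega> u) \<longleftrightarrow> emeasure (\<mu> \<omega> u) (- sc_set (\<nu> \<omega>)) = 0"
    "pure_point (\<mu> \<omega> u) \<longleftrightarrow> emeasure (\<mu> \<omega> u) (- pp_set (\<nu> \<omega>)) = 0"
    unfolding \<mu>_def \<nu>_def by (rule classify; assumption)+
qed

end

theorem theorem4p6:
  fixes M :: "'a measure" and T :: "'a \<Rightarrow> 'a" and f :: "'a \<Rightarrow> real"
  assumes "sigma_finite_measure M"
    and "emeasure M (space M) = \<infinity>"
    and "conservative M T"
    and "invertible_map M T"
    and "ergodic M T"
    and "measure_preserving M T"
    and "bounded (f ` space M)"
    and "f \<in> borel_measurable M"
  shows "\<exists>\<Sigma>ac \<Sigma>sc \<Sigma>pp :: real set.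
           compact \<Sigma>ac \<and> compact \<Sigma>sc \<and> compact \<Sigma>pp \<and>
           (AE \<omega> in M.
              ac_spectrum (hamiltonian M T f \<omega>) = complex_of_real ` \<Sigma>ac \<and>
              sc_spectrum (hamiltonian M T f \<omega>) = complex_of_real ` \<Sigma>sc \<and>
              pp_spectrum (hamiltonian M T f \<omega>) = complex_of_real ` \<Sigma>pp)"
proof -
  obtain C where C: "\<And>\<omega>. \<omega> \<in> space M \<Longrightarrow> \<bar>f \<omega>\<bar> \<le> C"
    using assms(7) by (auto simp: bounded_iff)
  interpret ergodic_schroedinger M T f C by unfold_locales (use assms C in auto)
  \<comment> \<open>The masses of the three parts on a fixed Borel set, as measurable functions of
    \<omega>.\<close>
  note joint = emeasure_decomposition_measurable[OF \<nu>_kernel]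
  obtain Sac where ac: "compact Sac" "AE \<omega> in M. complex_support (\<nu> \<omega>) (ac_set (\<nu> \<omega>)) = complex_of_real ` Sac"
    by (rule part_spectrum_constant[OF joint(1) decomposition_at(1,4)])
  obtain Ssc where sc: "compact Ssc" "AE \<omega> in M. complex_support (\<nu> \<omega>) (sc_set (\<nu> \<omega>)) = complex_of_real ` Ssc"
    by (rule part_spectrum_constant[OF joint(2) decomposition_at(2,5)])
  obtain Spp where pp: "compact Spp" "AE \<omega> in M. complex_support (\<nu> \<omega>) (pp_set (\<nu> \<omega>)) = complex_of_real ` Spp"
    by (rule part_spectrum_constant[OF joint(3) decomposition_at(3,6)])
  have "AE \<omega> in M. ac_spectrum (hamiltonian M T f \<omega>) = complex_of_real ` Sac \<and>
      sc_spectrum (hamiltonian M T f \<omega>) = complex_of_real ` Ssc \<and>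
      pp_spectrum (hamiltonian M T f \<omega>) = complex_of_real ` Spp"
    using ac(2) sc(2) pp(2) AE_space by eventually_elim (simp add: spectra_eq)
  with ac(1) sc(1) pp(1) show ?thesis by blast
qed

end
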